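(* Let $d\ge 0$. If $\mathsf T^{2d+1}\to\mathsf{SO}(V)$ is a faithful representation, then there exists a $d$-dimensional subgroup $\mathsf H\subseteq \mathsf T^{2d+1}$ such that the induced representation $\mathsf T^{2d+1}/\mathsf H\to\mathsf{SO}(V^{\mathsf H})$ is faithful and has exactly $d+1$ non-trivial, pairwise inequivalent, irreducible subrepresentations. In particular, there exist $d+1$ circles in $\mathsf T^{2d+1}/\mathsf H$ whose fixed-point sets in $V^{\mathsf H}$ intersect pairwise transversely.
   Context: $\mathsf T^{k}$ is the $k$-dimensional torus and $V$ is a finite-dimensional real Euclidean vector space. Subgroups are closed and need not be connected (for $d=0$, $\mathsf H$ is a finite group). $V^{\mathsf H}$ is the subspace of vectors fixed by $\mathsf H$. Subrepresentations are real, and "exactly $d+1$" counts equivalence classes of non-trivial irreducible subrepresentations. *)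

theory Defs
  imports
    "HOL-Analysis.Analysis"
    "HOL-Algebra.Coset"
    "HOL-Algebra.Bij"
    "HOL-Algebra.Product_Groups"
begin

text \<open>
  A topological group is given by a group in the sense of HOL-Algebra together with an
  abstract topology on its carrier. Finite-dimensional Euclidean vector spaces are linear
  subspaces of an arbitrary \<^class>\<open>euclidean_space\<close>, so that a space and the fixed-point
  spaces inside it are treated uniformly.
\<close>

section \<open>Tori\<close>

definition circle_group :: "complex monoid" where
  "circle_group = \<lparr>carrier = sphere 0 1, monoid.mult = (*), one = 1\<rparr>"

abbreviation circle_top :: "complex topology" where
  "circle_top \<equiv> top_of_set (sphere 0 1)"

definition torus :: "nat \<Rightarrow> (nat \<Rightarrow> complex) monoid" where
  "torus k = product_group {..<k} (\<lambda>_. circle_group)"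

definition torus_top :: "nat \<Rightarrow> (nat \<Rightarrow> complex) topology" where
  "torus_top k = product_topology (\<lambda>_. circle_top) {..<k}"

section \<open>Dimension, quotients and circle subgroups\<close>

text \<open>
  The dimension of a closed subgroup of a torus is its dimension as a manifold. Subspaces of
  tori are Hausdorff and second countable, so only the local Euclidean condition is required.
\<close>

definition locally_euclidean :: "nat \<Rightarrow> 'a topology \<Rightarrow> bool" where
  "locally_euclidean d X \<longleftrightarrow>
     (\<forall>x\<in>topspace X. \<exists>U W. openin X U \<and> x \<in> U \<and> openin (Euclidean_space d) W \<and>
        subtopology X U homeomorphic_space subtopology (Euclidean_space d) W)"

definition closed_subgroup_of_dim ::
    "nat \<Rightarrow> ('a, 'm) monoid_scheme \<Rightarrow> 'a topology \<Rightarrow> 'a set \<Rightarrow> bool" where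
  "closed_subgroup_of_dim d G X H \<longleftrightarrow>
     subgroup H G \<and> closedin X H \<and> locally_euclidean d (subtopology X H)"

definition quotient_top :: "'a topology \<Rightarrow> ('a \<Rightarrow> 'b) \<Rightarrow> 'b topology" where
  "quotient_top X q =
     topology (\<lambda>U. U \<subseteq> q ` topspace X \<and> openin X {x \<in> topspace X. q x \<in> U})"

lemma openin_quotient_top:
  "openin (quotient_top X q) U \<longleftrightarrow>
     U \<subseteq> q ` topspace X \<and> openin X {x \<in> topspace X. q x \<in> U}"
proof -
  let ?pre = "\<lambda>U. {x \<in> topspace X. q x \<in> U}"
  let ?P = "\<lambda>U. U \<subseteq> q ` topspace X \<and> openin X (?pre U)"
  have inter: "?P (S \<inter> T)" if "?P S" "?P T" for S T
  proof -
    have "?pre (S \<inter> T) = ?pre S \<inter> ?pre T" by blast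
    moreover have "openin X (?pre S \<inter> ?pre T)"
      by (rule openin_Int[OF conjunct2[OF that(1)] conjunct2[OF that(2)]])
    moreover have "S \<inter> T \<subseteq> q ` topspace X"
      by (rule le_infI1[OF conjunct1[OF that(1)]])
    ultimately show ?thesis by (simp only: simp_thms)
  qed
  have union: "?P (\<Union>\<K>)" if "\<forall>S\<in>\<K>. ?P S" for \<K>
  proof -
    have "?pre (\<Union>\<K>) = \<Union> (?pre ` \<K>)" by blast
    moreover have "openin X (\<Union> (?pre ` \<K>))"
      using that by (intro openin_Union) blast
    moreover have "\<Union>\<K> \<subseteq> q ` topspace X"
      using that by (intro Union_least) blast
    ultimately show ?thesis by (simp only: simp_thms)
  qed
  have "istopology ?P"
    unfolding istopology_def
    by (rule conjI; intro allI impI; (erule (1) inter | erule union))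
  then have "openin (topology ?P) = ?P"
    by (rule topology_inverse')
  then show ?thesis
    unfolding quotient_top_def by (rule fun_cong)
qed

lemma topspace_quotient_top: "topspace (quotient_top X q) = q ` topspace X"
proof
  show "topspace (quotient_top X q) \<subseteq> q ` topspace X"
    using openin_topspace[of "quotient_top X q"] unfolding openin_quotient_top
    by (rule conjunct1)
  have "{x \<in> topspace X. q x \<in> q ` topspace X} = topspace X" by auto
  then have "openin (quotient_top X q) (q ` topspace X)"
    by (simp add: openin_quotient_top)
  then show "q ` topspace X \<subseteq> topspace (quotient_top X q)"
    by (rule openin_subset)
qed

lemma quotient_map_quotient_top: "quotient_map X (quotient_top X q) q"
  by (auto simp: quotient_map_def topspace_quotient_top openin_quotient_top)

definition quotient_group_top ::
    "('a, 'm) monoid_scheme \<Rightarrow> 'a topology \<Rightarrow> 'a set \<Rightarrow> 'a set topology" where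
  "quotient_group_top G X H = quotient_top X (\<lambda>g. H #>\<^bsub>G\<^esub> g)"

definition circle_subgroup ::
    "('a, 'm) monoid_scheme \<Rightarrow> 'a topology \<Rightarrow> 'a set \<Rightarrow> bool" where
  "circle_subgroup G X C \<longleftrightarrow> subgroup C G \<and>
     (\<exists>\<phi>. \<phi> \<in> iso circle_group (G\<lparr>carrier := C\<rparr>) \<and>
          homeomorphic_map circle_top (subtopology X C) \<phi>)"

section \<open>The special orthogonal group of a subspace\<close>

definition orthonormal_basis_of :: "'v::euclidean_space set \<Rightarrow> 'v set \<Rightarrow> bool" where
  "orthonormal_basis_of V B \<longleftrightarrow>
     B \<subseteq> V \<and> pairwise orthogonal B \<and> (\<forall>b\<in>B. norm b = 1) \<and> span B = V"

text \<open>
  The Leibniz formula for the matrix with entries \<open>c \<bullet> f b\<close> for \<open>b, c \<in> B\<close>. For a linear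
  \<open>f\<close> from \<open>V\<close> to \<open>V\<close> the value does not depend on the orthonormal basis \<open>B\<close>.
\<close>

definition det_on :: "'v::euclidean_space set \<Rightarrow> ('v \<Rightarrow> 'v) \<Rightarrow> real" where
  "det_on V f =
     (let B = SOME B. orthonormal_basis_of V B
      in \<Sum>p | p permutes B. of_int (sign p) * (\<Prod>b\<in>B. p b \<bullet> f b))"

definition SO_carrier :: "'v::euclidean_space set \<Rightarrow> ('v \<Rightarrow> 'v) set" where
  "SO_carrier V = {f \<in> Bij V.
     (\<forall>x\<in>V. \<forall>y\<in>V. f (x + y) = f x + f y) \<and>
     (\<forall>c. \<forall>x\<in>V. f (c *\<^sub>R x) = c *\<^sub>R f x) \<and>
     (\<forall>x\<in>V. \<forall>y\<in>V. f x \<bullet> f y = x \<bullet> y) \<and>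
     det_on V f = 1}"

definition SO_group :: "'v::euclidean_space set \<Rightarrow> ('v \<Rightarrow> 'v) monoid" where
  "SO_group V = (BijGroup V)\<lparr>carrier := SO_carrier V\<rparr>"

text \<open>
  Pointwise convergence on \<open>V\<close>; as \<open>V\<close> is finite-dimensional, this is the usual (matrix)
  topology.
\<close>

definition SO_top :: "'v::euclidean_space set \<Rightarrow> ('v \<Rightarrow> 'v) topology" where
  "SO_top V = subtopology (product_topology (\<lambda>_. euclidean) V) (SO_carrier V)"

section \<open>Representations\<close>

definition SO_representation ::
    "('a, 'm) monoid_scheme \<Rightarrow> 'a topology \<Rightarrow> 'v::euclidean_space set
      \<Rightarrow> ('a \<Rightarrow> 'v \<Rightarrow> 'v) \<Rightarrow> bool" where
  "SO_representation G X V \<rho> \<longleftrightarrow>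
     \<rho> \<in> hom G (SO_group V) \<and> continuous_map X (SO_top V) \<rho>"

definition faithful :: "('a, 'm) monoid_scheme \<Rightarrow> ('a \<Rightarrow> 'v \<Rightarrow> 'v) \<Rightarrow> bool" where
  "faithful G \<rho> \<longleftrightarrow> inj_on \<rho> (carrier G)"

definition fixed_space :: "('a \<Rightarrow> 'v \<Rightarrow> 'v) \<Rightarrow> 'v set \<Rightarrow> 'a set \<Rightarrow> 'v set" where
  "fixed_space \<rho> V H = {v \<in> V. \<forall>h\<in>H. \<rho> h v = v}"

text \<open>
  On a coset of \<open>H\<close> all elements act in the same way on the vectors fixed by \<open>H\<close>, so the
  image below is a singleton.
\<close>

definition induced_rep ::
    "('a \<Rightarrow> 'v \<Rightarrow> 'v) \<Rightarrow> 'v set \<Rightarrow> 'a set \<Rightarrow> 'a set \<Rightarrow> 'v \<Rightarrow> 'v" where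
  "induced_rep \<rho> V H = (\<lambda>K. the_elem ((\<lambda>g. restrict (\<rho> g) (fixed_space \<rho> V H)) ` K))"

definition subrepresentation ::
    "('a, 'm) monoid_scheme \<Rightarrow> 'v::euclidean_space set \<Rightarrow> ('a \<Rightarrow> 'v \<Rightarrow> 'v)
      \<Rightarrow> 'v set \<Rightarrow> bool" where
  "subrepresentation G V \<rho> W \<longleftrightarrow>
     subspace W \<and> W \<subseteq> V \<and> (\<forall>g\<in>carrier G. \<rho> g ` W \<subseteq> W)"

definition irreducible_subrep ::
    "('a, 'm) monoid_scheme \<Rightarrow> 'v::euclidean_space set \<Rightarrow> ('a \<Rightarrow> 'v \<Rightarrow> 'v)
      \<Rightarrow> 'v set \<Rightarrow> bool" where
  "irreducible_subrep G V \<rho> W \<longleftrightarrow>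
     subrepresentation G V \<rho> W \<and> W \<noteq> {0} \<and>
     (\<forall>U. subrepresentation G V \<rho> U \<and> U \<subseteq> W \<longrightarrow> U = {0} \<or> U = W)"

definition nontrivial_subrep ::
    "('a, 'm) monoid_scheme \<Rightarrow> ('a \<Rightarrow> 'v \<Rightarrow> 'v) \<Rightarrow> 'v set \<Rightarrow> bool" where
  "nontrivial_subrep G \<rho> W \<longleftrightarrow> (\<exists>g\<in>carrier G. \<exists>w\<in>W. \<rho> g w \<noteq> w)"

definition equivalent_subreps ::
    "('a, 'm) monoid_scheme \<Rightarrow> ('a \<Rightarrow> 'v \<Rightarrow> 'v) \<Rightarrow> 'v::euclidean_space set \<Rightarrow> 'v set
      \<Rightarrow> bool" where
  "equivalent_subreps G \<rho> W W' \<longleftrightarrow>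
     (\<exists>f. linear f \<and> bij_betw f W W' \<and>
          (\<forall>g\<in>carrier G. \<forall>w\<in>W. f (\<rho> g w) = \<rho> g (f w)))"

definition nontrivial_irreps ::
    "('a, 'm) monoid_scheme \<Rightarrow> 'v::euclidean_space set \<Rightarrow> ('a \<Rightarrow> 'v \<Rightarrow> 'v)
      \<Rightarrow> 'v set set" where
  "nontrivial_irreps G V \<rho> =
     {W. irreducible_subrep G V \<rho> W \<and> nontrivial_subrep G \<rho> W}"

definition nontrivial_irrep_classes ::
    "('a, 'm) monoid_scheme \<Rightarrow> 'v::euclidean_space set \<Rightarrow> ('a \<Rightarrow> 'v \<Rightarrow> 'v)
      \<Rightarrow> 'v set set set" where
  "nontrivial_irrep_classes G V \<rho> =
     nontrivial_irreps G V \<rho> //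
       {(W, W'). W \<in> nontrivial_irreps G V \<rho> \<and> W' \<in> nontrivial_irreps G V \<rho> \<and>
                 equivalent_subreps G \<rho> W W'}"

text \<open>
  Linear subspaces \<open>A\<close> and \<open>B\<close> of \<open>V\<close> are their own tangent spaces at every point, so
  transversality in \<open>V\<close> means that they span \<open>V\<close> together.
\<close>

definition transverse_in ::
    "'v::real_vector set \<Rightarrow> 'v set \<Rightarrow> 'v set \<Rightarrow> bool" where
  "transverse_in V A B \<longleftrightarrow> {a + b | a b. a \<in> A \<and> b \<in> B} = V"

end

theory Submission
  imports Defs
begin

text \<open>
  Write \<open>n = 2 * d + 1\<close>. A representation of the torus splits \<open>V\<close> orthogonally into weight spaces,
  indexed by weights \<open>a\<close> in the character lattice inside an \<open>n\<close>-dimensional space and taken up to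
  sign, because the representation is real. Faithfulness forces the finite set of non-zero weights to
  span that space (\<open>span_weights\<close>). Let \<open>F\<close> be a linearly independent set of weights and \<open>H\<close> the
  common kernel of the corresponding characters. Then \<open>H\<close> is a closed subgroup of dimension
  \<open>n - card F\<close> (\<open>locally_euclidean_H\<close>), and by duality a weight is trivial on \<open>H\<close> exactly when it lies
  in the integer span of \<open>F\<close> (\<open>int_span_if_annihilated\<close>). So if the integer span of \<open>F\<close> contains no
  non-zero weights besides those of \<open>F\<close> and their negatives, then \<open>V\<^sup>H\<close> is the sum of the trivial
  part and of the isotypic components of the weights in \<open>F\<close> (\<open>common_fixed_eq_span\<close>). All claims can
  then be read off: the characters in \<open>F\<close> identify the quotient by \<open>H\<close> with a torus of rank \<open>card F\<close>,
  there is one class of non-trivial irreducibles for each member of \<open>F\<close>, and the coordinate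
  circles have fixed-point sets that miss only one isotypic component each.

  The heart of the matter is thus a statement about a finite set \<open>S = - S\<close> of real vectors of rank
  \<open>n\<close>: it contains independent vectors, at least half of \<open>n\<close> in number, whose integer span meets \<open>S\<close>
  in nothing else up to sign and zero (\<open>half_rank_int_closed_independent\<close>). For the roots \<open>e\<^sub>i - e\<^sub>j\<close> of
  a complete graph on an even number of vertices this is a perfect matching. The general proof has
  three steps.

  Among the bases of the span that are contained in \<open>S\<close>, take one whose integer span is minimal for
  inclusion, and restrict attention to the members \<open>S'\<close> of \<open>S\<close> in that lattice. Every basis contained
  in \<open>S'\<close> then generates the same lattice: \<open>S'\<close> is a unimodular system (\<open>minimal_int_basis\<close>).

  The hyperplane arrangement dual to \<open>S'\<close> has a simplicial chamber. In other words, \<open>S'\<close> contains a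
  basis \<open>B\<close> such that each member of \<open>S'\<close> is, up to sign, a combination of \<open>B\<close> with non-negative
  coefficients (\<open>simplicial_basis_exists\<close>). These coefficients are integers.

  Finally \<open>B\<close> can be coloured with two colours such that in each of these combinations the two colours
  are balanced up to one. This is the theorem of Ghouila-Houri on totally unimodular matrices, and the
  proof is by rounding: the functional with value 1/2 on \<open>B\<close> can be moved, without leaving the interval
  between the floor and the ceiling of its initial value at any member of \<open>S'\<close>, until it is integral on
  a basis (\<open>integral_rounding\<close>) and hence, by unimodularity, on \<open>S'\<close>. A non-zero member of \<open>S'\<close> that
  is a combination of a single colour class is then a single element of \<open>B\<close> up to sign, so either
  colour class is as required, and the larger one is large enough.
\<close>

section \<open>Simplicial chambers of hyperplane arrangements\<close>

lemma exists_dual_vector: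
  fixes B :: "'a::euclidean_space set"
  assumes "independent B" "b \<in> B"
  obtains v where "v \<in> span B" "b \<bullet> v = 1" "\<And>c. c \<in> B - {b} \<Longrightarrow> c \<bullet> v = 0"
proof -
  obtain y z where y: "y \<in> span (B - {b})"
    and z: "\<And>w. w \<in> span (B - {b}) \<Longrightarrow> orthogonal z w" and b: "b = y + z"
    using orthogonal_subspace_decomp_exists[of "B - {b}" b] by metis
  have "b \<notin> span (B - {b})" using assms by (auto simp: dependent_def)
  then have "z \<noteq> 0" using b y by auto
  have "z = b - y" using b by simp
  moreover have "y \<in> span B" using y span_mono[of "B - {b}" B] by blast
  ultimately have zs: "z \<in> span B" using assms(2) by (simp add: span_base span_diff)
  have bz: "b \<bullet> z = z \<bullet> z" using z[OF y] b by (metis add_0 inner_add_right inner_commute orthogonal_def)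
  show ?thesis
  proof (rule that[of "(1 / (z \<bullet> z)) *\<^sub>R z"])
    show "(1 / (z \<bullet> z)) *\<^sub>R z \<in> span B" using zs by (rule span_scale)
    show "b \<bullet> ((1 / (z \<bullet> z)) *\<^sub>R z) = 1" using bz \<open>z \<noteq> 0\<close> by simp
    show "c \<bullet> ((1 / (z \<bullet> z)) *\<^sub>R z) = 0" if "c \<in> B - {b}" for c
      using z[OF span_base[OF that]] by (simp add: orthogonal_def inner_commute)
  qed
qed

lemma exists_functional_on_basis:
  fixes B :: "'a::euclidean_space set"
  assumes "independent B"
  obtains h where "h \<in> span B" "\<And>b. b \<in> B \<Longrightarrow> b \<bullet> h = f b"
proof -
  have fin: "finite B" using assms by (rule independent_imp_finite)
  have "\<forall>b\<in>B. \<exists>v. v \<in> span B \<and> b \<bullet> v = 1 \<and> (\<forall>c\<in>B - {b}. c \<bullet> v = 0)"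
    using exists_dual_vector[OF assms] by metis
  then obtain w where w: "\<And>b. b \<in> B \<Longrightarrow> w b \<in> span B \<and> b \<bullet> w b = 1 \<and> (\<forall>c\<in>B - {b}. c \<bullet> w b = 0)"
    by metis
  show ?thesis
  proof (rule that[of "\<Sum>b\<in>B. f b *\<^sub>R w b"])
    show "(\<Sum>b\<in>B. f b *\<^sub>R w b) \<in> span B" using w by (simp add: span_sum span_scale)
    fix b assume b: "b \<in> B"
    have "b \<bullet> (\<Sum>b\<in>B. f b *\<^sub>R w b) = (\<Sum>c\<in>B. if c = b then f b else 0)"
      unfolding inner_sum_right by (rule sum.cong) (use w b in auto)
    then show "b \<bullet> (\<Sum>b\<in>B. f b *\<^sub>R w b) = f b" using fin b by simp
  qed
qed

lemma finite_span_coeffs: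
  assumes "finite B" "x \<in> span B"
  obtains c where "x = (\<Sum>b\<in>B. c b *\<^sub>R b)"
  using assms(2) unfolding span_finite[OF assms(1)] by auto

text \<open>
  A line that is not contained in any of the subspaces meets each of them in at most one point.
\<close>

lemma span_not_finite_union_subspaces:
  fixes U :: "'a::real_vector set"
  assumes "finite \<U>" "subspace U" "\<And>W. W \<in> \<U> \<Longrightarrow> subspace W \<and> \<not> U \<subseteq> W"
  shows "\<exists>x\<in>U. \<forall>W\<in>\<U>. x \<notin> W"
  using assms(1,3)
proof (induction \<U> rule: finite_induct)
  case empty
  then show ?case using assms(2) subspace_0 by auto
next
  case (insert W \<U>)
  then obtain x where x: "x \<in> U" "\<And>W'. W' \<in> \<U> \<Longrightarrow> x \<notin> W'" by auto
  show ?case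
  proof (cases "x \<in> W")
    case False
    then show ?thesis using x by blast
  next
    case True
    obtain y where y: "y \<in> U" "y \<notin> W" using insert.prems by blast
    define bad where "bad W' = {r::real. y + r *\<^sub>R x \<in> W'}" for W'
    have "finite (bad W')" if "W' \<in> \<U>" for W'
    proof -
      have "r = r'" if r: "r \<in> bad W'" "r' \<in> bad W'" for r r'
      proof (rule ccontr)
        assume "r \<noteq> r'"
        have sub: "subspace W'" using insert.prems \<open>W' \<in> \<U>\<close> by simp
        have "(y + r *\<^sub>R x) - (y + r' *\<^sub>R x) \<in> W'"
          using r sub unfolding bad_def by (blast intro: subspace_diff)
        then have "(r - r') *\<^sub>R x \<in> W'" by (simp add: algebra_simps)
        then have "(1 / (r - r')) *\<^sub>R (r - r') *\<^sub>R x \<in> W'"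
          using sub by (blast intro: subspace_scale)
        then show False using \<open>r \<noteq> r'\<close> \<open>W' \<in> \<U>\<close> x(2) by simp
      qed
      then show ?thesis by (metis finite.emptyI finite_insert finite_subset insertI1 subsetI)
    qed
    then have "finite (\<Union>W'\<in>\<U>. bad W')" using insert.hyps by simp
    then obtain r where r: "r \<notin> (\<Union>W'\<in>\<U>. bad W')"
      using infinite_UNIV_char_0 by (metis UNIV_I finite_subset subsetI)
    have "y + r *\<^sub>R x \<notin> W"
    proof
      assume "y + r *\<^sub>R x \<in> W"
      moreover have "subspace W" using insert.prems by simp
      moreover have "r *\<^sub>R x \<in> W" using calculation(2) True by (simp add: subspace_scale)
      ultimately have "y \<in> W" by (metis add_diff_cancel_right' subspace_diff)
      with y show False by simp
    qed
    moreover have "y + r *\<^sub>R x \<in> U" using y x assms(2) by (simp add: subspace_add subspace_scale)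
    ultimately show ?thesis using r unfolding bad_def by blast
  qed
qed

text \<open>
  Meaningful for finite \<open>B\<close> only.
\<close>

definition in_cone :: "'a::real_vector set \<Rightarrow> 'a \<Rightarrow> bool" where
  "in_cone B x \<longleftrightarrow> (\<exists>c. (\<forall>b\<in>B. 0 \<le> c b) \<and> x = (\<Sum>b\<in>B. c b *\<^sub>R b))"

text \<open>
  Shannon's argument that an arrangement of hyperplanes has a simplicial chamber. A member \<open>s\<close> of \<open>S\<close>
  is regarded as the hyperplane orthogonal to it, and the functional \<open>\<delta>\<close> as the hyperplane at infinity.
  Fix a hyperplane \<open>g\<close> and choose a vertex \<open>v\<close> of the arrangement off \<open>g\<close> that is nearest to \<open>g\<close> in
  the affine chart where \<open>\<delta>\<close> is 1. The hyperplanes through \<open>v\<close> form an arrangement of smaller rank,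
  which has a simplicial chamber by induction. Cut off by \<open>g\<close> it becomes a simplex with apex \<open>v\<close>; a
  further hyperplane that cuts this simplex would meet an edge issuing from \<open>v\<close> in a vertex nearer to
  \<open>g\<close>. That \<open>\<delta>\<close> is non-negative on the chamber is part of the induction because the simplex must not
  reach to infinity; genericity of \<open>\<delta>\<close> excludes vertices at infinity.
\<close>

lemma simplicial_basis_aux:
  fixes S :: "'a::euclidean_space set"
  assumes "finite S" "\<And>s. s \<in> S \<Longrightarrow> -s \<in> S" "\<delta> \<in> span S"
    and "\<And>T. T \<subseteq> S \<Longrightarrow> dim T < dim S \<Longrightarrow> \<delta> \<notin> span T"
    and "dim S = n"
  shows "\<exists>B\<subseteq>S. independent B \<and> span B = span S \<and> in_cone B \<delta> \<and> (\<forall>s\<in>S. in_cone B s \<or> in_cone B (- s))"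
  using assms
proof (induction n arbitrary: S \<delta>)
  case 0
  then have "S \<subseteq> {0}" by (simp add: dim_eq_0)
  moreover have "span S = {0}" using \<open>S \<subseteq> {0}\<close> by (metis span_empty span_insert_0 subset_singletonD)
  ultimately show ?case using 0(3) by (intro exI[of _ "{}"]) (auto simp: in_cone_def independent_empty)
next
  case (Suc n)
  note fin = Suc.prems(1) and sym = Suc.prems(2) and gen = Suc.prems(4) and dimS = Suc.prems(5)
  have "\<delta> \<noteq> 0" using gen[of "{}"] dimS by auto
  obtain B0 where B0: "B0 \<subseteq> S" "independent B0" "S \<subseteq> span B0" "card B0 = dim S"
    using basis_exists[of S] by blast
  have spanB0: "span B0 = span S" using B0(1,3) span_mono[OF B0(1)] span_minimal[OF B0(3) subspace_span] by blast
  have finB0: "finite B0" using B0 fin finite_subset by blast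
  obtain c where c: "\<delta> = (\<Sum>b\<in>B0. c b *\<^sub>R b)"
    using finite_span_coeffs[OF finB0] Suc.prems(3) spanB0 by metis
  have "\<exists>g0\<in>B0. c g0 \<noteq> 0"
  proof (rule ccontr)
    assume "\<not> (\<exists>g0\<in>B0. c g0 \<noteq> 0)"
    then have "\<delta> = 0" unfolding c by (intro sum.neutral) auto
    with \<open>\<delta> \<noteq> 0\<close> show False by simp
  qed
  then obtain g0 where g0: "g0 \<in> B0" "c g0 \<noteq> 0" by blast
  obtain v0 where v0: "v0 \<in> span B0" "g0 \<bullet> v0 = 1" "\<And>c. c \<in> B0 - {g0} \<Longrightarrow> c \<bullet> v0 = 0"
    using exists_dual_vector[OF B0(2) g0(1)] by metis
  have "\<delta> \<bullet> v0 = (\<Sum>b\<in>B0. if b = g0 then c g0 else 0)"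
    unfolding c inner_sum_left by (rule sum.cong) (use v0 in auto)
  then have lv0: "\<delta> \<bullet> v0 = c g0" using finB0 g0 by simp
  define g where "g = (if c g0 > 0 then g0 else - g0)"
  have gS: "g \<in> S" using g0 B0 sym unfolding g_def by auto
  \<comment> \<open>The set \<open>R\<close> consists of the vertices of the arrangement in the affine chart \<open>\<delta> \<bullet> v = 1\<close>, on the
  positive side of \<open>g\<close>. A vertex is determined by the hyperplanes \<open>Z v\<close> through it.\<close>
  define Z where "Z v = {s \<in> S. s \<bullet> v = 0}" for v
  define R where "R = {v \<in> span S. \<delta> \<bullet> v = 1 \<and> g \<bullet> v > 0 \<and> n \<le> dim (Z v)}"
  have "(1 / c g0) *\<^sub>R v0 \<in> R"
  proof -
    have "B0 - {g0} \<subseteq> Z ((1 / c g0) *\<^sub>R v0)" using v0 B0 unfolding Z_def by auto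
    moreover have "card (B0 - {g0}) = n" using g0 finB0 B0(4) dimS by simp
    moreover have "independent (B0 - {g0})" using B0(2) by (rule independent_mono) auto
    ultimately have "n \<le> dim (Z ((1 / c g0) *\<^sub>R v0))" using independent_card_le_dim by metis
    moreover have "g \<bullet> ((1 / c g0) *\<^sub>R v0) > 0" using v0 g0 unfolding g_def by auto
    ultimately show ?thesis unfolding R_def using lv0 g0 v0 spanB0 by (auto simp: span_scale)
  qed
  have dimZ: "dim (Z v) = n" if "v \<in> R" for v
  proof -
    have "v \<notin> span (Z v)"
    proof
      have "x \<bullet> v = 0" if "x \<in> span (Z v)" for x
        using that by (induction rule: span_induct_alt) (auto simp: Z_def inner_add_left)
      moreover assume "v \<in> span (Z v)"
      ultimately have "v \<bullet> v = 0" by blast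
      then show False using that unfolding R_def by auto
    qed
    moreover have "v \<in> span S" using that R_def by auto
    ultimately have "span (Z v) \<noteq> span S" by auto
    moreover have "span (Z v) \<subseteq> span S" by (rule span_mono) (auto simp: Z_def)
    ultimately have "dim (Z v) < dim S" by (metis dim_psubset psubsetI)
    then show ?thesis using that dimS unfolding R_def by auto
  qed
  have hyper: "u \<in> span (insert x T)" 
    if "T \<subseteq> S" "dim T = n" "x \<in> span S" "x \<notin> span T" "u \<in> span S" for T x u
  proof -
    have "dim (insert x T) = Suc n" using that by (simp add: dim_insert)
    moreover have "span (insert x T) \<subseteq> span S" using that by (metis insert_subset span_base span_mono span_span subset_trans subsetI)
    ultimately have "span (insert x T) = span S" using dimS
      by (metis dim_psubset less_irrefl psubsetI dim_span span_span)
    then show ?thesis using that by simp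
  qed
  have "inj_on Z R"
  proof
    fix v v' assume v: "v \<in> R" "v' \<in> R" "Z v = Z v'"
    have ln: "\<delta> \<notin> span (Z v)" using gen[of "Z v"] dimZ[OF v(1)] dimS Z_def by auto
    have "v - v' \<in> span (insert \<delta> (Z v))"
      by (rule hyper) (use v ln dimZ Suc.prems(3) in \<open>auto simp: Z_def R_def span_diff\<close>)
    moreover have "y \<bullet> (v - v') = 0" if "y \<in> span (insert \<delta> (Z v))" for y
      using that
    proof (induction rule: span_induct_alt)
      case (step r x y)
      have "x \<bullet> (v - v') = 0" using step(1) v unfolding Z_def R_def by (auto simp: inner_diff_right)
      then show ?case using step by (simp add: inner_add_left)
    qed simp
    ultimately have "(v - v') \<bullet> (v - v') = 0" by blast
    then show "v = v'" by simp
  qed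
  moreover have "Z ` R \<subseteq> Pow S" unfolding Z_def by auto
  ultimately have "finite R" using fin by (metis finite_Pow_iff inj_on_finite)
  then obtain v where v: "v \<in> R" "\<And>v'. v' \<in> R \<Longrightarrow> g \<bullet> v \<le> g \<bullet> v'"
    using \<open>_ \<in> R\<close> ex_is_arg_min_if_finite[of R "\<lambda>v. g \<bullet> v"] unfolding is_arg_min_linorder by blast
  have gv: "g \<bullet> v > 0" and lv: "\<delta> \<bullet> v = 1" and vs: "v \<in> span S" using v(1) R_def by auto
  define S' where "S' = Z v"
  define \<kappa> where "\<kappa> = 1 / (g \<bullet> v)"
  have S': "S' \<subseteq> S" "finite S'" "dim S' = n" using fin dimZ[OF v(1)] unfolding S'_def Z_def by auto
  have spS'v: "x \<bullet> v = 0" if "x \<in> span S'" for x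
    using that by (induction rule: span_induct_alt) (auto simp: S'_def Z_def inner_add_left)
  have gS': "g \<notin> span S'" using spS'v gv by force
  have gspan: "g \<in> span S" using gS by (rule span_base)
  \<comment> \<open>The functional at infinity for the arrangement through \<open>v\<close>: it agrees with \<open>\<delta>\<close> on the hyperplane
  \<open>g\<close> and vanishes at \<open>v\<close>.\<close>
  define \<delta>' where "\<delta>' = \<delta> - \<kappa> *\<^sub>R g"
  have l'v: "\<delta>' \<bullet> v = 0" unfolding \<delta>'_def \<kappa>_def using lv gv by (simp add: inner_diff_left)
  have "\<delta>' \<in> span (insert g S')"
    by (rule hyper) (use S' gS' gspan Suc.prems(3) in \<open>auto simp: \<delta>'_def span_diff span_scale\<close>)
  then obtain k where k: "\<delta>' - k *\<^sub>R g \<in> span S'" by (auto simp: span_breakdown_eq)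
  then have "(\<delta>' - k *\<^sub>R g) \<bullet> v = 0" by (rule spS'v)
  then have "k = 0" using l'v gv by (simp add: inner_diff_left)
  then have l's: "\<delta>' \<in> span S'" using k by simp
  have lg: "\<delta> = \<delta>' + \<kappa> *\<^sub>R g" unfolding \<delta>'_def by simp
  have ln: "\<delta>' \<notin> span T" if "T \<subseteq> S'" "dim T < n" for T
  proof
    assume "\<delta>' \<in> span T"
    then have "\<delta> \<in> span (insert g T)" unfolding lg
      by (metis (no_types) add.commute insertI1 span_add span_base span_mono span_scale subset_insertI subsetD)
    moreover have "dim (insert g T) < dim S" using that dimS by (auto simp: dim_insert)
    ultimately show False using gen[of "insert g T"] that gS S' by auto
  qed
  have "\<exists>B\<subseteq>S'. independent B \<and> span B = span S' \<and> in_cone B \<delta>' \<and> (\<forall>s\<in>S'. in_cone B s \<or> in_cone B (- s))"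
  proof (rule Suc.IH)
    show "- s \<in> S'" if "s \<in> S'" for s using that sym unfolding S'_def Z_def by auto
  qed (use S' l's ln in auto)
  then obtain B' where B': "B' \<subseteq> S'" "independent B'" "span B' = span S'" "in_cone B' \<delta>'"
    "\<And>s. s \<in> S' \<Longrightarrow> in_cone B' s \<or> in_cone B' (- s)" by blast
  have finB': "finite B'" and gB': "g \<notin> B'"
    using B' S' gS' finite_subset span_base by blast+
  have cardB': "card B' = n" using B' S' by (metis dim_eq_card)
  define B where "B = insert g B'"
  have indB: "independent B" unfolding B_def using B' gS' by (simp add: independent_insertI)
  have spanB: "span B = span S"
  proof -
    have "B \<subseteq> span S" using B' S' gS unfolding B_def by (auto intro: span_base)
    moreover have "u \<in> span B" if "u \<in> span S" for u
    proof -
      have "u \<in> span (insert g S')" by (rule hyper) (use S' gS' gspan that in auto)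
      moreover have "insert g S' \<subseteq> span B" unfolding B_def
        using B'(3) by (metis insert_subset span_base insertI1 span_mono subset_insertI subset_trans span_superset)
      ultimately show ?thesis by (metis span_mono span_span subsetD)
    qed
    ultimately show ?thesis by (metis span_minimal subspace_span subsetI subset_antisym)
  qed
  have cone_ext: "in_cone B (x + t *\<^sub>R g)" if cx: "in_cone B' x" "0 \<le> t" for x t
  proof -
    obtain c where "\<forall>b\<in>B'. 0 \<le> c b" "x = (\<Sum>b\<in>B'. c b *\<^sub>R b)" using cx(1) unfolding in_cone_def by auto
    moreover have "(\<Sum>b\<in>B'. (c(g := t)) b *\<^sub>R b) = (\<Sum>b\<in>B'. c b *\<^sub>R b)"
      by (rule sum.cong) (use gB' in auto)
    ultimately show ?thesis unfolding in_cone_def B_def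
      by (intro exI[of _ "c(g := t)"]) (use that finB' gB' in auto)
  qed
  obtain \<mu> where \<mu>: "\<And>b. b \<in> B' \<Longrightarrow> 0 \<le> \<mu> b" "\<delta>' = (\<Sum>b\<in>B'. \<mu> b *\<^sub>R b)"
    using B'(4) unfolding in_cone_def by auto
  have pos: "in_cone B s" if s: "s \<in> S" "s \<bullet> v > 0" for s
  proof -
    obtain c where "s = (\<Sum>b\<in>B. c b *\<^sub>R b)"
      using finite_span_coeffs[of B s] finB' s(1) spanB by (metis B_def finite_insert span_base)
    then have sc: "s = (\<Sum>b\<in>B'. c b *\<^sub>R b) + c g *\<^sub>R g" using finB' gB' by (simp add: B_def)
    have "(\<Sum>b\<in>B'. c b *\<^sub>R b) \<bullet> v = 0"
      by (rule spS'v) (use B'(1) in \<open>auto intro!: span_sum span_scale intro: span_base\<close>)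
    then have "s \<bullet> v = c g * (g \<bullet> v)" unfolding sc by (simp add: inner_add_left)
    then have cg: "c g > 0" using s gv by (simp add: zero_less_mult_iff)
    have "0 \<le> c j" if j: "j \<in> B'" for j
    proof (rule ccontr)
      assume "\<not> 0 \<le> c j"
      then have cj: "c j < 0" by simp
      obtain w where w: "w \<in> span B" "j \<bullet> w = 1" "\<And>b. b \<in> B - {j} \<Longrightarrow> b \<bullet> w = 0"
        using exists_dual_vector[OF indB] j by (metis B_def insertCI)
      have gw: "g \<bullet> w = 0" using w(3)[of g] j gB' by (auto simp: B_def)
      have coord: "(\<Sum>b\<in>B'. f b *\<^sub>R b) \<bullet> w = f j" for f
      proof -
        have "(\<Sum>b\<in>B'. f b *\<^sub>R b) \<bullet> w = (\<Sum>b\<in>B'. if b = j then f j else 0)"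
          unfolding inner_sum_left by (rule sum.cong) (use w in \<open>auto simp: B_def\<close>)
        then show ?thesis using finB' j by simp
      qed
      have sw: "s \<bullet> w = c j" unfolding sc using coord gw by (simp add: inner_add_left)
      have lw: "\<delta> \<bullet> w = \<mu> j" unfolding lg \<mu>(2) using coord gw by (simp add: inner_add_left)
      have "\<mu> j \<noteq> 0"
      proof
        assume "\<mu> j = 0"
        then have "\<delta>' = (\<Sum>b\<in>B' - {j}. \<mu> b *\<^sub>R b)" unfolding \<mu>(2)
          using sum.remove[OF finB' j, of "\<lambda>b. \<mu> b *\<^sub>R b"] by simp
        then have "\<delta>' \<in> span (B' - {j})" by (auto intro!: span_sum span_scale intro: span_base)
        moreover have "dim (B' - {j}) < n"
          using dim_le_card'[of "B' - {j}"] finB' j cardB' 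
          by (metis card_Diff1_less finite_Diff le_less_trans)
        ultimately show False using ln[of "B' - {j}"] B'(1) by auto
      qed
      then have muj: "\<mu> j > 0" using \<mu>(1)[OF j] by simp
      \<comment> \<open>The edge from \<open>v\<close> in direction \<open>w\<close> meets the hyperplane \<open>s\<close> at \<open>v + r *\<^sub>R w\<close>; in the chart this
      is \<open>u\<close>, which is nearer to \<open>g\<close> than \<open>v\<close>.\<close>
      define r where "r = - (s \<bullet> v) / c j"
      have r: "r > 0" unfolding r_def using s cj by (simp add: divide_pos_neg)
      define m where "m = 1 + r * \<mu> j"
      have m: "m > 1" unfolding m_def using r muj by simp
      define u where "u = (1 / m) *\<^sub>R (v + r *\<^sub>R w)"
      have "s \<bullet> (v + r *\<^sub>R w) = 0" using sw cj unfolding r_def by (simp add: inner_add_right inner_diff_right)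
      then have su: "s \<bullet> u = 0" unfolding u_def by simp
      have lu: "\<delta> \<bullet> u = 1" using lv lw m unfolding u_def m_def by (simp add: inner_add_right)
      have gu: "g \<bullet> u = (g \<bullet> v) / m" using gw unfolding u_def by (simp add: inner_add_right)
      have us: "u \<in> span S" using vs w(1) spanB unfolding u_def by (simp add: span_add span_scale)
      have "insert s (B' - {j}) \<subseteq> Z u"
      proof -
        have "b \<bullet> u = 0" if "b \<in> B' - {j}" for b
        proof -
          have "b \<bullet> v = 0" using that B'(1) unfolding S'_def Z_def by auto
          moreover have "b \<bullet> w = 0" using w(3)[of b] that by (auto simp: B_def)
          ultimately show ?thesis unfolding u_def by (simp add: inner_add_right)
        qed
        then show ?thesis using su s(1) B'(1) S'(1) unfolding Z_def by auto
      qed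
      moreover have "s \<notin> span (B' - {j})"
        using spS'v s(2) B'(3) span_mono[of "B' - {j}" B'] by force
      then have "independent (insert s (B' - {j}))"
        using B'(2) by (meson Diff_subset independent_insertI independent_mono)
      moreover have "card (insert s (B' - {j})) = n"
        using \<open>s \<notin> span (B' - {j})\<close> finB' j cardB'
        by (metis card.insert card.remove finite_Diff span_base)
      ultimately have "n \<le> dim (Z u)" by (metis independent_card_le_dim)
      then have "u \<in> R" unfolding R_def using us lu gu gv m by simp
      then have "g \<bullet> v \<le> (g \<bullet> v) / m" using v(2) gu by metis
      then show False using gv m by (simp add: field_simps)
    qed
    then have "in_cone B' (\<Sum>b\<in>B'. c b *\<^sub>R b)" unfolding in_cone_def by blast
    then show ?thesis using cone_ext[of _ "c g"] cg sc by simp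
  qed
  have "in_cone B s \<or> in_cone B (- s)" if sS: "s \<in> S" for s
  proof -
    consider "s \<bullet> v > 0" | "s \<bullet> v < 0" | "s \<in> S'" using sS unfolding S'_def Z_def by fastforce
    then show ?thesis
    proof cases
      case 1 then show ?thesis using pos that by blast
    next
      case 2 then show ?thesis using pos[of "- s"] sym that by simp
    next
      case 3 then show ?thesis using B'(5) cone_ext[of _ 0] by force
    qed
  qed
  moreover have "in_cone B \<delta>" unfolding lg
    by (rule cone_ext[OF B'(4)]) (use gv in \<open>simp add: \<kappa>_def\<close>)
  moreover have "B \<subseteq> S" using B' S' gS unfolding B_def by auto
  ultimately show ?case using indB spanB by blast
qed

lemma simplicial_basis_exists:
  fixes S :: "'a::euclidean_space set"
  assumes "finite S" "\<And>s. s \<in> S \<Longrightarrow> -s \<in> S"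
  obtains B where "B \<subseteq> S" "independent B" "span B = span S"
    "\<And>s. s \<in> S \<Longrightarrow> in_cone B s \<or> in_cone B (- s)"
proof -
  have "\<exists>x\<in>span S. \<forall>W\<in>span ` {T. T \<subseteq> S \<and> dim T < dim S}. x \<notin> W"
  proof (rule span_not_finite_union_subspaces)
    show "finite (span ` {T. T \<subseteq> S \<and> dim T < dim S})" using assms(1) by simp
    show "subspace W \<and> \<not> span S \<subseteq> W" if "W \<in> span ` {T. T \<subseteq> S \<and> dim T < dim S}" for W
      using that by (auto simp: not_le[symmetric]) (metis dim_span dim_subset not_le)
  qed simp
  then obtain \<delta> where "\<delta> \<in> span S" "\<And>T. T \<subseteq> S \<Longrightarrow> dim T < dim S \<Longrightarrow> \<delta> \<notin> span T" by auto
  from simplicial_basis_aux[OF assms this refl] show ?thesis using that by blast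
qed

section \<open>Independent sets that are closed under integer combinations\<close>

text \<open>
  The subgroup generated by a finite set; a lattice if the set is independent.
\<close>

definition int_span :: "'a::real_vector set \<Rightarrow> 'a set" where
  "int_span B = {x. \<exists>c. x = (\<Sum>b\<in>B. of_int (c b) *\<^sub>R b)}"

lemma independent_coeffs_unique:
  assumes "independent B" "finite B" "(\<Sum>b\<in>B. c b *\<^sub>R b) = (\<Sum>b\<in>B. c' b *\<^sub>R b)" "b \<in> B"
  shows "c b = c' b"
proof -
  have "(\<Sum>b\<in>B. (c b - c' b) *\<^sub>R b) = 0" using assms(3) by (simp add: algebra_simps sum_subtractf)
  then show ?thesis using assms independent_explicit_finite_subsets[of B] by (metis right_minus_eq subset_refl)
qed

lemma int_span_base: "finite B \<Longrightarrow> b \<in> B \<Longrightarrow> b \<in> int_span B"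
  unfolding int_span_def
  by (rule CollectI, rule exI[of _ "\<lambda>x. if x = b then 1 else 0"]) (simp add: if_distrib if_distribR sum.delta cong: if_cong)

lemma int_span_add: "x \<in> int_span B \<Longrightarrow> y \<in> int_span B \<Longrightarrow> x + y \<in> int_span B"
proof -
  assume "x \<in> int_span B" "y \<in> int_span B"
  then obtain c c' where "x = (\<Sum>b\<in>B. of_int (c b) *\<^sub>R b)" "y = (\<Sum>b\<in>B. of_int (c' b) *\<^sub>R b)"
    unfolding int_span_def by blast
  then have "x + y = (\<Sum>b\<in>B. of_int (c b + c' b) *\<^sub>R b)" by (simp add: sum.distrib scaleR_add_left)
  then show ?thesis unfolding int_span_def by (intro CollectI exI[of _ "\<lambda>b. c b + c' b"])
qed

lemma int_span_scale: "x \<in> int_span B \<Longrightarrow> of_int k *\<^sub>R x \<in> int_span B"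
proof -
  assume "x \<in> int_span B"
  then obtain c where "x = (\<Sum>b\<in>B. of_int (c b) *\<^sub>R b)" unfolding int_span_def by auto
  then have "of_int k *\<^sub>R x = (\<Sum>b\<in>B. of_int (k * c b) *\<^sub>R b)" by (simp add: scaleR_sum_right)
  then show ?thesis unfolding int_span_def by (intro CollectI exI[of _ "\<lambda>b. k * c b"])
qed

lemma int_span_sum:
  assumes "\<And>i. i \<in> I \<Longrightarrow> f i \<in> int_span B"
  shows "sum f I \<in> int_span B"
proof -
  have "0 \<in> int_span B" unfolding int_span_def by (rule CollectI, rule exI[of _ "\<lambda>_. 0"]) simp
  with assms show ?thesis by (induction I rule: infinite_finite_induct) (auto intro: int_span_add)
qed

lemma int_span_minus: "x \<in> int_span B \<Longrightarrow> - x \<in> int_span B"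
  using int_span_scale[of x B "-1"] by simp

lemma int_span_subset:
  assumes "A \<subseteq> int_span B"
  shows "int_span A \<subseteq> int_span B"
proof
  fix x assume "x \<in> int_span A"
  then obtain c where "x = (\<Sum>a\<in>A. of_int (c a) *\<^sub>R a)" unfolding int_span_def by auto
  then show "x \<in> int_span B" using assms by (auto intro!: int_span_sum int_span_scale)
qed

lemma int_span_mono: "finite B \<Longrightarrow> A \<subseteq> B \<Longrightarrow> int_span A \<subseteq> int_span B"
  by (rule int_span_subset) (auto intro: int_span_base)

lemma int_span_inner_Ints:
  assumes "x \<in> int_span B" "\<And>b. b \<in> B \<Longrightarrow> b \<bullet> y \<in> \<int>"
  shows "x \<bullet> y \<in> \<int>"
  using assms unfolding int_span_def by (auto simp: inner_sum_left intro!: Ints_sum Ints_mult)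

text \<open>
  Minimality for inclusion replaces the choice of a basis of minimal determinant: a basis inside the
  lattice generated by \<open>B0\<close> generates a sublattice, which cannot be smaller.
\<close>

lemma minimal_int_basis:
  fixes S :: "'a::euclidean_space set"
  assumes "finite S"
  obtains B0 where "B0 \<subseteq> S" "independent B0" "span B0 = span S"
    "\<And>T. T \<subseteq> S \<inter> int_span B0 \<Longrightarrow> independent T \<Longrightarrow> span T = span S \<Longrightarrow> int_span T = int_span B0"
proof -
  define \<B> where "\<B> = {B. B \<subseteq> S \<and> independent B \<and> span B = span S}"
  have "finite \<B>" using assms unfolding \<B>_def by simp
  moreover obtain B where B: "B \<subseteq> S" "independent B" "S \<subseteq> span B" "card B = dim S"
    by (rule basis_exists)
  have "span B = span S" using span_mono[OF B(1)] span_minimal[OF B(3) subspace_span] by blast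
  then have "\<B> \<noteq> {}" using B unfolding \<B>_def by blast
  ultimately obtain L where L: "L \<in> int_span ` \<B>" "\<And>L'. L' \<in> int_span ` \<B> \<Longrightarrow> L' \<subseteq> L \<Longrightarrow> L = L'"
    using finite_has_minimal[of "int_span ` \<B>"] by (metis finite_imageI image_is_empty)
  then obtain B0 where B0: "B0 \<in> \<B>" "L = int_span B0" by blast
  show ?thesis
  proof (rule that[of B0])
    fix T assume T: "T \<subseteq> S \<inter> int_span B0" "independent T" "span T = span S"
    then have "int_span T \<subseteq> L" using B0(2) int_span_subset by blast
    moreover have "T \<in> \<B>" using T unfolding \<B>_def by blast
    ultimately show "int_span T = int_span B0" using L(2) B0(2) by blast
  qed (use B0 in \<open>auto simp: \<B>_def\<close>)
qed

text \<open>
  Among the points of the polyhedron of admissible functionals, take one that is integral on a subset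
  of \<open>S\<close> of maximal rank. If this subset did not span, one could move along a direction orthogonal to
  it until the value at some further member of \<open>S\<close> becomes an integer; no value leaves its interval
  before that happens.
\<close>

lemma integral_rounding:
  fixes S :: "'a::euclidean_space set"
  assumes "finite S" "\<phi>0 \<in> span S"
  obtains \<phi> where "\<phi> \<in> span S" "span {s \<in> S. s \<bullet> \<phi> \<in> \<int>} = span S"
    "\<And>s. s \<in> S \<Longrightarrow> of_int \<lfloor>s \<bullet> \<phi>0\<rfloor> \<le> s \<bullet> \<phi> \<and> s \<bullet> \<phi> \<le> of_int \<lceil>s \<bullet> \<phi>0\<rceil>"
proof -
  define P where "P = {\<phi> \<in> span S. \<forall>s\<in>S. of_int \<lfloor>s \<bullet> \<phi>0\<rfloor> \<le> s \<bullet> \<phi> \<and> s \<bullet> \<phi> \<le> of_int \<lceil>s \<bullet> \<phi>0\<rceil>}"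
  define Z where "Z \<phi> = {s \<in> S. s \<bullet> \<phi> \<in> \<int>}" for \<phi>
  have "\<phi>0 \<in> P" using assms unfolding P_def by simp
  moreover have "\<forall>\<phi>. \<phi> \<in> P \<longrightarrow> dim (Z \<phi>) < Suc (DIM('a))" using dim_subset_UNIV le_imp_less_Suc by blast
  ultimately obtain \<phi> where \<phi>: "\<phi> \<in> P" "\<And>\<psi>. \<psi> \<in> P \<Longrightarrow> dim (Z \<psi>) \<le> dim (Z \<phi>)"
    using ex_has_greatest_nat[of "\<lambda>\<phi>. \<phi> \<in> P" \<phi>0 "\<lambda>\<phi>. dim (Z \<phi>)"] by blast
  have "span (Z \<phi>) = span S"
  proof (rule ccontr)
    assume "span (Z \<phi>) \<noteq> span S"
    moreover have "span (Z \<phi>) \<subseteq> span S" by (rule span_mono) (auto simp: Z_def)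
    ultimately obtain u where u: "u \<noteq> 0" "u \<in> span S" "\<And>y. y \<in> span (Z \<phi>) \<Longrightarrow> orthogonal u y"
      using orthogonal_to_subspace_exists_gen[of "Z \<phi>" S] by blast
    define D where "D = {s \<in> S. s \<bullet> u \<noteq> 0}"
    have finD: "finite D" using assms(1) unfolding D_def by simp
    have "D \<noteq> {}"
    proof
      assume "D = {}"
      have "x \<bullet> u = 0" if "x \<in> span S" for x using that
        by (induction rule: span_induct_alt) (use \<open>D = {}\<close> in \<open>auto simp: D_def inner_add_left\<close>)
      then have "u \<bullet> u = 0" using u(2) by blast
      then show False using u by simp
    qed
    have DZ: "s \<bullet> \<phi> \<notin> \<int>" if "s \<in> D" for s
      using that u(3)[OF span_base, of s] by (auto simp: D_def Z_def orthogonal_def inner_commute)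
    \<comment> \<open>The time at which the value at \<open>s\<close> becomes an integer.\<close>
    define \<tau> where "\<tau> s = ((if s \<bullet> u > 0 then of_int \<lceil>s \<bullet> \<phi>\<rceil> else of_int \<lfloor>s \<bullet> \<phi>\<rfloor>) - s \<bullet> \<phi>) / (s \<bullet> u)" for s
    have fl: "of_int \<lfloor>s \<bullet> \<phi>\<rfloor> < s \<bullet> \<phi>" "s \<bullet> \<phi> < of_int \<lceil>s \<bullet> \<phi>\<rceil>" if "s \<in> D" for s
      using DZ[OF that] by (metis Ints_of_int floor_correct order_less_le) (metis DZ[OF that] Ints_of_int le_of_int_ceiling order_less_le)
    have \<tau>pos: "\<tau> s > 0" if "s \<in> D" for s
      using fl[OF that] that unfolding \<tau>_def D_def by (auto intro: divide_neg_neg)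
    define t where "t = Min (\<tau> ` D)"
    have t: "t > 0" "\<And>s. s \<in> D \<Longrightarrow> t \<le> \<tau> s" using finD \<open>D \<noteq> {}\<close> \<tau>pos unfolding t_def by auto
    obtain s0 where s0: "s0 \<in> D" "t = \<tau> s0" using Min_in[of "\<tau> ` D"] finD \<open>D \<noteq> {}\<close> unfolding t_def image_iff by (metis finite_imageI image_iff image_is_empty)
    define \<psi> where "\<psi> = \<phi> + t *\<^sub>R u"
    have su: "s \<bullet> \<psi> = s \<bullet> \<phi> + t * (s \<bullet> u)" for s unfolding \<psi>_def by (simp add: inner_add_right)
    have bnd: "of_int \<lfloor>s \<bullet> \<phi>\<rfloor> \<le> s \<bullet> \<psi> \<and> s \<bullet> \<psi> \<le> of_int \<lceil>s \<bullet> \<phi>\<rceil>" if "s \<in> S" for s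
    proof -
      consider "s \<bullet> u = 0" | "s \<bullet> u > 0" | "s \<bullet> u < 0" by linarith
      then show ?thesis
      proof cases
        case 1
        then show ?thesis unfolding su by simp
      next
        case 2
        then have "s \<in> D" using that D_def by auto
        have "t * (s \<bullet> u) \<le> of_int \<lceil>s \<bullet> \<phi>\<rceil> - s \<bullet> \<phi>"
          using t(2)[OF \<open>s \<in> D\<close>] 2 unfolding \<tau>_def by (simp add: pos_le_divide_eq)
        moreover have "0 \<le> t * (s \<bullet> u)" using t 2 by simp
        moreover have "of_int \<lfloor>s \<bullet> \<phi>\<rfloor> \<le> s \<bullet> \<phi>" by simp
        ultimately show ?thesis unfolding su by linarith
      next
        case 3
        then have "s \<in> D" using that D_def by auto
        have "t * (s \<bullet> u) \<ge> of_int \<lfloor>s \<bullet> \<phi>\<rfloor> - s \<bullet> \<phi>"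
          using t(2)[OF \<open>s \<in> D\<close>] 3 unfolding \<tau>_def by (simp add: neg_le_divide_eq)
        moreover have "t * (s \<bullet> u) \<le> 0" using t 3 by (simp add: mult_nonneg_nonpos)
        moreover have "s \<bullet> \<phi> \<le> of_int \<lceil>s \<bullet> \<phi>\<rceil>" by simp
        ultimately show ?thesis unfolding su by linarith
      qed
    qed
    have "\<psi> \<in> P"
    proof -
      have "of_int \<lfloor>s \<bullet> \<phi>0\<rfloor> \<le> s \<bullet> \<psi> \<and> s \<bullet> \<psi> \<le> of_int \<lceil>s \<bullet> \<phi>0\<rceil>" if "s \<in> S" for s
      proof -
        have "\<lfloor>s \<bullet> \<phi>0\<rfloor> \<le> \<lfloor>s \<bullet> \<phi>\<rfloor>" "\<lceil>s \<bullet> \<phi>\<rceil> \<le> \<lceil>s \<bullet> \<phi>0\<rceil>"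
          using \<phi>(1) that unfolding P_def by (auto simp: le_floor_iff ceiling_le_iff)
        then show ?thesis using bnd[OF that] by (meson of_int_le_iff order_trans)
      qed
      then show ?thesis using u(2) \<phi>(1) unfolding P_def \<psi>_def by (auto simp: span_add span_scale)
    qed
    have "s0 \<bullet> \<psi> \<in> \<int>" using s0 unfolding su s0(2) \<tau>_def D_def by auto
    then have "insert s0 (Z \<phi>) \<subseteq> Z \<psi>"
      using s0(1) u(3)[OF span_base] unfolding su Z_def D_def by (auto simp: orthogonal_def inner_commute)
    moreover have "s0 \<notin> span (Z \<phi>)" using u(3)[of s0] s0(1) unfolding D_def orthogonal_def by (auto simp: inner_commute)
    ultimately have "dim (Z \<phi>) < dim (Z \<psi>)" using dim_subset[of "insert s0 (Z \<phi>)" "Z \<psi>"] by (simp add: dim_insert)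
    then show False using \<phi>(2)[OF \<open>\<psi> \<in> P\<close>] by simp
  qed
  then show ?thesis using that \<phi>(1) unfolding P_def Z_def by blast
qed

theorem half_rank_int_closed_independent:
  fixes S :: "'a::euclidean_space set"
  assumes fin: "finite S" and sym: "\<And>s. s \<in> S \<Longrightarrow> - s \<in> S" and "m \<le> (dim S + 1) div 2"
  obtains F where "F \<subseteq> S" "independent F" "card F = m"
    "\<And>s. s \<in> S \<Longrightarrow> s \<in> int_span F \<Longrightarrow> s = 0 \<or> s \<in> F \<or> - s \<in> F"
proof -
  obtain B0 where B0: "B0 \<subseteq> S" "independent B0" "span B0 = span S"
    "\<And>T. T \<subseteq> S \<inter> int_span B0 \<Longrightarrow> independent T \<Longrightarrow> span T = span S \<Longrightarrow> int_span T = int_span B0"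
    using minimal_int_basis[OF fin] by blast
  define S' where "S' = S \<inter> int_span B0"
  have finB0: "finite B0" using B0 fin finite_subset by blast
  have "B0 \<subseteq> S'" using B0 int_span_base[OF finB0] unfolding S'_def by blast
  then have spS': "span S' = span S"
    using B0(3) span_mono[of S' S] span_mono[of B0 S'] unfolding S'_def by blast
  have finS': "finite S'" and symS': "\<And>s. s \<in> S' \<Longrightarrow> - s \<in> S'"
    using fin sym int_span_minus unfolding S'_def by auto
  obtain B where B: "B \<subseteq> S'" "independent B" "span B = span S'"
    "\<And>s. s \<in> S' \<Longrightarrow> in_cone B s \<or> in_cone B (- s)"
    using simplicial_basis_exists[OF finS' symS'] by metis
  have finB: "finite B" using B finS' finite_subset by blast
  have latB: "int_span B = int_span B0" using B0(4)[of B] B spS' unfolding S'_def by auto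
  obtain h where h: "h \<in> span B" "\<And>b. b \<in> B \<Longrightarrow> b \<bullet> h = 1"
    using exists_functional_on_basis[OF B(2), of "\<lambda>_. 1"] by blast
  have hs: "(1/2) *\<^sub>R h \<in> span S'" using span_scale[OF h(1)] B(3) by blast
  obtain \<phi> where \<phi>: "\<phi> \<in> span S'" "span {s \<in> S'. s \<bullet> \<phi> \<in> \<int>} = span S'"
    "\<And>s. s \<in> S' \<Longrightarrow> of_int \<lfloor>s \<bullet> ((1/2) *\<^sub>R h)\<rfloor> \<le> s \<bullet> \<phi> \<and> s \<bullet> \<phi> \<le> of_int \<lceil>s \<bullet> ((1/2) *\<^sub>R h)\<rceil>"
    using integral_rounding[OF finS' hs] by blast
  obtain T where T: "T \<subseteq> {s \<in> S'. s \<bullet> \<phi> \<in> \<int>}" "independent T" "{s \<in> S'. s \<bullet> \<phi> \<in> \<int>} \<subseteq> span T"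
    "card T = dim {s \<in> S'. s \<bullet> \<phi> \<in> \<int>}"
    by (rule basis_exists)
  have "span T = span S'" using span_mono[OF T(1)] span_minimal[OF T(3) subspace_span] \<phi>(2) by blast
  then have "int_span T = int_span B0" using B0(4)[of T] T spS' unfolding S'_def by blast
  then have int: "s \<bullet> \<phi> \<in> \<int>" if "s \<in> S'" for s
    using int_span_inner_Ints[of s T \<phi>] T(1) that unfolding S'_def by blast
  have b01: "b \<bullet> \<phi> = 0 \<or> b \<bullet> \<phi> = 1" if "b \<in> B" for b
  proof -
    have "\<lceil>1 / (2::real)\<rceil> = 1" by (rule ceiling_unique) auto
    then have "0 \<le> b \<bullet> \<phi>" "b \<bullet> \<phi> \<le> 1" using \<phi>(3)[of b] B(1) h(2)[OF that] that by (auto simp: subset_iff)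
    moreover obtain k where "b \<bullet> \<phi> = of_int k" using int[of b] B(1) \<open>b \<in> B\<close> by (auto elim: Ints_cases)
    ultimately have "0 \<le> k" "k \<le> 1" by simp_all
    then have "k = 0 \<or> k = 1" by linarith
    then show ?thesis using \<open>b \<bullet> \<phi> = of_int k\<close> by auto
  qed
  have card2: "card {b \<in> B. b \<bullet> \<phi> = 0} + card {b \<in> B. b \<bullet> \<phi> = 1} = dim S"
  proof -
    have "B = {b \<in> B. b \<bullet> \<phi> = 0} \<union> {b \<in> B. b \<bullet> \<phi> = 1}" using b01 by blast
    then have "card B = card {b \<in> B. b \<bullet> \<phi> = 0} + card {b \<in> B. b \<bullet> \<phi> = 1}"
      using finB by (metis (mono_tags, lifting) card_Un_disjoint disjoint_iff finite_Un mem_Collect_eq zero_neq_one)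
    moreover have "card B = dim S" using B(2,3) spS' by (metis dim_span dim_eq_card)
    ultimately show ?thesis by simp
  qed
  \<comment> \<open>The colour of the larger class.\<close>
  define \<epsilon> :: real where "\<epsilon> = (if m \<le> card {b \<in> B. b \<bullet> \<phi> = 0} then 0 else 1)"
  have "m \<le> card {b \<in> B. b \<bullet> \<phi> = \<epsilon>}" using assms(3) card2 unfolding \<epsilon>_def by auto
  then obtain F where F: "F \<subseteq> {b \<in> B. b \<bullet> \<phi> = \<epsilon>}" "card F = m"
    using obtain_subset_with_card_n by metis
  have finF: "finite F" using F finB finite_subset by fastforce
  have FB: "F \<subseteq> B" using F by blast
  have cone: "s = 0 \<or> s \<in> F" if s: "s \<in> S'" "s \<in> int_span F" "in_cone B s" for s
  proof -
    obtain c where c: "s = (\<Sum>b\<in>F. of_int (c b) *\<^sub>R b)" using s(2) unfolding int_span_def by auto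
    obtain a where a: "\<And>b. b \<in> B \<Longrightarrow> 0 \<le> a b" "s = (\<Sum>b\<in>B. a b *\<^sub>R b)" using s(3) unfolding in_cone_def by auto
    have "(\<Sum>b\<in>B. (if b \<in> F then of_int (c b) else 0) *\<^sub>R b) = s"
      unfolding c by (rule sum.mono_neutral_cong_right[OF finB FB]) auto
    then have ca: "a b = (if b \<in> F then of_int (c b) else 0)" if "b \<in> B" for b
      by (intro independent_coeffs_unique[OF B(2) finB _ that]) (use a(2) in simp)
    have c0: "0 \<le> c b" if "b \<in> F" for b using ca[of b] a(1)[of b] FB that by auto
    \<comment> \<open>For \<open>k \<ge> 2\<close> neither 0 nor \<open>k\<close> lies between the floor and the ceiling of \<open>k / 2\<close>.\<close>
    define k where "k = (\<Sum>b\<in>F. c b)"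
    have "s \<bullet> h = of_int k" unfolding c k_def inner_sum_left of_int_sum
      by (rule sum.cong) (use h FB in auto)
    moreover have "s \<bullet> \<phi> = of_int k * \<epsilon>" unfolding c k_def inner_sum_left of_int_sum sum_distrib_right
      by (rule sum.cong) (use F in auto)
    ultimately have "of_int \<lfloor>of_int k / (2::real)\<rfloor> \<le> of_int k * \<epsilon> \<and> of_int k * \<epsilon> \<le> of_int \<lceil>of_int k / (2::real)\<rceil>"
      using \<phi>(3)[OF s(1)] by simp
    then have "k \<le> 1" unfolding \<epsilon>_def by (auto split: if_splits simp: floor_le_iff le_ceiling_iff)
    show ?thesis
    proof (cases "\<forall>b\<in>F. c b = 0")
      case True
      then show ?thesis unfolding c by simp
    next
      case False
      then obtain b where b: "b \<in> F" "c b \<noteq> 0" by blast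
      have "k = c b + (\<Sum>b\<in>F - {b}. c b)" unfolding k_def using finF b by (simp add: sum.remove)
      moreover have "0 \<le> (\<Sum>b\<in>F - {b}. c b)" using c0 by (auto intro: sum_nonneg)
      ultimately have "c b = 1" "(\<Sum>b\<in>F - {b}. c b) = 0" using b c0[OF b(1)] \<open>k \<le> 1\<close> by linarith+
      moreover have "\<forall>x\<in>F - {b}. c x = 0"
        using \<open>(\<Sum>b\<in>F - {b}. c b) = 0\<close> c0 finF sum_nonneg_eq_0_iff[of "F - {b}" c] by auto
      ultimately have "s = b" unfolding c using finF b by (simp add: sum.remove)
      then show ?thesis using b by simp
    qed
  qed
  show ?thesis
  proof (rule that[of F])
    show "F \<subseteq> S" using FB B(1) S'_def by blast
    show "independent F" using FB B(2) independent_mono by blast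
    fix s assume s: "s \<in> S" "s \<in> int_span F"
    then have "s \<in> S'" using int_span_mono[OF finB FB] latB unfolding S'_def by blast
    then show "s = 0 \<or> s \<in> F \<or> - s \<in> F"
      using B(4)[of s] cone[of s] cone[of "- s"] s(2) symS' int_span_minus by fastforce
  qed (rule F)
qed

lemma half_not_Ints: "(1/2::real) \<notin> \<int>"
proof
  assume "(1/2::real) \<in> \<int>"
  then obtain k where "1/2 = real_of_int k" by (auto elim: Ints_cases)
  then have "of_int (2 * k) = real_of_int 1" by simp
  then have "2 * k = 1" by (simp only: of_int_eq_iff)
  then show False by presburger
qed

text \<open>
  Pontryagin duality for the torus: a character that is trivial on the common kernel of the characters
  in \<open>F\<close> is a product of these. Testing on the orthogonal complement of \<open>F\<close>, which is closed under
  scaling, puts \<open>a\<close> into the linear span; testing on the dual basis shows that its coefficients are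
  integers.
\<close>

lemma int_span_if_annihilated:
  fixes F :: "'a::euclidean_space set"
  assumes ind: "independent F" and ann: "\<And>x. (\<And>f. f \<in> F \<Longrightarrow> f \<bullet> x \<in> \<int>) \<Longrightarrow> a \<bullet> x \<in> \<int>"
  shows "a \<in> int_span F"
proof -
  have fin: "finite F" using ind by (rule independent_imp_finite)
  obtain y z where yz: "y \<in> span F" "\<And>w. w \<in> span F \<Longrightarrow> orthogonal z w" "a = y + z"
    using orthogonal_subspace_decomp_exists[of F a] by metis
  have "z = 0"
  proof (rule ccontr)
    assume "z \<noteq> 0"
    have "a \<bullet> ((1 / (2 * (z \<bullet> z))) *\<^sub>R z) \<in> \<int>"
      by (rule ann) (use yz(2)[OF span_base] in \<open>auto simp: orthogonal_def inner_commute\<close>)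
    moreover have "a \<bullet> z = z \<bullet> z" using yz(2)[OF yz(1)] yz(3) by (simp add: inner_add_left inner_add_right orthogonal_def inner_commute)
    ultimately have "(1/2::real) \<in> \<int>" using \<open>z \<noteq> 0\<close> by simp
    then show False using half_not_Ints by contradiction
  qed
  then obtain c where c: "a = (\<Sum>f\<in>F. c f *\<^sub>R f)" using yz finite_span_coeffs[OF fin] by (metis add.right_neutral)
  have "c f \<in> \<int>" if f: "f \<in> F" for f
  proof -
    obtain v where v: "f \<bullet> v = 1" "\<And>g. g \<in> F - {f} \<Longrightarrow> g \<bullet> v = 0" using exists_dual_vector[OF ind f] by metis
    have "a \<bullet> v \<in> \<int>" by (rule ann) (metis v Diff_iff Ints_0 Ints_1 singletonD)
    moreover have "a \<bullet> v = (\<Sum>g\<in>F. if g = f then c f else 0)"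
      unfolding c inner_sum_left by (rule sum.cong) (use v in auto)
    ultimately show ?thesis using fin f by simp
  qed
  then have "\<forall>f\<in>F. \<exists>k. c f = of_int k" unfolding Ints_def by blast
  then obtain k where k: "\<forall>f\<in>F. c f = of_int (k f)" by (rule bchoice[THEN exE])
  have "a = (\<Sum>f\<in>F. of_int (k f) *\<^sub>R f)" unfolding c by (rule sum.cong) (use k in auto)
  then show ?thesis unfolding int_span_def by (intro CollectI exI[of _ k])
qed

section \<open>Characters, symmetric operators and weight spaces\<close>

lemma additive_continuous_imp_linear:
  fixes l :: "'a::real_normed_vector \<Rightarrow> real"
  assumes add: "\<And>x y. l (x + y) = l x + l y" and cont: "continuous_on UNIV l"
  shows "linear l"
proof (rule linearI)
  show "l (x + y) = l x + l y" for x y by (rule add)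
  fix r x
  have l0: "l 0 = 0" using add[of 0 0] by simp
  have nat: "l (of_nat n *\<^sub>R y) = of_nat n * l y" for n y
    by (induction n) (simp_all add: l0 add algebra_simps scaleR_add_left)
  have neg: "l (- y) = - l y" for y using add[of y "- y"] l0 by simp
  have int: "l (of_int k *\<^sub>R y) = of_int k * l y" for k y
  proof (cases "k \<ge> 0")
    case True
    then show ?thesis using nat[of "nat k" y] by simp
  next
    case False
    then show ?thesis using nat[of "nat (- k)" y] neg[of "of_int (- k) *\<^sub>R y"] by simp
  qed
  have rat: "l (q *\<^sub>R x) - q * l x = 0" if "q \<in> \<rat>" for q
  proof -
    obtain a b where q: "q = of_int a / of_int b" "b > 0" using \<open>q \<in> \<rat>\<close> by (metis Rats_cases')
    have "of_int b * l (q *\<^sub>R x) = of_int a * l x"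
      using int[of b "q *\<^sub>R x"] int[of a x] q by simp
    moreover have "of_int b * (q * l x) = of_int a * l x" using q by simp
    ultimately have "of_int b * (l (q *\<^sub>R x) - q * l x) = 0" by (simp only: right_diff_distrib diff_self)
    then show ?thesis using q(2) by simp
  qed
  have "continuous_on UNIV (\<lambda>q. l (q *\<^sub>R x))"
    by (rule continuous_on_compose2[OF cont]) (auto intro!: continuous_intros)
  then have "continuous_on (closure \<rat>) (\<lambda>q. l (q *\<^sub>R x) - q * l x)"
    unfolding Rats_closure_real by (intro continuous_intros)
  from continuous_constant_on_closure[OF this rat] show "l (r *\<^sub>R x) = r *\<^sub>R l x"
    by (simp add: Rats_closure_real)
qed

text \<open>
  A continuous logarithm exists because the domain is contractible. It is additive up to multiples of
  \<open>2 * pi\<close>, and this error is constant by continuity.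
\<close>

lemma continuous_unit_character:
  fixes f :: "'a::euclidean_space \<Rightarrow> complex"
  assumes cont: "continuous_on UNIV f" and mult: "\<And>x y. f (x + y) = f x * f y"
    and unit: "\<And>x. cmod (f x) = 1"
  obtains a where "\<And>x. f x = cis (2 * pi * (a \<bullet> x))"
proof -
  have nz: "f x \<noteq> 0" for x using unit[of x] by auto
  obtain g where g: "continuous_on UNIV g" "\<And>x. f x = exp (g x)"
    using continuous_logarithm_on_contractible[OF cont convex_imp_contractible[OF convex_UNIV]] nz
    by (metis UNIV_I)
  have f0: "f 0 = 1" using mult[of 0 0] nz[of 0] by simp
  have Re0: "Re (g x) = 0" for x using unit[of x] unfolding g(2) by simp
  define l where "l x = Im (g x - g 0)" for x
  have contl: "continuous_on UNIV l" unfolding l_def by (intro continuous_intros g)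
  have fl: "f x = cis (l x)" for x
  proof -
    have "f x = exp (g x - g 0)" using f0 unfolding g(2) by (simp add: exp_diff)
    also have "g x - g 0 = \<i> * of_real (l x)" unfolding l_def using Re0 by (simp add: complex_eq_iff)
    finally show ?thesis by (simp add: cis_conv_exp)
  qed
  have "l (x + y) = l x + l y" for x y
  proof -
    define D where "D x = l (x + y) - l x - l y" for x
    have "D constant_on UNIV"
    proof (rule continuous_discrete_range_constant)
      show "continuous_on UNIV D" unfolding D_def
        by (intro continuous_intros contl continuous_on_compose2[OF contl]) auto
      have D: "\<exists>k::int. D x = of_int k * 2 * pi" for x
      proof -
        have "cis (D x) = 1" unfolding D_def using mult[of x y] nz[of x] nz[of y]
          by (simp add: fl flip: cis_divide)
        then have "cos (D x) = 1" by (metis cis.sel(1) one_complex.sel(1))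
        then show ?thesis by (simp add: cos_one_2pi_int)
      qed
      have "2 * pi \<le> norm (D z - D x)" if "D z \<noteq> D x" for x z
      proof -
        obtain k m where km: "D z = of_int k * 2 * pi" "D x = of_int m * 2 * pi" using D by blast
        have "D z - D x = of_int (k - m) * (2 * pi)" unfolding km by (simp add: algebra_simps)
        moreover have "1 \<le> \<bar>real_of_int (k - m)\<bar>" using that km by (auto simp flip: of_int_abs)
        ultimately show ?thesis by (simp add: abs_mult)
      qed
      then show "\<exists>e>0. \<forall>z. z \<in> UNIV \<and> D z \<noteq> D x \<longrightarrow> e \<le> norm (D z - D x)" for x
        by (intro exI[of _ "2 * pi"]) auto
    qed (rule connected_UNIV)
    then have "D x = D 0" by (metis UNIV_I constant_on_def)
    also have "D 0 = 0" by (simp add: D_def l_def)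
    finally show ?thesis by (simp add: D_def)
  qed
  then have lin: "linear l" using contl by (rule additive_continuous_imp_linear)
  show ?thesis
  proof (rule that[of "(1 / (2 * pi)) *\<^sub>R adjoint l 1"])
    show "f x = cis (2 * pi * (((1 / (2 * pi)) *\<^sub>R adjoint l 1) \<bullet> x))" for x
      using adjoint_works[OF lin, of x 1] by (simp add: fl inner_commute)
  qed
qed

text \<open>
  A maximum point of the quadratic form on the unit sphere is an eigenvector.
\<close>

lemma symmetric_on_subspace_eigenvector:
  fixes A :: "'v::euclidean_space \<Rightarrow> 'v"
  assumes W: "subspace W" "W \<noteq> {0}" and maps: "\<And>v. v \<in> W \<Longrightarrow> A v \<in> W"
    and add: "\<And>u v. u \<in> W \<Longrightarrow> v \<in> W \<Longrightarrow> A (u + v) = A u + A v"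
    and scale: "\<And>c v. v \<in> W \<Longrightarrow> A (c *\<^sub>R v) = c *\<^sub>R A v"
    and sym: "\<And>u v. u \<in> W \<Longrightarrow> v \<in> W \<Longrightarrow> A u \<bullet> v = u \<bullet> A v"
    and cont: "continuous_on W A"
  obtains m v where "v \<in> W" "v \<noteq> 0" "A v = m *\<^sub>R v"
proof -
  define K where "K = W \<inter> sphere 0 1"
  obtain w where w: "w \<in> W" "w \<noteq> 0" using W subspace_0 by blast
  have "compact K" unfolding K_def using W closed_subspace by (intro closed_Int_compact) auto
  moreover have "(1 / norm w) *\<^sub>R w \<in> K" unfolding K_def using w W by (simp add: subspace_scale)
  moreover have "continuous_on K (\<lambda>v. v \<bullet> A v)"
    using cont unfolding K_def by (intro continuous_intros) (auto intro: continuous_on_subset)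
  ultimately obtain v where v: "v \<in> K" "\<And>u. u \<in> K \<Longrightarrow> u \<bullet> A u \<le> v \<bullet> A v"
    using continuous_attains_sup[of K "\<lambda>v. v \<bullet> A v"] by blast
  define m where "m = v \<bullet> A v"
  have vW: "v \<in> W" and vv: "v \<bullet> v = 1" using v(1) unfolding K_def by (auto simp: dot_square_norm)
  have le: "u \<bullet> A u \<le> m * (u \<bullet> u)" if u: "u \<in> W" for u
  proof (cases "u = 0")
    case True
    then show ?thesis using scale[OF u, of 0] by simp
  next
    case False
    have "(1 / norm u) *\<^sub>R u \<in> K" unfolding K_def using u False W by (simp add: subspace_scale)
    from v(2)[OF this] have "(1 / norm u)\<^sup>2 * (u \<bullet> A u) \<le> m"
      unfolding m_def by (simp add: scale[OF u] power2_eq_square)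
    then show ?thesis using False by (simp add: dot_square_norm field_simps)
  qed
  define q where "q = A v - m *\<^sub>R v"
  have qW: "q \<in> W" unfolding q_def using vW maps W by (simp add: subspace_diff subspace_scale)
  have "q = 0"
  proof (rule ccontr)
    assume "q \<noteq> 0"
    then have qq: "q \<bullet> q > 0" by simp
    define k where "k = m * (q \<bullet> q) - q \<bullet> A q"
    have main: "2 * t * (q \<bullet> q) \<le> t\<^sup>2 * k" for t
    proof -
      have tq: "t *\<^sub>R q \<in> W" using qW W by (simp add: subspace_scale)
      then have "v + t *\<^sub>R q \<in> W" using vW W by (simp add: subspace_add)
      note main = le[OF this]
      have x1: "v \<bullet> A q = q \<bullet> A v" using sym[OF vW qW] by (simp add: inner_commute)
      have x2: "v \<bullet> q = q \<bullet> v" by (rule inner_commute)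
      have "(v + t *\<^sub>R q) \<bullet> A (v + t *\<^sub>R q) = m + 2 * t * (q \<bullet> A v) + t\<^sup>2 * (q \<bullet> A q)"
        unfolding add[OF vW tq] scale[OF qW] m_def
        by (simp add: inner_add_left inner_add_right x1 power2_eq_square algebra_simps)
      moreover have "(v + t *\<^sub>R q) \<bullet> (v + t *\<^sub>R q) = 1 + 2 * t * (q \<bullet> v) + t\<^sup>2 * (q \<bullet> q)"
        by (simp add: inner_add_left inner_add_right x2 vv power2_eq_square algebra_simps)
      ultimately have "m + 2 * t * (q \<bullet> A v) + t\<^sup>2 * (q \<bullet> A q) \<le> m * (1 + 2 * t * (q \<bullet> v) + t\<^sup>2 * (q \<bullet> q))"
        using main by simp
      moreover have "q \<bullet> q = q \<bullet> (A v - m *\<^sub>R v)" by (simp add: q_def)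
      then have "q \<bullet> A v = q \<bullet> q + m * (q \<bullet> v)" by (simp add: inner_diff_right)
      ultimately show ?thesis unfolding k_def by (simp add: algebra_simps)
    qed
    define t where "t = (q \<bullet> q) / (\<bar>k\<bar> + 1)"
    have t: "t > 0" unfolding t_def using qq by simp
    have "t * k \<le> q \<bullet> q"
    proof -
      have "t * k \<le> t * (\<bar>k\<bar> + 1)" using t by (intro mult_left_mono) auto
      also have "\<dots> = q \<bullet> q" unfolding t_def by simp
      finally show ?thesis .
    qed
    moreover have "t * (2 * (q \<bullet> q)) \<le> t * (t * k)" using main[of t] by (simp add: power2_eq_square mult_ac)
    then have "2 * (q \<bullet> q) \<le> t * k" using t by simp
    ultimately show False using qq by simp
  qed
  moreover have "v \<noteq> 0" using vv by auto
  ultimately show ?thesis using that[of v m] vW unfolding q_def by simp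
qed

lemma cos_inner_eq_imp:
  fixes a b :: "'a::euclidean_space"
  assumes eq: "\<And>x. cos (2 * pi * (a \<bullet> x)) = cos (2 * pi * (b \<bullet> x))"
  shows "a = b \<or> a = - b"
proof -
  have le: "\<bar>d \<bullet> x\<bar> \<le> \<bar>c \<bullet> x\<bar>"
    if eq: "\<And>x. cos (2 * pi * (c \<bullet> x)) = cos (2 * pi * (d \<bullet> x))" for c d x :: 'a
  proof (rule ccontr)
    assume less: "\<not> \<bar>d \<bullet> x\<bar> \<le> \<bar>c \<bullet> x\<bar>"
    define r where "r = 1 / (2 * \<bar>d \<bullet> x\<bar>)"
    have "cos \<bar>2 * pi * (r * (c \<bullet> x))\<bar> = cos \<bar>2 * pi * (r * (d \<bullet> x))\<bar>"
      using eq[of "r *\<^sub>R x"] by simp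
    moreover have "\<bar>2 * pi * (r * (d \<bullet> x))\<bar> = pi" using less unfolding r_def by (simp add: abs_mult)
    moreover have "\<bar>2 * pi * (r * (c \<bullet> x))\<bar> < pi" using less unfolding r_def by (simp add: abs_mult field_simps)
    ultimately show False using cos_monotone_0_pi[of "\<bar>2 * pi * (r * (c \<bullet> x))\<bar>" pi] by simp
  qed
  have "\<bar>a \<bullet> x\<bar> = \<bar>b \<bullet> x\<bar>" for x using le[of a b x] le[of b a x] eq by (metis order_antisym)
  then have "(a \<bullet> x)\<^sup>2 = (b \<bullet> x)\<^sup>2" for x by (metis power2_abs)
  then have prod: "((a - b) \<bullet> x) * ((a + b) \<bullet> x) = 0" for x
    by (simp add: inner_add_left inner_diff_left power2_eq_square algebra_simps)
  define p q where "p = a - b" and "q = a + b"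
  have pq: "(p \<bullet> x) * (q \<bullet> x) = 0" for x using prod unfolding p_def q_def .
  have "(p \<bullet> p) * (p \<bullet> q) = 0" "(p \<bullet> q) * (q \<bullet> q) = 0" using pq[of p] pq[of q] by (simp_all add: inner_commute)
  moreover have "(p \<bullet> p + p \<bullet> q) * (p \<bullet> q + q \<bullet> q) = 0" using pq[of "p + q"] by (simp add: inner_add_right inner_commute)
  ultimately have "p = 0 \<or> q = 0" by (cases "p \<bullet> q = 0") auto
  then show ?thesis unfolding p_def q_def by (auto simp: eq_neg_iff_add_eq_0)
qed

text \<open>
  A torus representation is studied through its pullback along the exponential map, which is an
  orthogonal representation of a vector group.
\<close>

locale vector_group_rep =
  fixes V :: "'v::euclidean_space set" and R :: "'e::euclidean_space \<Rightarrow> 'v \<Rightarrow> 'v"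
  assumes subspace_V: "subspace V"
    and R_in: "v \<in> V \<Longrightarrow> R x v \<in> V"
    and R_add: "u \<in> V \<Longrightarrow> v \<in> V \<Longrightarrow> R x (u + v) = R x u + R x v"
    and R_scale: "v \<in> V \<Longrightarrow> R x (c *\<^sub>R v) = c *\<^sub>R R x v"
    and R_inner: "u \<in> V \<Longrightarrow> v \<in> V \<Longrightarrow> R x u \<bullet> R x v = u \<bullet> v"
    and R_0: "v \<in> V \<Longrightarrow> R 0 v = v"
    and R_plus: "v \<in> V \<Longrightarrow> R (x + y) v = R x (R y v)"
    and R_cont: "v \<in> V \<Longrightarrow> continuous_on UNIV (\<lambda>x. R x v)"
begin

lemmas V_closed = subspace_0[OF subspace_V] subspace_add[OF subspace_V] subspace_diff[OF subspace_V]
  subspace_scale[OF subspace_V] subspace_neg[OF subspace_V] subspace_sum[OF subspace_V]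

lemma R_diff: "u \<in> V \<Longrightarrow> v \<in> V \<Longrightarrow> R x (u - v) = R x u - R x v"
  using R_add[of u "- v"] R_scale[of v x "-1"] subspace_V by (simp add: subspace_neg)

lemma R_zero [simp]: "R x 0 = 0"
  using R_scale[of 0 x 0] subspace_V by (simp add: subspace_0)

lemma R_sum: "(\<And>i. i \<in> I \<Longrightarrow> f i \<in> V) \<Longrightarrow> R x (sum f I) = (\<Sum>i\<in>I. R x (f i))"
proof (induction I rule: infinite_finite_induct)
  case (insert i I)
  then show ?case using R_add[of "f i" "sum f I"] subspace_V by (simp add: subspace_sum)
qed simp_all

lemma R_inverse [simp]: "v \<in> V \<Longrightarrow> R x (R (- x) v) = v" "v \<in> V \<Longrightarrow> R (- x) (R x v) = v"
  using R_plus[of v x "- x"] R_plus[of v "- x" x] R_0 by simp_all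

lemma R_commute: "v \<in> V \<Longrightarrow> R x (R y v) = R y (R x v)"
  by (metis R_plus add.commute)

lemma R_adjoint: "u \<in> V \<Longrightarrow> v \<in> V \<Longrightarrow> R x u \<bullet> v = u \<bullet> R (- x) v"
  using R_inner[of u "R (- x) v" x] by (simp add: R_in)

lemma R_fix_iff: "v \<in> V \<Longrightarrow> R x v = v \<longleftrightarrow> R (- x) v = v"
  by (metis R_inverse)

text \<open>
  The real isotypic component of the weights \<open>a\<close> and \<open>- a\<close>. The equation says that the symmetric part
  of \<open>R x\<close> is multiplication by \<open>cos (2 * pi * (a \<bullet> x))\<close>; this avoids complexification.
\<close>

definition wspace :: "'e \<Rightarrow> 'v set" where
  "wspace a = {v \<in> V. \<forall>x. R x v + R (- x) v = (2 * cos (2 * pi * (a \<bullet> x))) *\<^sub>R v}"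

definition invariant :: "'v set \<Rightarrow> bool" where
  "invariant W \<longleftrightarrow> subspace W \<and> W \<subseteq> V \<and> (\<forall>x. \<forall>w\<in>W. R x w \<in> W)"

definition weights :: "'e set" where
  "weights = {a. a \<noteq> 0 \<and> wspace a \<noteq> {0}}"

lemma wspace_subset: "wspace a \<subseteq> V"
  unfolding wspace_def by blast

lemma wspace_uminus: "wspace (- a) = wspace a"
  unfolding wspace_def by simp

lemma invariant_V: "invariant V"
  unfolding invariant_def using subspace_V R_in by auto

lemma sym_part_linear:
  "u \<in> V \<Longrightarrow> v \<in> V \<Longrightarrow> R x (u + v) + R (- x) (u + v) = (R x u + R (- x) u) + (R x v + R (- x) v)"
  "v \<in> V \<Longrightarrow> R x (c *\<^sub>R v) + R (- x) (c *\<^sub>R v) = c *\<^sub>R (R x v + R (- x) v)"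
  by (simp_all add: R_add R_scale scaleR_add_right)

lemma invariant_eigenspace:
  assumes W: "invariant W"
  shows "invariant {v \<in> W. R x v + R (- x) v = m *\<^sub>R v}" (is "invariant ?E")
proof -
  have sW: "subspace W" and WV: "\<And>v. v \<in> W \<Longrightarrow> v \<in> V" and RW: "\<And>x w. w \<in> W \<Longrightarrow> R x w \<in> W"
    using W unfolding invariant_def by auto
  have "subspace ?E"
    using sW WV by (intro subspaceI)
      (simp_all add: subspace_0 subspace_add subspace_scale sym_part_linear scaleR_add_right mult.commute)
  moreover have "R y v \<in> ?E" if v: "v \<in> ?E" for y v
  proof -
    have vV: "v \<in> V" using v WV by blast
    have "R x (R y v) + R (- x) (R y v) = R y (R x v + R (- x) v)"
      using vV by (simp add: R_add R_in R_commute[of v _ y])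
    then show ?thesis using v vV RW by (simp add: R_scale)
  qed
  ultimately show ?thesis using WV unfolding invariant_def by blast
qed

lemma invariant_wspace: "invariant (wspace a)"
proof -
  have "wspace a = (\<Inter>x. {v \<in> V. R x v + R (- x) v = (2 * cos (2 * pi * (a \<bullet> x))) *\<^sub>R v})"
    unfolding wspace_def by blast
  moreover note inv = invariant_eigenspace[OF invariant_V]
  have "invariant (\<Inter>x. {v \<in> V. R x v + R (- x) v = (2 * cos (2 * pi * (a \<bullet> x))) *\<^sub>R v})" (is "invariant (\<Inter>x. ?E x)")
  proof -
    have "subspace (\<Inter>x. ?E x)" using inv by (intro subspace_Inter) (auto simp: invariant_def)
    moreover have "R y v \<in> ?E x" if "v \<in> (\<Inter>x. ?E x)" for x y v
      using inv[of x] that unfolding invariant_def by blast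
    ultimately show ?thesis unfolding invariant_def by blast
  qed
  ultimately show ?thesis by simp
qed

text \<open>
  The symmetric operators \<open>R x + R (- x)\<close> act by scalars on both spaces, and for some \<open>x\<close> by different
  ones.
\<close>

lemma wspace_orthogonal:
  assumes "u \<in> wspace a" "v \<in> wspace b" "a \<noteq> b" "a \<noteq> - b"
  shows "u \<bullet> v = 0"
proof (rule ccontr)
  assume uv: "u \<bullet> v \<noteq> 0"
  have V: "u \<in> V" "v \<in> V" using assms wspace_subset by auto
  have "cos (2 * pi * (a \<bullet> x)) = cos (2 * pi * (b \<bullet> x))" for x
  proof -
    have "(R x u + R (- x) u) \<bullet> v = u \<bullet> (R x v + R (- x) v)"
      using R_adjoint[OF V, of x] R_adjoint[OF V, of "- x"] by (simp add: inner_add_left inner_add_right)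
    then show ?thesis using assms(1,2) uv unfolding wspace_def by simp
  qed
  then show False using cos_inner_eq_imp assms(3,4) by blast
qed

text \<open>
  Let \<open>W\<close> be an invariant subspace of minimal dimension. The symmetric operators \<open>R x + R (- x)\<close>
  commute with the representation, so each has an invariant eigenspace in \<open>W\<close> and is therefore a scalar
  \<open>2 * c x\<close>. The function \<open>c\<close> satisfies d'Alembert's equation, and the claim is that it is a cosine.
  Unless \<open>c = 1\<close> throughout, a normalised skew part of some \<open>R x0\<close> is a complex structure \<open>J\<close> on \<open>W\<close>,
  and \<open>R x = c x + s x * J\<close>, which makes \<open>c + \<i> * s\<close> a continuous unitary character.
\<close>

lemma invariant_contains_weight_vector:
  assumes X: "invariant X" "X \<noteq> {0}"
  obtains W a where "invariant W" "W \<subseteq> X" "W \<noteq> {0}" "W \<subseteq> wspace a"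
proof -
  obtain W where W: "invariant W" "W \<subseteq> X" "W \<noteq> {0}"
    and min: "\<And>U. invariant U \<Longrightarrow> U \<subseteq> X \<Longrightarrow> U \<noteq> {0} \<Longrightarrow> dim W \<le> dim U"
    using ex_has_least_nat[of "\<lambda>U. invariant U \<and> U \<subseteq> X \<and> U \<noteq> {0}" X dim] X by blast
  have sW: "subspace W" and WV: "W \<subseteq> V" and RW: "\<And>x w. w \<in> W \<Longrightarrow> R x w \<in> W"
    using W(1) unfolding invariant_def by auto
  have "\<exists>c. \<forall>v\<in>W. R x v + R (- x) v = (2 * c) *\<^sub>R v" for x
  proof -
    define A where "A v = R x v + R (- x) v" for v
    have isoc: "continuous_on W (R y)" for y
    proof (rule continuous_onI)
      fix u e assume "u \<in> W" "(0::real) < e"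
      have "dist (R y v) (R y u) = dist v u" if "v \<in> W" for v
      proof -
        have "v \<in> V" "u \<in> V" "v - u \<in> V" using that \<open>u \<in> W\<close> WV subspace_diff[OF subspace_V] by auto
        then show ?thesis using R_inner[of "v - u" "v - u" y] by (simp add: dist_norm R_diff norm_eq_sqrt_inner)
      qed
      then show "\<exists>d>0. \<forall>v\<in>W. dist v u < d \<longrightarrow> dist (R y v) (R y u) \<le> e"
        using \<open>0 < e\<close> by (intro exI[of _ e]) auto
    qed
    obtain m v where v: "v \<in> W" "v \<noteq> 0" "A v = m *\<^sub>R v"
    proof (rule symmetric_on_subspace_eigenvector[of W A])
      show "A v \<in> W" if "v \<in> W" for v unfolding A_def using that RW sW by (simp add: subspace_add)
      show "A (u + v) = A u + A v" if "u \<in> W" "v \<in> W" for u v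
        unfolding A_def using that WV by (intro sym_part_linear) auto
      show "A (c *\<^sub>R v) = c *\<^sub>R A v" if "v \<in> W" for c v
        unfolding A_def using that WV by (intro sym_part_linear) auto
      show "A u \<bullet> v = u \<bullet> A v" if "u \<in> W" "v \<in> W" for u v
        unfolding A_def using that WV R_adjoint[of u v x] R_adjoint[of u v "- x"]
        by (auto simp: inner_add_left inner_add_right subset_iff)
      show "continuous_on W A" unfolding A_def by (intro continuous_intros isoc)
    qed (use sW W in auto)
    define E where "E = {v \<in> W. A v = m *\<^sub>R v}"
    have "invariant E" unfolding E_def A_def by (rule invariant_eigenspace[OF W(1)])
    moreover have "v \<in> E" "E \<subseteq> W" using v unfolding E_def by auto
    ultimately have "dim W \<le> dim E" using min[of E] W(2) v(2) by blast
    moreover have "subspace E" using \<open>invariant E\<close> unfolding invariant_def by blast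
    ultimately have "E = W" using \<open>E \<subseteq> W\<close> sW by (simp add: subspace_dim_equal)
    then show ?thesis unfolding E_def A_def by (intro exI[of _ "m / 2"]) auto
  qed
  then obtain c where c: "\<And>x v. v \<in> W \<Longrightarrow> R x v + R (- x) v = (2 * c x) *\<^sub>R v" by metis
  obtain w0 where w0: "w0 \<in> W" "w0 \<noteq> 0" using W sW subspace_0 by blast
  define w where "w = (1 / norm w0) *\<^sub>R w0"
  have w: "w \<in> W" "w \<bullet> w = 1" unfolding w_def using w0 sW by (auto simp: subspace_scale dot_square_norm power2_eq_square)
  have wV: "w \<in> V" using w WV by auto
  have cw: "c x = R x w \<bullet> w" for x
  proof -
    have "(R x w + R (- x) w) \<bullet> w = 2 * c x" using c[OF w(1), of x] w(2) by simp
    moreover have "R (- x) w \<bullet> w = R x w \<bullet> w" using R_adjoint[OF wV wV, of x] by (simp add: inner_commute)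
    ultimately show ?thesis by (simp add: inner_add_left)
  qed
  have dAlembert: "2 * c x * c y = c (x + y) + c (x - y)" for x y
  proof -
    have Rw: "R y w \<in> W" for y using RW w by auto
    have "(2 * c x) *\<^sub>R (2 * c y) *\<^sub>R w = (2 * c x) *\<^sub>R (R y w + R (- y) w)" using c[OF w(1), of y] by simp
    also have "\<dots> = (2 * c x) *\<^sub>R R y w + (2 * c x) *\<^sub>R R (- y) w" by (rule scaleR_add_right)
    also have "\<dots> = (R x (R y w) + R (- x) (R y w)) + (R x (R (- y) w) + R (- x) (R (- y) w))"
      using c[OF Rw, of x] by simp
    also have "\<dots> = (R (x + y) w + R (- (x + y)) w) + (R (x - y) w + R (- (x - y)) w)"
      using wV by (simp add: R_plus[symmetric] algebra_simps)
    also have "\<dots> = (2 * (c (x + y) + c (x - y))) *\<^sub>R w"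
      using c[OF w(1), of "x + y"] c[OF w(1), of "x - y"] by (simp add: algebra_simps)
    finally have "2 * c x * (2 * c y) = 2 * (c (x + y) + c (x - y))" using w(2) by auto
    then show ?thesis by simp
  qed
  have c0: "c 0 = 1" using cw[of 0] w R_0[OF wV] by simp
  have cle: "\<bar>c x\<bar> \<le> 1" for x
    using Cauchy_Schwarz_ineq2[of "R x w" w] R_inner[OF wV wV, of x] w(2)
    unfolding cw by (simp add: norm_eq_sqrt_inner)
  have "\<exists>a. \<forall>x. c x = cos (2 * pi * (a \<bullet> x))"
  proof (cases "\<forall>x. (c x)\<^sup>2 = 1")
    case True
    have "c x = 1" for x
    proof -
      have "2 * (c ((1/2) *\<^sub>R x))\<^sup>2 = c x + 1"
        using dAlembert[of "(1/2) *\<^sub>R x" "(1/2) *\<^sub>R x"] c0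
        by (simp add: power2_eq_square flip: scaleR_add_left)
      then show ?thesis using True by simp
    qed
    then show ?thesis by (intro exI[of _ 0]) simp
  next
    case False
    then obtain x0 where x0: "(c x0)\<^sup>2 \<noteq> 1" by blast
    then have "(c x0)\<^sup>2 < 1" using cle[of x0] by (metis abs_le_square_iff abs_one order_le_less power_one)
    then have s0: "1 - (c x0)\<^sup>2 > 0" by simp
    define s0 where "s0 = sqrt (1 - (c x0)\<^sup>2)"
    have s0: "s0 > 0" "s0\<^sup>2 = 1 - (c x0)\<^sup>2" using s0 unfolding s0_def by auto
    define J where "J v = (1 / s0) *\<^sub>R (R x0 v - c x0 *\<^sub>R v)" for v
    have JW: "J v \<in> W" if "v \<in> W" for v unfolding J_def using that RW sW by (simp add: subspace_diff subspace_scale)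
    have Rx0: "R x0 v = c x0 *\<^sub>R v + s0 *\<^sub>R J v" if "v \<in> W" for v unfolding J_def using s0 by simp
    have Rmx0: "R (- x0) v = c x0 *\<^sub>R v - s0 *\<^sub>R J v" if "v \<in> W" for v
    proof -
      have "R (- x0) v = (2 * c x0) *\<^sub>R v - R x0 v" using c[OF that, of x0] by (metis add_diff_cancel_left')
      also have "\<dots> = c x0 *\<^sub>R v - s0 *\<^sub>R J v"
        unfolding Rx0[OF that] by (simp add: scaleR_2 flip: scaleR_scaleR)
      finally show ?thesis .
    qed
    have J_add: "J (u + v) = J u + J v" if "u \<in> W" "v \<in> W" for u v
      unfolding J_def using that WV by (simp add: R_add subset_iff algebra_simps)
    have J_scale: "J (r *\<^sub>R v) = r *\<^sub>R J v" if "v \<in> W" for r v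
      unfolding J_def using that WV by (simp add: R_scale subset_iff algebra_simps)
    have JJ: "J (J v) = - v" if "v \<in> W" for v
    proof -
      have "v = R (- x0) (R x0 v)" using that WV by auto
      also have "\<dots> = c x0 *\<^sub>R R x0 v - s0 *\<^sub>R J (R x0 v)" using Rmx0 RW that by simp
      also have "\<dots> = c x0 *\<^sub>R (c x0 *\<^sub>R v + s0 *\<^sub>R J v) - s0 *\<^sub>R J (c x0 *\<^sub>R v + s0 *\<^sub>R J v)"
        using Rx0 that by simp
      also have "J (c x0 *\<^sub>R v + s0 *\<^sub>R J v) = c x0 *\<^sub>R J v + s0 *\<^sub>R J (J v)"
        using that JW sW by (simp add: J_add J_scale subspace_scale)
      finally have "v = (c x0)\<^sup>2 *\<^sub>R v - s0\<^sup>2 *\<^sub>R J (J v)" by (simp add: algebra_simps power2_eq_square)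
      then have "v + s0\<^sup>2 *\<^sub>R J (J v) = (c x0)\<^sup>2 *\<^sub>R v" by (metis diff_add_cancel)
      moreover have "(c x0)\<^sup>2 *\<^sub>R v = v - s0\<^sup>2 *\<^sub>R v" using s0(2) by (simp add: scaleR_left_diff_distrib)
      ultimately have "s0\<^sup>2 *\<^sub>R (J (J v) + v) = 0" by (simp add: scaleR_add_right algebra_simps)
      then show ?thesis using s0(1) by (simp add: add_eq_0_iff2)
    qed
    \<comment> \<open>If \<open>c\<close> is the cosine of an angle, this is its sine up to sign, by the addition theorem.\<close>
    define s where "s x = (c (x - x0) - c (x + x0)) / (2 * s0)" for x
    have RJc: "R x v = c x *\<^sub>R v + s x *\<^sub>R J v" if v: "v \<in> W" for x v
    proof -
      define K where "K v = R x v - R (- x) v" for v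
      have KJ: "(2 * s0) *\<^sub>R K (J u) = (2 * (c (x + x0) - c (x - x0))) *\<^sub>R u" if u: "u \<in> W" for u
      proof -
        have uV: "u \<in> V" using u WV by auto
        have "(2 * s0) *\<^sub>R J u = R x0 u - R (- x0) u" using Rx0[OF u] Rmx0[OF u] by (simp add: scaleR_scaleR[symmetric] scaleR_2 del: scaleR_scaleR)
        then have "K ((2 * s0) *\<^sub>R J u) = K (R x0 u - R (- x0) u)" by simp
        also have "\<dots> = (R (x + x0) u + R (- (x + x0)) u) - (R (x - x0) u + R (- (x - x0)) u)"
          unfolding K_def using uV by (simp add: R_diff R_in R_plus[symmetric] algebra_simps)
        also have "\<dots> = (2 * (c (x + x0) - c (x - x0))) *\<^sub>R u"
          using c[OF u, of "x + x0"] c[OF u, of "x - x0"] by (simp add: algebra_simps)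
        also have "K ((2 * s0) *\<^sub>R J u) = (2 * s0) *\<^sub>R K (J u)"
          using JW[OF u] WV unfolding K_def by (simp add: R_scale subset_iff V_closed algebra_simps)
        finally show ?thesis .
      qed
      have "K (J (J v)) = - K v" unfolding JJ[OF v] K_def using R_scale[of v _ "-1"] v WV by auto
      then have "(2 * s0) *\<^sub>R K v = (2 * (c (x - x0) - c (x + x0))) *\<^sub>R J v"
        using arg_cong[OF KJ[OF JW[OF v]], of uminus] by (simp add: scaleR_left_diff_distrib right_diff_distrib)
      then have "(1 / (2 * s0)) *\<^sub>R (2 * s0) *\<^sub>R K v = (1 / (2 * s0)) *\<^sub>R ((2 * (c (x - x0) - c (x + x0))) *\<^sub>R J v)"
        by simp
      then have "K v = (1 / (2 * s0)) *\<^sub>R ((2 * (c (x - x0) - c (x + x0))) *\<^sub>R J v)"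
        using s0(1) by simp
      then have Kv: "K v = (2 * s x) *\<^sub>R J v" unfolding s_def by simp
      have "2 *\<^sub>R R x v = (R x v + R (- x) v) + K v" unfolding K_def by (simp add: scaleR_2)
      also have "\<dots> = 2 *\<^sub>R (c x *\<^sub>R v + s x *\<^sub>R J v)"
        unfolding c[OF v, of x] Kv by (simp add: scaleR_add_right)
      finally have "2 *\<^sub>R R x v = 2 *\<^sub>R (c x *\<^sub>R v + s x *\<^sub>R J v)" .
      then show ?thesis by (simp only: scaleR_cancel_left) simp
    qed
    have Jww: "J w \<bullet> w = 0" unfolding J_def by (simp add: inner_diff_left cw[symmetric] w)
    have JwJw: "J w \<bullet> J w = 1"
    proof -
      have "s0\<^sup>2 * (J w \<bullet> J w) = (R x0 w - c x0 *\<^sub>R w) \<bullet> (R x0 w - c x0 *\<^sub>R w)"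
        unfolding J_def using s0(1) by (simp add: power2_eq_square)
      also have "\<dots> = s0\<^sup>2" using R_inner[OF wV wV, of x0] w s0(2)
        by (simp add: inner_diff_left inner_diff_right cw[symmetric] inner_commute[of w "R x0 w"] power2_eq_square)
      finally show ?thesis using s0(1) by simp
    qed
    have sJ: "s x = R x w \<bullet> J w" for x
      unfolding RJc[OF w(1), of x] using Jww JwJw by (simp add: inner_add_left inner_commute[of w "J w"])
    define f where "f x = Complex (c x) (s x)" for x
    have "continuous_on UNIV f"
      unfolding f_def Complex_eq cw sJ using R_cont[OF wV] by (intro continuous_intros)
    moreover have "f (x + y) = f x * f y" for x y
    proof -
      have "R (x + y) w = R x (c y *\<^sub>R w + s y *\<^sub>R J w)" using R_plus[OF wV] RJc[OF w(1), of y] by simp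
      also have "\<dots> = c y *\<^sub>R R x w + s y *\<^sub>R R x (J w)"
        using wV JW[OF w(1)] WV by (simp add: R_add R_scale V_closed subset_iff)
      also have "\<dots> = (c x * c y - s x * s y) *\<^sub>R w + (s x * c y + c x * s y) *\<^sub>R J w"
        unfolding RJc[OF w(1), of x] RJc[OF JW[OF w(1)], of x] JJ[OF w(1)] by (simp add: algebra_simps)
      finally have e: "R (x + y) w = (c x * c y - s x * s y) *\<^sub>R w + (s x * c y + c x * s y) *\<^sub>R J w" .
      have "c (x + y) = c x * c y - s x * s y" unfolding cw[of "x + y"] e using Jww w by (simp add: inner_add_left)
      moreover have "s (x + y) = s x * c y + c x * s y" unfolding sJ[of "x + y"] e
        using Jww JwJw by (simp add: inner_add_left inner_commute[of w "J w"])
      ultimately show ?thesis unfolding f_def by (simp add: complex_eq_iff)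
    qed
    moreover have "cmod (f x) = 1" for x
    proof -
      have "R x w \<bullet> R x w = 1" using R_inner[OF wV wV] w by simp
      then have "(c x)\<^sup>2 + (s x)\<^sup>2 = 1" unfolding RJc[OF w(1), of x] using Jww JwJw w
        by (simp add: inner_add_left inner_add_right inner_commute[of w "J w"] power2_eq_square)
      then show ?thesis unfolding f_def by (simp add: cmod_def)
    qed
    ultimately obtain a where "\<And>x. f x = cis (2 * pi * (a \<bullet> x))" using continuous_unit_character[of f] by metis
    then have "c x = cos (2 * pi * (a \<bullet> x))" for x by (metis f_def cis.sel(1) complex.sel(1))
    then show ?thesis by blast
  qed
  then obtain a where "\<And>x. c x = cos (2 * pi * (a \<bullet> x))" by blast
  then have "W \<subseteq> wspace a" unfolding wspace_def using c WV by auto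
  then show ?thesis using that W by blast
qed

end

lemma in_span_pair: "x \<in> span {u, v} \<longleftrightarrow> (\<exists>\<alpha> \<beta>. x = \<alpha> *\<^sub>R u + \<beta> *\<^sub>R v)"
  unfolding span_insert span_singleton by (auto simp: algebra_simps)

lemma independent_not_uminus:
  fixes B :: "'a::real_vector set"
  assumes "independent B" "a \<in> B" "b \<in> B" "a = - b"
  shows False
proof -
  have "b \<noteq> 0" "a \<noteq> 0" using assms dependent_zero by blast+
  have "a \<noteq> b"
  proof
    assume "a = b"
    then have "2 *\<^sub>R b = 0" using assms(4) unfolding scaleR_2 by (metis add.right_inverse)
    with \<open>b \<noteq> 0\<close> show False by simp
  qed
  then have "b \<in> span (B - {a})" using assms(3) by (intro span_base) auto
  then have "a \<in> span (B - {a})" unfolding assms(4) by (rule span_neg)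
  then show False using assms unfolding dependent_def by blast
qed

context vector_group_rep begin

text \<open>
  If the symmetric part of an isometry fixes \<open>v\<close>, then so does the isometry.
\<close>

lemma wspace_fixed:
  assumes "v \<in> wspace a" "a \<bullet> x \<in> \<int>"
  shows "R x v = v"
proof -
  have v: "v \<in> V" "R x v + R (- x) v = 2 *\<^sub>R v"
    using assms unfolding wspace_def by (auto simp: cos_integer_2pi)
  have "R x v \<bullet> v + R (- x) v \<bullet> v = 2 * (v \<bullet> v)" using v(2) by (metis inner_add_left inner_scaleR_left)
  moreover have "R (- x) v \<bullet> v = R x v \<bullet> v" using R_adjoint[OF v(1) v(1), of x] by (simp add: inner_commute)
  ultimately have "(R x v - v) \<bullet> (R x v - v) = 0"
    using R_inner[OF v(1) v(1), of x] by (simp add: inner_diff_left inner_diff_right inner_commute)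
  then show ?thesis by simp
qed

lemma wspace_zero: "v \<in> wspace 0 \<Longrightarrow> R x v = v"
  by (erule wspace_fixed) simp

lemma wspace_fixed_imp:
  assumes "v \<in> wspace a" "v \<noteq> 0" "R x v = v"
  shows "a \<bullet> x \<in> \<int>"
proof -
  have v: "v \<in> V" "R x v + R (- x) v = (2 * cos (2 * pi * (a \<bullet> x))) *\<^sub>R v"
    using assms(1) unfolding wspace_def by auto
  have "R (- x) v = v" using R_fix_iff[OF v(1)] assms(3) by blast
  then have "2 *\<^sub>R v = (2 * cos (2 * pi * (a \<bullet> x))) *\<^sub>R v"
    unfolding v(2)[symmetric] assms(3) by (simp add: scaleR_2)
  then have "cos (2 * pi * (a \<bullet> x)) = 1" using assms(2) by simp
  then obtain k :: int where "2 * pi * (a \<bullet> x) = of_int k * 2 * pi" by (auto simp: cos_one_2pi_int)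
  then have "a \<bullet> x = of_int k" by simp
  then show ?thesis by simp
qed

section \<open>Decomposition into weight spaces\<close>

lemma invariantD:
  assumes "invariant W"
  shows "subspace W" "W \<subseteq> V" "\<And>x w. w \<in> W \<Longrightarrow> R x w \<in> W"
  using assms unfolding invariant_def by auto

text \<open>
  The orthogonal complement of the span of all weight vectors in \<open>X\<close> is invariant, so if it were
  non-zero it would contain a weight vector.
\<close>

lemma invariant_span_weight_vectors:
  assumes X: "invariant X"
  shows "X = span (\<Union>a. X \<inter> wspace a)"
proof -
  note X' = invariantD[OF X]
  define Y where "Y = span (\<Union>a. X \<inter> wspace a)"
  have YX: "Y \<subseteq> X" unfolding Y_def by (rule span_minimal) (use X' in auto)
  have RYV: "R x y \<in> Y \<and> y \<in> V" if "y \<in> Y" for x y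
    using that unfolding Y_def
  proof (induction rule: span_induct_alt)
    case base
    then show ?case by (simp add: span_zero V_closed)
  next
    case (step c u y)
    have "u \<in> V" "y \<in> V" using step X'(2) by auto
    moreover have "R x u \<in> (\<Union>a. X \<inter> wspace a)"
    proof -
      obtain a where "u \<in> X" "u \<in> wspace a" using step(1) by blast
      then have "R x u \<in> X" "R x u \<in> wspace a" using X'(3) invariantD(3)[OF invariant_wspace] by blast+
      then show ?thesis by blast
    qed
    then have "R x u \<in> span (\<Union>a. X \<inter> wspace a)" by (rule span_base)
    ultimately show ?case using step by (simp add: R_add R_scale V_closed span_add span_scale)
  qed
  then have RY: "R x y \<in> Y" if "y \<in> Y" for x y using that by blast
  define Z where "Z = {z \<in> X. \<forall>y\<in>Y. y \<bullet> z = 0}"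
  have "invariant Z"
  proof -
    have "subspace Z" unfolding Z_def using X'(1)
      by (auto simp: subspace_def inner_add_right)
    moreover have "R x z \<in> Z" if z: "z \<in> Z" for x z
    proof -
      have "y \<bullet> R x z = 0" if "y \<in> Y" for y
      proof -
        have "y \<in> V" "z \<in> V" using that z YX X'(2) unfolding Z_def by auto
        then have "y \<bullet> R x z = R (- x) y \<bullet> z" using R_adjoint[of y z "- x"] by simp
        then show ?thesis using RY[OF that] z unfolding Z_def by auto
      qed
      then show ?thesis using z X'(3) unfolding Z_def by auto
    qed
    ultimately show ?thesis using X'(2) unfolding invariant_def Z_def by auto
  qed
  have "Z = {0}"
  proof (rule ccontr)
    assume "Z \<noteq> {0}"
    then obtain W a where W: "invariant W" "W \<subseteq> Z" "W \<noteq> {0}" "W \<subseteq> wspace a"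
      using invariant_contains_weight_vector[OF \<open>invariant Z\<close>] by metis
    then obtain w where w: "w \<in> W" "w \<noteq> 0" using subspace_0[OF invariantD(1)[OF W(1)]] by blast
    then have "w \<in> Y" using W unfolding Y_def Z_def by (intro span_base) auto
    then have "w \<bullet> w = 0" using w W(2) unfolding Z_def by blast
    then show False using w by simp
  qed
  have "X \<subseteq> Y"
  proof
    fix x assume x: "x \<in> X"
    obtain y z where yz: "y \<in> span Y" "\<And>w. w \<in> span Y \<Longrightarrow> orthogonal z w" "x = y + z"
      using orthogonal_subspace_decomp_exists[of Y x] by metis
    have y: "y \<in> Y" using yz(1) unfolding Y_def by (simp add: span_span)
    then have "z \<in> X" using x yz(3) YX X'(1) by (metis add_diff_cancel_left' subsetD subspace_diff)
    then have "z \<in> Z" unfolding Z_def using yz(2)[OF span_base] by (auto simp: orthogonal_def inner_commute)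
    then show "x \<in> Y" using \<open>Z = {0}\<close> y yz(3) by simp
  qed
  then show ?thesis using YX unfolding Y_def by blast
qed

lemma weights_uminus: "a \<in> weights \<Longrightarrow> - a \<in> weights"
  unfolding weights_def by (simp add: wspace_uminus)

lemma wspace_cases:
  assumes "v \<in> wspace a" "v \<noteq> 0"
  shows "a = 0 \<or> a \<in> weights"
  using assms unfolding weights_def by auto

lemma R_trivial_if_weights_integral:
  assumes "\<And>a. a \<in> weights \<Longrightarrow> a \<bullet> x \<in> \<int>" "v \<in> V"
  shows "R x v = v"
proof -
  have "v \<in> span (\<Union>a. V \<inter> wspace a)" using invariant_span_weight_vectors[OF invariant_V] assms(2) by blast
  then have "v \<in> V \<and> R x v = v"
  proof (induction rule: span_induct_alt)
    case base
    then show ?case by (simp add: V_closed)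
  next
    case (step c u y)
    then obtain a where a: "u \<in> V" "u \<in> wspace a" by blast
    have "R x u = u"
    proof (cases "u = 0")
      case False
      then have "a \<bullet> x \<in> \<int>" using wspace_cases[OF a(2)] assms(1) by auto
      then show ?thesis using wspace_fixed a by blast
    qed simp
    then show ?case using step a by (simp add: R_add R_scale V_closed)
  qed
  then show ?thesis by blast
qed

definition weight_vector :: "'e \<Rightarrow> 'v" where
  "weight_vector a = (SOME v. v \<in> wspace a \<and> v \<noteq> 0)"

lemma weight_vector:
  assumes "a \<in> weights"
  shows "weight_vector a \<in> wspace a" "weight_vector a \<noteq> 0"
proof -
  have "\<exists>v. v \<in> wspace a \<and> v \<noteq> 0"
    using assms subspace_0[OF invariantD(1)[OF invariant_wspace[of a]]] unfolding weights_def by blast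
  then have "weight_vector a \<in> wspace a \<and> weight_vector a \<noteq> 0" unfolding weight_vector_def by (rule someI_ex)
  then show "weight_vector a \<in> wspace a" "weight_vector a \<noteq> 0" by auto
qed

lemma weight_vector_orthogonal:
  assumes "a \<in> weights" "b \<in> weights" "weight_vector a \<noteq> weight_vector b"
  shows "weight_vector a \<bullet> weight_vector b = 0"
proof -
  have "a \<noteq> b" "a \<noteq> - b" using assms(3) unfolding weight_vector_def by (auto simp: wspace_uminus)
  then show ?thesis using wspace_orthogonal weight_vector assms by blast
qed

text \<open>
  Weights that differ by more than a sign have orthogonal weight vectors.
\<close>

lemma finite_weights: "finite weights"
proof -
  have "pairwise orthogonal (weight_vector ` weights)"
    using weight_vector_orthogonal by (auto simp: pairwise_def orthogonal_def)
  moreover have "0 \<notin> weight_vector ` weights" using weight_vector(2) by force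
  ultimately have "finite (weight_vector ` weights)"
    using pairwise_orthogonal_independent independent_imp_finite by blast
  moreover have "finite (weight_vector -` {v} \<inter> weights)" if "v \<in> weight_vector ` weights" for v
  proof -
    obtain a where a: "a \<in> weights" "v = weight_vector a" using \<open>v \<in> weight_vector ` weights\<close> by blast
    have "b = a \<or> b = - a" if b: "b \<in> weights" "weight_vector b = v" for b
    proof (rule ccontr)
      assume "\<not> (b = a \<or> b = - a)"
      then have "weight_vector b \<bullet> weight_vector a = 0" using wspace_orthogonal weight_vector a b by blast
      then show False using b a weight_vector(2) by auto
    qed
    then have "weight_vector -` {v} \<inter> weights \<subseteq> {a, - a}" by auto
    then show ?thesis by (rule finite_subset) simp
  qed
  ultimately have "finite (weight_vector -` (weight_vector ` weights) \<inter> weights)"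
    by (rule finite_finite_vimage_IntI)
  moreover have "weights \<subseteq> weight_vector -` (weight_vector ` weights) \<inter> weights" by blast
  ultimately show ?thesis by (rule rev_finite_subset)
qed

text \<open>
  The element of the vector group at which the weight \<open>a\<close> takes the value 1/4 acts on the weight space
  as a rotation by a right angle, that is, as a complex structure.
\<close>

definition J :: "'e \<Rightarrow> 'v \<Rightarrow> 'v" where
  "J a = R ((1 / (4 * (a \<bullet> a))) *\<^sub>R a)"

lemma J_closed:
  assumes "invariant W" "v \<in> W"
  shows "J a v \<in> W"
  unfolding J_def using invariantD(3)[OF assms(1)] assms(2) by blast

lemma J_wspace: "v \<in> wspace a \<Longrightarrow> J a v \<in> wspace a"
  by (rule J_closed[OF invariant_wspace])

lemma J_linear: "u \<in> V \<Longrightarrow> v \<in> V \<Longrightarrow> J a (\<alpha> *\<^sub>R u + \<beta> *\<^sub>R v) = \<alpha> *\<^sub>R J a u + \<beta> *\<^sub>R J a v"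
  unfolding J_def by (simp add: R_add R_scale V_closed)

context
  fixes a :: 'e
  assumes a0: "a \<noteq> 0"
begin

lemma R_uminus_J: "v \<in> wspace a \<Longrightarrow> R (- ((1 / (4 * (a \<bullet> a))) *\<^sub>R a)) v = - J a v"
proof -
  assume "v \<in> wspace a"
  then have "R ((1 / (4 * (a \<bullet> a))) *\<^sub>R a) v + R (- ((1 / (4 * (a \<bullet> a))) *\<^sub>R a)) v
      = (2 * cos (2 * pi * (a \<bullet> ((1 / (4 * (a \<bullet> a))) *\<^sub>R a)))) *\<^sub>R v"
    unfolding wspace_def by blast
  also have "2 * pi * (a \<bullet> ((1 / (4 * (a \<bullet> a))) *\<^sub>R a)) = pi / 2" using a0 by simp
  finally show ?thesis unfolding J_def by (simp add: add_eq_0_iff)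
qed

lemma J_J: "v \<in> wspace a \<Longrightarrow> J a (J a v) = - v"
proof -
  assume v: "v \<in> wspace a"
  have "v = R (- ((1 / (4 * (a \<bullet> a))) *\<^sub>R a)) (J a v)"
    unfolding J_def using R_inverse(2) v wspace_subset by (metis subsetD)
  also have "\<dots> = - J a (J a v)" by (rule R_uminus_J[OF J_wspace[OF v]])
  finally show ?thesis by (simp add: equation_minus_iff)
qed

lemma J_orthogonal: "v \<in> wspace a \<Longrightarrow> J a v \<bullet> v = 0"
proof -
  assume v: "v \<in> wspace a"
  then have "v \<in> V" using wspace_subset by blast
  then have "J a v \<bullet> v = v \<bullet> (- J a v)" unfolding J_def using R_adjoint R_uminus_J[OF v] by (metis J_def)
  then show ?thesis by (simp add: inner_commute)
qed

lemma J_inner: "v \<in> wspace a \<Longrightarrow> J a v \<bullet> J a v = v \<bullet> v"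
  unfolding J_def using R_inner wspace_subset by blast

lemma R_eq_rotation:
  assumes v: "v \<in> wspace a"
  shows "R x v = cos (2 * pi * (a \<bullet> x)) *\<^sub>R v + sin (2 * pi * (a \<bullet> x)) *\<^sub>R J a v"
proof -
  define x0 where "x0 = (1 / (4 * (a \<bullet> a))) *\<^sub>R a"
  define \<theta> where "\<theta> = 2 * pi * (a \<bullet> x)"
  have x0: "2 * pi * (a \<bullet> x0) = pi / 2" using a0 unfolding x0_def by simp
  have w: "R y u + R (- y) u = (2 * cos (2 * pi * (a \<bullet> y))) *\<^sub>R u" if "u \<in> wspace a" for u y
    using that unfolding wspace_def by blast
  have K: "R x (J a u) - R (- x) (J a u) = - (2 * sin \<theta>) *\<^sub>R u" if u: "u \<in> wspace a" for u
  proof -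
    have uV: "u \<in> V" using u wspace_subset by blast
    have "R x (J a u) = R (x + x0) u" unfolding J_def x0_def using R_plus[OF uV] by simp
    moreover have "R (- x) (J a u) = - R (- (x + x0)) u"
    proof -
      have "R (- (x + x0)) u = R (- x) (R (- x0) u)" using R_plus[OF uV, of "- x" "- x0"] by simp
      also have "\<dots> = R (- x) (- J a u)" using R_uminus_J[OF u] unfolding x0_def by simp
      also have "\<dots> = - R (- x) (J a u)"
        using R_scale[of "J a u" "- x" "-1"] J_wspace[OF u] wspace_subset by auto
      finally show ?thesis by simp
    qed
    moreover have "cos (2 * pi * (a \<bullet> (x + x0))) = - sin \<theta>"
      unfolding inner_add_right distrib_left x0 \<theta>_def by (simp add: cos_add)
    ultimately show ?thesis using w[OF u, of "x + x0"] by simp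
  qed
  have Jv: "J a v \<in> wspace a" by (rule J_wspace[OF v])
  have neg: "R y (- v) = - R y v" for y using R_scale[of v y "-1"] v wspace_subset by auto
  have "R x v - R (- x) v = (2 * sin \<theta>) *\<^sub>R J a v"
    using K[OF Jv] unfolding J_J[OF v] neg by (simp add: algebra_simps minus_equation_iff)
  moreover have "R x v + R (- x) v = (2 * cos \<theta>) *\<^sub>R v" using w[OF v, of x] unfolding \<theta>_def .
  moreover have "2 *\<^sub>R R x v = (R x v + R (- x) v) + (R x v - R (- x) v)" by (simp add: scaleR_2)
  ultimately have "2 *\<^sub>R R x v = 2 *\<^sub>R (cos \<theta> *\<^sub>R v + sin \<theta> *\<^sub>R J a v)" by (simp add: scaleR_add_right)
  then show ?thesis unfolding \<theta>_def by (simp only: scaleR_cancel_left) simp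
qed

lemma invariant_rotation_plane:
  assumes v: "v \<in> wspace a"
  shows "invariant (span {v, J a v})"
proof -
  have V: "v \<in> V" "J a v \<in> V" using v J_wspace wspace_subset by blast+
  then have "span {v, J a v} \<subseteq> V" by (intro span_minimal) (auto simp: subspace_V)
  moreover have "R x u \<in> span {v, J a v}" if u: "u \<in> span {v, J a v}" for x u
  proof -
    have "R x v \<in> span {v, J a v}" unfolding R_eq_rotation[OF v] by (intro span_add span_scale span_base) auto
    moreover have "R x (J a v) \<in> span {v, J a v}" unfolding R_eq_rotation[OF J_wspace[OF v]] J_J[OF v]
      by (intro span_add span_scale span_neg span_base) auto
    moreover obtain \<alpha> \<beta> where "u = \<alpha> *\<^sub>R v + \<beta> *\<^sub>R J a v" using u unfolding in_span_pair by blast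
    ultimately show ?thesis using V by (simp add: R_add R_scale V_closed span_add span_scale)
  qed
  ultimately show ?thesis unfolding invariant_def by simp
qed

lemma dim_rotation_plane:
  assumes v: "v \<in> wspace a" "v \<noteq> 0"
  shows "dim (span {v, J a v}) = 2"
proof -
  have "J a v \<noteq> 0" using J_inner[OF v(1)] v(2) by auto
  moreover have "pairwise orthogonal {v, J a v}"
    using J_orthogonal[OF v(1)] by (auto simp: pairwise_def orthogonal_def inner_commute)
  ultimately have "independent {v, J a v}" using v by (intro pairwise_orthogonal_independent) auto
  moreover have "v \<noteq> J a v" using J_orthogonal[OF v(1)] v(2) by auto
  ultimately show ?thesis by (simp add: dim_eq_card_independent)
qed

end

definition irreducible :: "'v set \<Rightarrow> bool" where
  "irreducible W \<longleftrightarrow> invariant W \<and> W \<noteq> {0} \<and> (\<forall>U. invariant U \<and> U \<subseteq> W \<longrightarrow> U = {0} \<or> U = W)"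

lemma irreducible_in_wspace:
  assumes "irreducible W"
  obtains a where "W \<subseteq> wspace a"
proof -
  obtain W' a where "invariant W'" "W' \<subseteq> W" "W' \<noteq> {0}" "W' \<subseteq> wspace a"
    using invariant_contains_weight_vector[of W] assms unfolding irreducible_def by metis
  then show ?thesis using that assms unfolding irreducible_def by metis
qed

lemma irreducible_rotation_plane:
  assumes a: "a \<noteq> 0" and v: "v \<in> wspace a" "v \<noteq> 0"
  shows "irreducible (span {v, J a v})"
  unfolding irreducible_def
proof (intro conjI allI impI)
  show "invariant (span {v, J a v})" by (rule invariant_rotation_plane[OF a v(1)])
  show "span {v, J a v} \<noteq> {0}" using dim_rotation_plane[OF a v] by force
  fix U assume U: "invariant U \<and> U \<subseteq> span {v, J a v}"
  show "U = {0} \<or> U = span {v, J a v}"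
  proof (cases "U = {0}")
    case False
    then obtain u where u: "u \<in> U" "u \<noteq> 0" using U subspace_0[OF invariantD(1)] by blast
    have "{v, J a v} \<subseteq> wspace a" using v J_wspace by auto
    then have "span {v, J a v} \<subseteq> wspace a" by (rule span_minimal) (rule invariantD(1)[OF invariant_wspace])
    then have uw: "u \<in> wspace a" using u U by blast
    have "{u, J a u} \<subseteq> U" using u U J_closed by blast
    then have "dim (span {u, J a u}) \<le> dim U" by (simp add: dim_subset)
    then have "2 \<le> dim U" using dim_rotation_plane[OF a uw u(2)] by simp
    then have "U = span {v, J a v}" using U dim_rotation_plane[OF a v]
      by (intro subspace_dim_equal) (auto simp: invariantD(1))
    then show ?thesis by blast
  qed simp
qed

lemma irreducible_eq_rotation_plane:
  assumes "irreducible W" "a \<noteq> 0" "W \<subseteq> wspace a" "w \<in> W" "w \<noteq> 0"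
  shows "W = span {w, J a w}"
proof -
  have inv: "invariant W" using assms(1) unfolding irreducible_def by blast
  have "span {w, J a w} \<subseteq> W"
    by (rule span_minimal) (use assms inv J_closed invariantD(1) in auto)
  moreover have "w \<in> wspace a" using assms by blast
  then have "invariant (span {w, J a w})" by (rule invariant_rotation_plane[OF assms(2)])
  moreover have "span {w, J a w} \<noteq> {0}" using assms(5) span_base[of w "{w, J a w}"] by auto
  ultimately show ?thesis using assms(1) unfolding irreducible_def by metis
qed

lemma irreducible_unit_vector:
  assumes "irreducible W"
  obtains w where "w \<in> W" "w \<bullet> w = 1"
proof -
  have sW: "subspace W" "W \<noteq> {0}" using assms invariantD(1) unfolding irreducible_def by auto
  then obtain u where u: "u \<in> W" "u \<noteq> 0" using subspace_0 by blast
  show ?thesis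
    by (rule that[of "(1 / norm u) *\<^sub>R u"]) (use u sW in \<open>auto simp: subspace_scale dot_square_norm power2_eq_square\<close>)
qed

text \<open>
  Both spaces are rotation planes on which each \<open>x\<close> acts by the same angle.
\<close>

lemma irreducible_same_weight_equivalent:
  assumes W: "irreducible W" "W \<subseteq> wspace a" and W': "irreducible W'" "W' \<subseteq> wspace a" and a: "a \<noteq> 0"
  obtains f where "linear f" "bij_betw f W W'" "\<And>x w. w \<in> W \<Longrightarrow> f (R x w) = R x (f w)"
proof -
  obtain w where w: "w \<in> W" "w \<bullet> w = 1" using irreducible_unit_vector[OF W(1)] .
  obtain w' where w': "w' \<in> W'" "w' \<bullet> w' = 1" using irreducible_unit_vector[OF W'(1)] .
  have wa: "w \<in> wspace a" "w' \<in> wspace a" using w w' W W' by auto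
  have eqW: "W = span {w, J a w}" by (rule irreducible_eq_rotation_plane[OF W(1) a W(2) w(1)]) (use w in auto)
  have eqW': "W' = span {w', J a w'}" by (rule irreducible_eq_rotation_plane[OF W'(1) a W'(2) w'(1)]) (use w' in auto)
  define f where "f v = (v \<bullet> w) *\<^sub>R w' + (v \<bullet> J a w) *\<^sub>R J a w'" for v
  have lin: "linear f" unfolding f_def
    by (intro linearI) (simp_all add: inner_add_left scaleR_add_left scaleR_add_right)
  have o: "J a w \<bullet> w = 0" "w \<bullet> J a w = 0" "J a w \<bullet> J a w = 1"
    using J_orthogonal[OF a wa(1)] J_inner[OF a wa(1)] w by (simp_all add: inner_commute)
  have o': "J a w' \<bullet> w' = 0" "w' \<bullet> J a w' = 0" "J a w' \<bullet> J a w' = 1"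
    using J_orthogonal[OF a wa(2)] J_inner[OF a wa(2)] w' by (simp_all add: inner_commute)
  have f: "f (\<alpha> *\<^sub>R w + \<beta> *\<^sub>R J a w) = \<alpha> *\<^sub>R w' + \<beta> *\<^sub>R J a w'" for \<alpha> \<beta>
    unfolding f_def using o w by (simp add: inner_add_left)
  have img: "f ` W = W'"
    unfolding eqW eqW' by (force simp: in_span_pair f image_iff)
  have inj: "inj_on f W"
  proof (rule inj_onI)
    fix u v assume uv: "u \<in> W" "v \<in> W" "f u = f v"
    obtain \<alpha> \<beta> where u: "u = \<alpha> *\<^sub>R w + \<beta> *\<^sub>R J a w" using uv(1) unfolding eqW in_span_pair by blast
    obtain \<gamma> \<delta> where v: "v = \<gamma> *\<^sub>R w + \<delta> *\<^sub>R J a w" using uv(2) unfolding eqW in_span_pair by blast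
    have e: "\<alpha> *\<^sub>R w' + \<beta> *\<^sub>R J a w' = \<gamma> *\<^sub>R w' + \<delta> *\<^sub>R J a w'" using uv(3) unfolding u v f .
    have "\<alpha> = \<gamma>" using arg_cong[OF e, of "\<lambda>x. x \<bullet> w'"] o' w' by (simp add: inner_add_left)
    moreover have "\<beta> = \<delta>" using arg_cong[OF e, of "\<lambda>x. x \<bullet> J a w'"] o' w' by (simp add: inner_add_left)
    ultimately show "u = v" unfolding u v by simp
  qed
  have equi: "f (R x u) = R x (f u)" if u: "u \<in> W" for x u
  proof -
    obtain \<alpha> \<beta> where uc: "u = \<alpha> *\<^sub>R w + \<beta> *\<^sub>R J a w" using u unfolding eqW in_span_pair by blast
    have V: "w \<in> V" "w' \<in> V" "J a w \<in> V" "J a w' \<in> V" using wa J_wspace wspace_subset by blast+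
    have Ju: "J a u = (- \<beta>) *\<^sub>R w + \<alpha> *\<^sub>R J a w"
      unfolding uc J_linear[OF V(1,3)] J_J[OF a wa(1)] by simp
    have fu: "f u = \<alpha> *\<^sub>R w' + \<beta> *\<^sub>R J a w'" unfolding uc f ..
    have Jfu: "J a (f u) = (- \<beta>) *\<^sub>R w' + \<alpha> *\<^sub>R J a w'"
      unfolding fu J_linear[OF V(2,4)] J_J[OF a wa(2)] by simp
    have fJ: "f (J a u) = J a (f u)" unfolding Ju Jfu f ..
    have "u \<in> wspace a" "f u \<in> wspace a" using u img W(2) W'(2) by blast+
    then show ?thesis
      by (simp add: R_eq_rotation[OF a] linear_add[OF lin] linear_scale[OF lin] fJ)
  qed
  show ?thesis using that[of f] lin inj img equi unfolding bij_betw_def by blast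
qed

lemma equivalent_imp_same_weight:
  assumes W: "w \<in> W" "w \<noteq> 0" "W \<subseteq> wspace a" "subspace W" and W': "W' \<subseteq> wspace b"
    and f: "linear f" "bij_betw f W W'" and equi: "\<And>x w. w \<in> W \<Longrightarrow> f (R x w) = R x (f w)"
  shows "a = b \<or> a = - b"
proof (rule cos_inner_eq_imp)
  fix x
  have "f w \<noteq> 0"
  proof
    assume "f w = 0"
    then have "f w = f 0" using linear_0[OF f(1)] by simp
    then show False using f(2) W subspace_0 unfolding bij_betw_def inj_on_def by blast
  qed
  moreover have "f (R x w + R (- x) w) = (2 * cos (2 * pi * (a \<bullet> x))) *\<^sub>R f w"
  proof -
    have "R x w + R (- x) w = (2 * cos (2 * pi * (a \<bullet> x))) *\<^sub>R w" using W unfolding wspace_def by blast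
    then show ?thesis by (simp add: linear_scale[OF f(1)])
  qed
  moreover have "f (R x w + R (- x) w) = (2 * cos (2 * pi * (b \<bullet> x))) *\<^sub>R f w"
  proof -
    have "f w \<in> wspace b" using f(2) W(1) W' unfolding bij_betw_def by blast
    then have "R x (f w) + R (- x) (f w) = (2 * cos (2 * pi * (b \<bullet> x))) *\<^sub>R f w" unfolding wspace_def by blast
    then show ?thesis using W(1) by (simp add: linear_add[OF f(1)] equi)
  qed
  ultimately show "cos (2 * pi * (a \<bullet> x)) = cos (2 * pi * (b \<bullet> x))" by simp
qed

text \<open>
  One weight vector for each member of \<open>B\<close>, together with the image under \<open>J\<close> of one of them, form an
  orthogonal system. The strict inequality is what \<open>torus_rank_le_DIM\<close> needs.
\<close>

lemma card_independent_weights_less: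
  assumes B: "B \<subseteq> weights" "independent B" "B \<noteq> {}"
  shows "card B < DIM('v)"
proof -
  have finB: "finite B" using B finite_weights finite_subset by blast
  obtain b where b: "b \<in> B" using B by blast
  then have b0: "b \<noteq> 0" using B unfolding weights_def by auto
  have wv: "weight_vector c \<in> wspace c" "weight_vector c \<noteq> 0" if "c \<in> B" for c using weight_vector B that by blast+
  define u where "u = J b (weight_vector b)"
  have u: "u \<in> wspace b" "u \<noteq> 0" using J_wspace[OF wv(1)[OF b]] J_inner[OF b0 wv(1)[OF b]] wv(2)[OF b] unfolding u_def by auto
  have ou: "u \<bullet> weight_vector c = 0" if "c \<in> B" for c
  proof (cases "c = b")
    case True
    then show ?thesis using J_orthogonal[OF b0 wv(1)[OF b]] unfolding u_def by simp
  next
    case False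
    then show ?thesis using wspace_orthogonal[OF u(1) wv(1)[OF that]] independent_not_uminus[OF B(2) b that] by blast
  qed
  have inj: "inj_on weight_vector B"
  proof (rule inj_onI, rule ccontr)
    fix c d assume cd: "c \<in> B" "d \<in> B" "weight_vector c = weight_vector d" "c \<noteq> d"
    then have "weight_vector c \<bullet> weight_vector d = 0"
      using wspace_orthogonal[OF wv(1)[OF cd(1)] wv(1)[OF cd(2)]] independent_not_uminus[OF B(2) cd(1,2)] by blast
    then show False using cd wv by auto
  qed
  have "u \<notin> weight_vector ` B" using ou u(2) by (metis imageE inner_eq_zero_iff)
  then have "card (insert u (weight_vector ` B)) = card B + 1" using finB inj by (simp add: card_image)
  moreover have "pairwise orthogonal (insert u (weight_vector ` B))"
    unfolding pairwise_insert
  proof (intro conjI allI impI)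
    show "pairwise orthogonal (weight_vector ` B)"
      using weight_vector_orthogonal B(1) unfolding pairwise_def orthogonal_def by blast
    fix y assume "y \<in> weight_vector ` B \<and> y \<noteq> u"
    then show "orthogonal u y" "orthogonal y u" using ou unfolding orthogonal_def by (auto simp: inner_commute)
  qed
  then have "independent (insert u (weight_vector ` B))"
    by (rule pairwise_orthogonal_independent) (use u wv in force)
  then have "card (insert u (weight_vector ` B)) \<le> DIM('v)" by (rule independent_bound[THEN conjunct2])
  ultimately show ?thesis by simp
qed

text \<open>
  The vectors fixed by the common kernel of the characters in \<open>F\<close>.
\<close>

definition common_fixed :: "'e set \<Rightarrow> 'v set" where
  "common_fixed F = {v \<in> V. \<forall>x. (\<forall>f\<in>F. f \<bullet> x \<in> \<int>) \<longrightarrow> R x v = v}"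

lemma invariant_common_fixed: "invariant (common_fixed F)"
proof -
  have "subspace (common_fixed F)"
    unfolding common_fixed_def by (rule subspaceI) (auto simp: V_closed R_add R_scale)
  moreover have "R y v \<in> common_fixed F" if "v \<in> common_fixed F" for y v
    using that R_commute[of v _ y] unfolding common_fixed_def by (auto simp: R_in)
  ultimately show ?thesis unfolding invariant_def common_fixed_def by auto
qed

lemma wspace_common_fixed:
  assumes "f = 0 \<or> f \<in> F"
  shows "wspace f \<subseteq> common_fixed F"
  unfolding common_fixed_def using wspace_fixed wspace_subset assms by fastforce

lemma common_fixed_weight:
  assumes F: "independent F" "\<And>a. a \<in> weights \<Longrightarrow> a \<in> int_span F \<Longrightarrow> a \<in> F \<or> - a \<in> F"
    and v: "v \<in> wspace a" "v \<in> common_fixed F" "v \<noteq> 0"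
  shows "\<exists>f. (f = 0 \<or> f \<in> F) \<and> wspace a = wspace f"
proof -
  have "a \<in> int_span F"
    by (rule int_span_if_annihilated[OF F(1)]) (use v wspace_fixed_imp[OF v(1,3)] in \<open>auto simp: common_fixed_def\<close>)
  then show ?thesis using wspace_cases[OF v(1,3)] F(2)[of a] wspace_uminus by metis
qed

lemma common_fixed_eq_span:
  assumes F: "independent F" "\<And>a. a \<in> weights \<Longrightarrow> a \<in> int_span F \<Longrightarrow> a \<in> F \<or> - a \<in> F"
  shows "common_fixed F = span (wspace 0 \<union> (\<Union>f\<in>F. wspace f))"
proof
  show "span (wspace 0 \<union> (\<Union>f\<in>F. wspace f)) \<subseteq> common_fixed F"
    by (rule span_minimal) (use wspace_common_fixed invariantD(1)[OF invariant_common_fixed] in auto)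
  have "(\<Union>a. common_fixed F \<inter> wspace a) \<subseteq> span (wspace 0 \<union> (\<Union>f\<in>F. wspace f))"
  proof
    fix v assume "v \<in> (\<Union>a. common_fixed F \<inter> wspace a)"
    then obtain a where v: "v \<in> common_fixed F" "v \<in> wspace a" by blast
    show "v \<in> span (wspace 0 \<union> (\<Union>f\<in>F. wspace f))"
    proof (cases "v = 0")
      case True
      then show ?thesis by (simp add: span_zero)
    next
      case False
      then show ?thesis using common_fixed_weight[OF F v(2,1)] v(2) by (intro span_base) blast
    qed
  qed
  then have "span (\<Union>a. common_fixed F \<inter> wspace a) \<subseteq> span (wspace 0 \<union> (\<Union>f\<in>F. wspace f))"
    by (rule span_minimal) simp
  then show "common_fixed F \<subseteq> span (wspace 0 \<union> (\<Union>f\<in>F. wspace f))"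
    using invariant_span_weight_vectors[OF invariant_common_fixed] by blast
qed

end

section \<open>Determinants indexed by a finite set\<close>

text \<open>
  The Leibniz formula occurring in \<^const>\<open>det_on\<close>, for matrices indexed by an arbitrary finite set.
\<close>

definition leibniz_det :: "'i set \<Rightarrow> ('i \<Rightarrow> 'i \<Rightarrow> real) \<Rightarrow> real" where
  "leibniz_det B M = (\<Sum>p | p permutes B. of_int (sign p) * (\<Prod>b\<in>B. M b (p b)))"

lemma leibniz_det_transpose:
  assumes "finite B"
  shows "leibniz_det B (\<lambda>b c. M c b) = leibniz_det B M"
proof -
  have "leibniz_det B (\<lambda>b c. M c b) = (\<Sum>p | p permutes B. of_int (sign (inv_into UNIV p)) * (\<Prod>b\<in>B. M (inv_into UNIV p b) b))"
    unfolding leibniz_det_def by (rule sum_permutations_inverse)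
  also have "\<dots> = leibniz_det B M"
    unfolding leibniz_det_def
  proof (rule sum.cong[OF refl])
    fix p assume "p \<in> {p. p permutes B}"
    then have p: "p permutes B" by simp
    have "(\<Prod>b\<in>B. M (inv_into UNIV p b) b) = (\<Prod>b\<in>p ` B. M (inv_into UNIV p b) b)" using permutes_image[OF p] by simp
    also have "\<dots> = (\<Prod>b\<in>B. M b (p b))"
      using permutes_inj[OF p] by (subst prod.reindex) (auto simp: permutes_inverses[OF p] intro: inj_on_subset)
    finally show "of_int (sign (inv_into UNIV p)) * (\<Prod>b\<in>B. M (inv_into UNIV p b) b) = of_int (sign p) * (\<Prod>b\<in>B. M b (p b))"
      using p assms by (simp add: sign_inverse permutation_permutes) (metis permutation_permutes sign_inverse)
  qed
  finally show ?thesis .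
qed

lemma leibniz_det_identity:
  assumes "finite B"
  shows "leibniz_det B (\<lambda>b c. if b = c then 1 else 0) = 1"
proof -
  have "leibniz_det B (\<lambda>b c. if b = c then 1 else 0)
      = (\<Sum>p | p permutes B. if p = id then 1 else 0)"
    unfolding leibniz_det_def
  proof (rule sum.cong[OF refl])
    fix p assume "p \<in> {p. p permutes B}"
    then have p: "p permutes B" by simp
    show "of_int (sign p) * (\<Prod>b\<in>B. if b = p b then 1 else 0) = (if p = id then 1 else (0::real))"
    proof (cases "p = id")
      case False
      then obtain b where "p b \<noteq> b" by (auto simp: fun_eq_iff)
      moreover have "b \<in> B" using calculation permutes_not_in[OF p] by blast
      ultimately have "\<exists>b\<in>B. (if b = p b then 1 else 0) = (0::real)" by (intro bexI[of _ b]) auto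
      then have "(\<Prod>b\<in>B. if b = p b then 1 else (0::real)) = 0" using assms by (simp add: prod_zero_iff)
      then show ?thesis using False by simp
    qed simp
  qed
  also have "\<dots> = 1" using assms by (simp add: finite_permutations permutes_id)
  finally show ?thesis .
qed

lemma leibniz_det_repeated_rows:
  assumes "finite B" "i \<in> B" "j \<in> B" "i \<noteq> j" "\<kappa> i = \<kappa> j"
  shows "leibniz_det B (\<lambda>b. M (\<kappa> b)) = 0"
proof -
  let ?t = "Transposition.transpose i j"
  have t: "?t permutes B" using assms by (simp add: permutes_swap_id)
  have "leibniz_det B (\<lambda>b. M (\<kappa> b)) = (\<Sum>p | p permutes B. of_int (sign (p \<circ> ?t)) * (\<Prod>b\<in>B. M (\<kappa> b) ((p \<circ> ?t) b)))"
    unfolding leibniz_det_def by (rule sum_permutations_compose_right[OF t])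
  also have "\<dots> = (\<Sum>p | p permutes B. - (of_int (sign p) * (\<Prod>b\<in>B. M (\<kappa> b) (p b))))"
  proof (rule sum.cong[OF refl])
    fix p assume "p \<in> {p. p permutes B}"
    then have p: "p permutes B" by simp
    have "sign (p \<circ> ?t) = - sign p"
    proof -
      have "permutation p" "permutation ?t" using p t assms(1) permutation_permutes by blast+
      then show ?thesis using assms(4) by (simp add: sign_compose sign_swap_id)
    qed
    moreover have "(\<Prod>b\<in>B. M (\<kappa> b) ((p \<circ> ?t) b)) = (\<Prod>b\<in>B. M (\<kappa> b) (p b))"
    proof -
      have k: "\<kappa> (?t b) = \<kappa> b" for b using assms(5) by (auto simp: Transposition.transpose_def)
      have "(\<Prod>b\<in>B. M (\<kappa> b) (p b)) = (\<Prod>b\<in>?t ` B. M (\<kappa> b) (p b))" using permutes_image[OF t] by simp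
      also have "\<dots> = (\<Prod>b\<in>B. M (\<kappa> (?t b)) (p (?t b)))"
        using permutes_inj[OF t] by (subst prod.reindex) (auto intro: inj_on_subset)
      finally show ?thesis unfolding k by simp
    qed
    ultimately show "of_int (sign (p \<circ> ?t)) * (\<Prod>b\<in>B. M (\<kappa> b) ((p \<circ> ?t) b)) = - (of_int (sign p) * (\<Prod>b\<in>B. M (\<kappa> b) (p b)))"
      by simp
  qed
  also have "\<dots> = - leibniz_det B (\<lambda>b. M (\<kappa> b))" unfolding leibniz_det_def by (rule sum_negf)
  finally show ?thesis by simp
qed

lemma leibniz_det_permuted_rows:
  assumes "finite B" "\<pi> permutes B"
  shows "leibniz_det B (\<lambda>b. M (\<pi> b)) = of_int (sign \<pi>) * leibniz_det B M"
proof -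
  have "leibniz_det B (\<lambda>b. M (\<pi> b)) = (\<Sum>p | p permutes B. of_int (sign (p \<circ> \<pi>)) * (\<Prod>b\<in>B. M (\<pi> b) ((p \<circ> \<pi>) b)))"
    unfolding leibniz_det_def by (rule sum_permutations_compose_right[OF assms(2)])
  also have "\<dots> = (\<Sum>p | p permutes B. of_int (sign \<pi>) * (of_int (sign p) * (\<Prod>b\<in>B. M b (p b))))"
  proof (rule sum.cong[OF refl])
    fix p assume "p \<in> {p. p permutes B}"
    then have p: "p permutes B" by simp
    have "permutation p" "permutation \<pi>" using p assms permutation_permutes by blast+
    then have "sign (p \<circ> \<pi>) = sign \<pi> * sign p" by (simp add: sign_compose mult.commute)
    moreover have "(\<Prod>b\<in>B. M (\<pi> b) ((p \<circ> \<pi>) b)) = (\<Prod>b\<in>B. M b (p b))"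
    proof -
      have "(\<Prod>b\<in>B. M b (p b)) = (\<Prod>b\<in>\<pi> ` B. M b (p b))" using permutes_image[OF assms(2)] by simp
      also have "\<dots> = (\<Prod>b\<in>B. M (\<pi> b) (p (\<pi> b)))"
        using permutes_inj[OF assms(2)] by (subst prod.reindex) (auto intro: inj_on_subset)
      finally show ?thesis by simp
    qed
    ultimately show "of_int (sign (p \<circ> \<pi>)) * (\<Prod>b\<in>B. M (\<pi> b) ((p \<circ> \<pi>) b))
        = of_int (sign \<pi>) * (of_int (sign p) * (\<Prod>b\<in>B. M b (p b)))" by simp
  qed
  also have "\<dots> = of_int (sign \<pi>) * leibniz_det B M" unfolding leibniz_det_def by (simp add: sum_distrib_left)
  finally show ?thesis .
qed

text \<open>
  Expanding the product of sums gives a sum over all self-maps \<open>\<kappa>\<close> of the index set, in which the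
  non-injective ones contribute zero because they repeat a row.
\<close>

lemma leibniz_det_mult:
  assumes fin: "finite B"
  shows "leibniz_det B (\<lambda>b c. \<Sum>k\<in>B. M b k * N k c) = leibniz_det B M * leibniz_det B N"
proof -
  let ?P = "{p. p permutes B}" and ?K = "PiE B (\<lambda>_. B)"
  have finK: "finite ?K" using fin by (simp add: finite_PiE)
  have "leibniz_det B (\<lambda>b c. \<Sum>k\<in>B. M b k * N k c)
      = (\<Sum>p\<in>?P. \<Sum>\<kappa>\<in>?K. of_int (sign p) * (\<Prod>b\<in>B. M b (\<kappa> b) * N (\<kappa> b) (p b)))"
    unfolding leibniz_det_def using fin by (simp add: prod_sum_PiE sum_distrib_left)
  also have "\<dots> = (\<Sum>\<kappa>\<in>?K. (\<Prod>b\<in>B. M b (\<kappa> b)) * leibniz_det B (\<lambda>b. N (\<kappa> b)))"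
    unfolding leibniz_det_def sum_distrib_left
    by (subst sum.swap) (intro sum.cong refl, simp add: prod.distrib mult_ac)
  also have "\<dots> = (\<Sum>\<kappa> | \<kappa> \<in> ?K \<and> inj_on \<kappa> B. (\<Prod>b\<in>B. M b (\<kappa> b)) * leibniz_det B (\<lambda>b. N (\<kappa> b)))"
  proof (rule sum.mono_neutral_right[OF finK], blast, rule ballI)
    fix \<kappa> assume "\<kappa> \<in> ?K - {\<kappa> \<in> ?K. inj_on \<kappa> B}"
    then obtain i j where "i \<in> B" "j \<in> B" "i \<noteq> j" "\<kappa> i = \<kappa> j" unfolding inj_on_def by blast
    from leibniz_det_repeated_rows[OF fin this, of N]
    show "(\<Prod>b\<in>B. M b (\<kappa> b)) * leibniz_det B (\<lambda>b. N (\<kappa> b)) = 0" by simp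
  qed
  also have "\<dots> = (\<Sum>p\<in>?P. (\<Prod>b\<in>B. M b (p b)) * leibniz_det B (\<lambda>b. N (p b)))"
  proof (rule sum.reindex_bij_witness[where i = "\<lambda>p. restrict p B" and j = "\<lambda>\<kappa> b. if b \<in> B then \<kappa> b else b"])
    fix \<kappa> assume "\<kappa> \<in> {\<kappa>. \<kappa> \<in> ?K \<and> inj_on \<kappa> B}"
    then have \<kappa>: "\<kappa> \<in> ?K" "inj_on \<kappa> B" by blast+
    have \<kappa>B: "\<kappa> b \<in> B" if "b \<in> B" for b using PiE_mem[OF \<kappa>(1) that] .
    show "restrict (\<lambda>b. if b \<in> B then \<kappa> b else b) B = \<kappa>" using PiE_arb[OF \<kappa>(1)] by (simp add: fun_eq_iff)
    show "(\<lambda>b. if b \<in> B then \<kappa> b else b) \<in> ?P"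
    proof (rule CollectI, rule inj_imp_permutes[OF _ fin])
      show "inj_on (\<lambda>b. if b \<in> B then \<kappa> b else b) B" using \<kappa>(2) by (simp add: inj_on_def)
    qed (use \<kappa>B in simp_all)
    show "(\<Prod>b\<in>B. M b (if b \<in> B then \<kappa> b else b)) * leibniz_det B (\<lambda>b. N (if b \<in> B then \<kappa> b else b))
        = (\<Prod>b\<in>B. M b (\<kappa> b)) * leibniz_det B (\<lambda>b. N (\<kappa> b))"
      unfolding leibniz_det_def by (simp cong: prod.cong)
  next
    fix p assume "p \<in> ?P"
    then have p: "p permutes B" by simp
    show "(\<lambda>b. if b \<in> B then restrict p B b else b) = p" using permutes_not_in[OF p] by (auto simp: fun_eq_iff)
    show "restrict p B \<in> {\<kappa>. \<kappa> \<in> ?K \<and> inj_on \<kappa> B}"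
      using permutes_in_image[OF p] permutes_inj[OF p] by (auto simp: inj_on_def)
  qed
  also have "\<dots> = leibniz_det B M * leibniz_det B N"
    unfolding leibniz_det_def[of B M] sum_distrib_right
    by (intro sum.cong refl) (simp add: leibniz_det_permuted_rows[OF fin])
  finally show ?thesis .
qed

context vector_group_rep begin

text \<open>
  The determinant is multiplicative and invariant under transposition, and \<open>R x\<close> is the square of an
  orthogonal map, namely of \<open>R ((1/2) *\<^sub>R x)\<close>.
\<close>

lemma det_on_R:
  assumes U: "invariant U"
  shows "det_on U (restrict (R x) U) = 1"
proof -
  note U' = invariantD[OF U]
  define B where "B = (SOME B. orthonormal_basis_of U B)"
  have "\<exists>B. orthonormal_basis_of U B"
    using orthonormal_basis_subspace[OF U'(1)] unfolding orthonormal_basis_of_def by metis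
  then have B: "orthonormal_basis_of U B" unfolding B_def by (rule someI_ex)
  then have BU: "B \<subseteq> U" and orth: "pairwise orthogonal B" and norm1: "\<And>b. b \<in> B \<Longrightarrow> norm b = 1" and spanB: "span B = U"
    unfolding orthonormal_basis_of_def by auto
  have "0 \<notin> B" using norm1 by force
  then have fin: "finite B" using orth pairwise_orthogonal_independent independent_imp_finite by blast
  have BV: "b \<in> V" if "b \<in> B" for b using that BU U'(2) by auto
  define D where "D y = leibniz_det B (\<lambda>b c. c \<bullet> R y b)" for y
  have Dplus: "D (y + z) = D z * D y" for y z
  proof -
    have "c \<bullet> R (y + z) b = (\<Sum>k\<in>B. (k \<bullet> R z b) * (c \<bullet> R y k))" if b: "b \<in> B" for b c
    proof -
      have "R z b \<in> U" using b BU U'(3) by blast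
      then have "R z b = (\<Sum>k\<in>B. (R z b \<bullet> k) *\<^sub>R k)"
        using orthonormal_basis_expand[OF orth norm1 _ fin] spanB by metis
      then have "R y (R z b) = R y (\<Sum>k\<in>B. (R z b \<bullet> k) *\<^sub>R k)" by simp
      also have "\<dots> = (\<Sum>k\<in>B. (R z b \<bullet> k) *\<^sub>R R y k)"
        using BV by (subst R_sum) (auto simp: V_closed R_scale intro!: sum.cong)
      finally show ?thesis using R_plus[OF BV[OF b], of y z] by (simp add: inner_sum_right inner_commute)
    qed
    then have "D (y + z) = leibniz_det B (\<lambda>b c. \<Sum>k\<in>B. (k \<bullet> R z b) * (c \<bullet> R y k))"
      unfolding D_def leibniz_det_def by (intro sum.cong refl arg_cong2[where f = "(*)"] prod.cong) auto
    then show ?thesis unfolding D_def by (simp add: leibniz_det_mult[OF fin, of "\<lambda>b k. k \<bullet> R z b" "\<lambda>k c. c \<bullet> R y k"])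
  qed
  have Dneg: "D (- y) = D y" for y
  proof -
    have "D (- y) = leibniz_det B (\<lambda>b c. b \<bullet> R y c)"
      unfolding D_def leibniz_det_def
    proof (intro sum.cong refl arg_cong2[where f = "(*)"] prod.cong)
      fix p b assume "p \<in> {p. p permutes B}" "b \<in> B"
      then have "p b \<in> B" "b \<in> B" using permutes_in_image[of p B b] by auto
      then have "p b \<in> V" "b \<in> V" using BV by auto
      then show "p b \<bullet> R (- y) b = b \<bullet> R y (p b)" using R_adjoint[of "p b" b y] by (simp add: inner_commute)
    qed
    also have "\<dots> = D y" unfolding D_def by (rule leibniz_det_transpose[OF fin])
    finally show ?thesis .
  qed
  have D0: "D 0 = 1"
  proof -
    have "D 0 = leibniz_det B (\<lambda>b c. if b = c then 1 else 0)"
      unfolding D_def leibniz_det_def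
    proof (intro sum.cong refl arg_cong2[where f = "(*)"] prod.cong)
      fix p b assume "p \<in> {p. p permutes B}" "b \<in> B"
      then have "p b \<in> B" using permutes_in_image[of p B b] by auto
      then show "p b \<bullet> R 0 b = (if b = p b then 1 else 0)"
        using \<open>b \<in> B\<close> orth norm1[of b] BV R_0 by (auto simp: pairwise_def orthogonal_def dot_square_norm)
    qed
    then show ?thesis using leibniz_det_identity[OF fin] by simp
  qed
  have "D x = D ((1/2) *\<^sub>R x) * D ((1/2) *\<^sub>R x)"
    using Dplus[of "(1/2) *\<^sub>R x" "(1/2) *\<^sub>R x"] by (simp flip: scaleR_add_left)
  also have "\<dots> = D ((1/2) *\<^sub>R x) * D (- ((1/2) *\<^sub>R x))" by (simp only: Dneg)
  also have "\<dots> = D 0" using Dplus[of "- ((1/2) *\<^sub>R x)" "(1/2) *\<^sub>R x"] by simp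
  finally have "D x = 1" using D0 by simp
  moreover have "det_on U (restrict (R x) U) = D x"
    unfolding det_on_def Let_def B_def[symmetric] D_def leibniz_det_def
    using BU by (intro sum.cong refl arg_cong2[where f = "(*)"] prod.cong) auto
  ultimately show ?thesis by simp
qed

end

section \<open>Weights of a faithful torus representation\<close>

lemma carrier_circle_group [simp]: "carrier circle_group = sphere 0 1"
  and mult_circle_group [simp]: "monoid.mult circle_group = (*)"
  and one_circle_group [simp]: "one circle_group = 1"
  by (simp_all add: circle_group_def)

lemma comm_group_circle: "comm_group circle_group"
proof (rule comm_groupI)
  show "\<exists>y\<in>carrier circle_group. y \<otimes>\<^bsub>circle_group\<^esub> x = \<one>\<^bsub>circle_group\<^esub>" if "x \<in> carrier circle_group" for x
    using that by (intro bexI[of _ "inverse x"]) (auto simp: norm_inverse intro!: left_inverse)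
qed (auto simp: norm_mult)

lemma carrier_torus: "carrier (torus n) = (\<Pi>\<^sub>E i\<in>{..<n}. sphere 0 1)"
  by (simp add: torus_def)

lemma mult_torus: "x \<otimes>\<^bsub>torus n\<^esub> y = (\<lambda>i\<in>{..<n}. x i * y i)"
  by (simp add: torus_def)

lemma one_torus: "\<one>\<^bsub>torus n\<^esub> = (\<lambda>i\<in>{..<n}. 1)"
  by (simp add: torus_def)

lemma comm_group_torus: "comm_group (torus n)"
proof (rule group.group_comm_groupI)
  show "group (torus n)" unfolding torus_def
    using comm_group_circle by (intro product_group) (simp add: comm_group_def)
qed (auto simp: mult_torus mult.commute)

lemma topspace_torus_top: "topspace (torus_top n) = carrier (torus n)"
  by (simp add: torus_top_def carrier_torus)

definition torus_exp :: "nat \<Rightarrow> (nat \<Rightarrow> 'v::euclidean_space) \<Rightarrow> 'v \<Rightarrow> nat \<Rightarrow> complex" where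
  "torus_exp n e x = (\<lambda>i\<in>{..<n}. cis (2 * pi * (e i \<bullet> x)))"

lemma torus_exp_in: "torus_exp n e x \<in> carrier (torus n)"
  by (simp add: torus_exp_def carrier_torus)

lemma torus_exp_add: "torus_exp n e (x + y) = torus_exp n e x \<otimes>\<^bsub>torus n\<^esub> torus_exp n e y"
  by (auto simp: torus_exp_def mult_torus cis_mult inner_add_right distrib_left)

lemma cis_eq_1_iff: "cis (2 * pi * r) = 1 \<longleftrightarrow> r \<in> \<int>"
proof
  assume "cis (2 * pi * r) = 1"
  then have "cos (2 * pi * r) = 1" by (metis cis.sel(1) one_complex.sel(1))
  then obtain k :: int where "2 * pi * r = of_int k * 2 * pi" by (auto simp: cos_one_2pi_int)
  then have "r = of_int k" by simp
  then show "r \<in> \<int>" by simp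
next
  assume "r \<in> \<int>"
  then show "cis (2 * pi * r) = 1" by (simp add: complex_eq_iff cos_integer_2pi sin_integer_2pi)
qed

lemma torus_exp_eq_one_iff: "torus_exp n e x = \<one>\<^bsub>torus n\<^esub> \<longleftrightarrow> (\<forall>i<n. e i \<bullet> x \<in> \<int>)"
  by (auto simp: torus_exp_def one_torus fun_eq_iff cis_eq_1_iff restrict_def)

lemma continuous_map_torus_exp: "continuous_map euclidean (torus_top n) (torus_exp n e)"
  unfolding torus_top_def
proof (rule continuous_map_coordinatewise_then_product)
  show "continuous_map euclidean circle_top (\<lambda>x. torus_exp n e x i)" if "i \<in> {..<n}" for i
    using that by (auto simp: torus_exp_def continuous_map_in_subtopology image_subset_iff intro!: continuous_intros)
qed (simp add: torus_exp_def)

lemma real_multiples_integral_imp_zero: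
  assumes "\<And>r. r * c \<in> \<int>"
  shows "c = (0::real)"
proof (rule ccontr)
  assume "c \<noteq> 0"
  then have "(1/2::real) \<in> \<int>" using assms[of "1 / (2 * c)"] by simp
  then show False using half_not_Ints by contradiction
qed

text \<open>
  The Lie algebra of the torus is spanned by orthogonal vectors \<open>e i\<close> of the space \<open>'v\<close> itself. Some
  of them may be zero, which restricts the representation to a coordinate subtorus; this case is needed
  to show that \<open>'v\<close> has room for \<open>n\<close> orthonormal vectors.
\<close>

locale torus_rep =
  fixes n :: nat and V :: "'v::euclidean_space set" and \<rho> :: "(nat \<Rightarrow> complex) \<Rightarrow> 'v \<Rightarrow> 'v" and e :: "nat \<Rightarrow> 'v"
  assumes V: "subspace V"
    and rep: "SO_representation (torus n) (torus_top n) V \<rho>"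
    and faith: "faithful (torus n) \<rho>"
    and e_orth: "\<And>i j. i < n \<Longrightarrow> j < n \<Longrightarrow> i \<noteq> j \<Longrightarrow> e i \<bullet> e j = 0"
    and e_norm: "\<And>i. i < n \<Longrightarrow> e i \<bullet> e i = 0 \<or> e i \<bullet> e i = 1"
begin

definition R :: "'v \<Rightarrow> 'v \<Rightarrow> 'v" where "R x = \<rho> (torus_exp n e x)"

lemma rho_SO: "t \<in> carrier (torus n) \<Longrightarrow> \<rho> t \<in> SO_carrier V"
  using rep unfolding SO_representation_def hom_def SO_group_def by auto

lemma rho_mult:
  assumes "s \<in> carrier (torus n)" "t \<in> carrier (torus n)" "v \<in> V"
  shows "\<rho> (s \<otimes>\<^bsub>torus n\<^esub> t) v = \<rho> s (\<rho> t v)"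
proof -
  have "\<rho> s \<in> Bij V" "\<rho> t \<in> Bij V" using rho_SO assms unfolding SO_carrier_def by auto
  moreover have "\<rho> (s \<otimes>\<^bsub>torus n\<^esub> t) = \<rho> s \<otimes>\<^bsub>SO_group V\<^esub> \<rho> t"
    using rep assms unfolding SO_representation_def hom_def by auto
  ultimately show ?thesis using assms(3) by (simp add: SO_group_def BijGroup_def compose_def)
qed

lemma rho_one: "v \<in> V \<Longrightarrow> \<rho> \<one>\<^bsub>torus n\<^esub> v = v"
proof -
  assume v: "v \<in> V"
  interpret T: comm_group "torus n" by (rule comm_group_torus)
  have "\<rho> \<one>\<^bsub>torus n\<^esub> \<in> Bij V" using rho_SO T.one_closed unfolding SO_carrier_def by auto
  then have inj: "inj_on (\<rho> \<one>\<^bsub>torus n\<^esub>) V" and maps: "\<rho> \<one>\<^bsub>torus n\<^esub> v \<in> V"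
    using v by (auto simp: Bij_def bij_betw_def)
  have "\<rho> \<one>\<^bsub>torus n\<^esub> (\<rho> \<one>\<^bsub>torus n\<^esub> v) = \<rho> \<one>\<^bsub>torus n\<^esub> v"
    using rho_mult[OF T.one_closed T.one_closed v] by simp
  then show ?thesis using inj maps v by (meson inj_onD)
qed

sublocale vector_group_rep V R
proof
  show "subspace V" by (rule V)
  have SO: "R x \<in> SO_carrier V" for x unfolding R_def by (rule rho_SO[OF torus_exp_in])
  fix x y :: 'v and u v :: 'v and c :: real
  show "R x v \<in> V" if "v \<in> V" using SO[of x] that by (auto simp: SO_carrier_def Bij_def bij_betw_def)
  show "R x (u + v) = R x u + R x v" if "u \<in> V" "v \<in> V" using SO[of x] that by (auto simp: SO_carrier_def)
  show "R x (c *\<^sub>R v) = c *\<^sub>R R x v" if "v \<in> V" using SO[of x] that by (auto simp: SO_carrier_def)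
  show "R x u \<bullet> R x v = u \<bullet> v" if "u \<in> V" "v \<in> V" using SO[of x] that by (auto simp: SO_carrier_def)
  show "R 0 v = v" if "v \<in> V" using rho_one[OF that] torus_exp_eq_one_iff[of n e 0] by (simp add: R_def)
  show "R (x + y) v = R x (R y v)" if "v \<in> V"
    unfolding R_def torus_exp_add by (rule rho_mult[OF torus_exp_in torus_exp_in that])
  show "continuous_on UNIV (\<lambda>x. R x v)" if "v \<in> V"
  proof -
    have "continuous_map (torus_top n) (product_topology (\<lambda>_. euclidean) V) \<rho>"
      using rep unfolding SO_representation_def SO_top_def continuous_map_in_subtopology by blast
    then have "continuous_map (torus_top n) euclidean (\<lambda>t. \<rho> t v)"
      using that by (simp add: continuous_map_componentwise)
    from continuous_map_compose[OF continuous_map_torus_exp this] show ?thesis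
      by (simp add: o_def R_def)
  qed
qed

lemma R_identity_iff: "(\<forall>v\<in>V. R x v = v) \<longleftrightarrow> (\<forall>i<n. e i \<bullet> x \<in> \<int>)"
proof
  assume *: "\<forall>v\<in>V. R x v = v"
  interpret T: comm_group "torus n" by (rule comm_group_torus)
  have "\<rho> (torus_exp n e x) = \<rho> \<one>\<^bsub>torus n\<^esub>"
  proof (rule extensionalityI)
    show "\<rho> (torus_exp n e x) \<in> extensional V" "\<rho> \<one>\<^bsub>torus n\<^esub> \<in> extensional V"
      using rho_SO[OF torus_exp_in] rho_SO[OF T.one_closed] by (auto simp: SO_carrier_def Bij_def)
    show "\<rho> (torus_exp n e x) v = \<rho> \<one>\<^bsub>torus n\<^esub> v" if "v \<in> V" for v
      using * that rho_one[OF that] unfolding R_def by simp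
  qed
  then have "torus_exp n e x = \<one>\<^bsub>torus n\<^esub>"
    using faith torus_exp_in T.one_closed unfolding faithful_def inj_on_def by blast
  then show "\<forall>i<n. e i \<bullet> x \<in> \<int>" by (simp add: torus_exp_eq_one_iff)
next
  assume "\<forall>i<n. e i \<bullet> x \<in> \<int>"
  then show "\<forall>v\<in>V. R x v = v" using torus_exp_eq_one_iff[of n e x] rho_one unfolding R_def by auto
qed

lemma weight_integral:
  assumes "a \<in> weights" "\<And>i. i < n \<Longrightarrow> e i \<bullet> x \<in> \<int>"
  shows "a \<bullet> x \<in> \<int>"
proof -
  have "R x (weight_vector a) = weight_vector a"
    using R_identity_iff[of x] assms(2) weight_vector(1)[OF assms(1)] wspace_subset by blast
  then show ?thesis by (rule wspace_fixed_imp[OF weight_vector[OF assms(1)]])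
qed

lemma weight_in_span:
  assumes "a \<in> weights"
  shows "a \<in> span (e ` {..<n})"
proof -
  obtain p q where pq: "p \<in> span (e ` {..<n})" "\<And>w. w \<in> span (e ` {..<n}) \<Longrightarrow> orthogonal q w" "a = p + q"
    using orthogonal_subspace_decomp_exists[of "e ` {..<n}" a] by metis
  have eq: "e i \<bullet> q = 0" if "i < n" for i
    using pq(2)[OF span_base, of "e i"] that by (auto simp: orthogonal_def inner_commute)
  have "r * (a \<bullet> q) \<in> \<int>" for r using weight_integral[OF assms, of "r *\<^sub>R q"] eq by simp
  then have "a \<bullet> q = 0" by (rule real_multiples_integral_imp_zero)
  moreover have "p \<bullet> q = 0" using pq(1,2) by (simp add: orthogonal_def inner_commute)
  ultimately have "q = 0" using pq(3) by (simp add: inner_add_left)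
  then show ?thesis using pq by simp
qed

text \<open>
  A direction orthogonal to all weights is a one-parameter group that acts trivially, which is
  impossible in a faithful representation.
\<close>

lemma span_weights: "span weights = span (e ` {..<n})"
proof (rule ccontr)
  assume "span weights \<noteq> span (e ` {..<n})"
  moreover have "span weights \<subseteq> span (e ` {..<n})"
    by (rule span_minimal) (auto intro: weight_in_span)
  ultimately obtain x where x: "x \<noteq> 0" "x \<in> span (e ` {..<n})" "\<And>y. y \<in> span weights \<Longrightarrow> orthogonal x y"
    using orthogonal_to_subspace_exists_gen[of weights "e ` {..<n}"] by blast
  have ax: "a \<bullet> x = 0" if "a \<in> weights" for a
    using x(3)[OF span_base[OF that]] by (simp add: orthogonal_def inner_commute)
  have "e i \<bullet> x = 0" if "i < n" for i
  proof (rule real_multiples_integral_imp_zero)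
    fix r
    have "R (r *\<^sub>R x) v = v" if "v \<in> V" for v
      using R_trivial_if_weights_integral[of "r *\<^sub>R x" v] ax that by simp
    then have "e i \<bullet> (r *\<^sub>R x) \<in> \<int>" using R_identity_iff[of "r *\<^sub>R x"] \<open>i < n\<close> by blast
    then show "r * (e i \<bullet> x) \<in> \<int>" by simp
  qed
  moreover have "y \<bullet> x = 0" if "y \<in> span (e ` {..<n})" for y
    using that by (induction rule: span_induct_alt) (use calculation in \<open>auto simp: inner_add_left\<close>)
  ultimately have "x \<bullet> x = 0" using x(2) by blast
  then show False using x(1) by simp
qed

end

text \<open>
  If the rank were larger than the dimension \<open>m\<close> of \<open>'v\<close>, a coordinate subtorus of rank \<open>m\<close> would have
  \<open>m\<close> independent weights.
\<close>

lemma torus_rank_le_DIM: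
  fixes V :: "'v::euclidean_space set"
  assumes "subspace V" "SO_representation (torus n) (torus_top n) V \<rho>" "faithful (torus n) \<rho>"
  shows "n \<le> DIM('v)"
proof (rule ccontr)
  assume n: "\<not> n \<le> DIM('v)"
  obtain h where h: "bij_betw h {0..<DIM('v)} (Basis::'v set)" using ex_bij_betw_nat_finite[OF finite_Basis] by blast
  define e where "e i = (if i < DIM('v) then h i else 0)" for i
  have hB: "h i \<in> Basis" if "i < DIM('v)" for i using h that by (auto simp: bij_betw_def)
  interpret torus_rep n V \<rho> e
  proof
    show "e i \<bullet> e j = 0" if "i \<noteq> j" for i j
    proof (cases "i < DIM('v) \<and> j < DIM('v)")
      case True
      then have "h i \<noteq> h j" using h that by (auto simp: bij_betw_def inj_on_def)
      then show ?thesis using True hB by (simp add: e_def inner_Basis)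
    qed (auto simp: e_def)
    show "e i \<bullet> e i = 0 \<or> e i \<bullet> e i = 1" for i using hB[of i] by (auto simp: e_def inner_Basis)
  qed (use assms in auto)
  have "Basis \<subseteq> e ` {..<n}"
  proof
    fix b :: 'v assume "b \<in> Basis"
    then have "b \<in> h ` {0..<DIM('v)}" using h by (simp add: bij_betw_def)
    then obtain i where "i < DIM('v)" "b = h i" by auto
    then show "b \<in> e ` {..<n}" using n by (intro image_eqI[of _ _ i]) (auto simp: e_def)
  qed
  then have "span (e ` {..<n}) = UNIV" using span_mono[of Basis] span_Basis by blast
  then have sp: "span weights = UNIV" using span_weights by simp
  obtain B where B: "B \<subseteq> weights" "independent B" "weights \<subseteq> span B" "card B = dim weights" by (rule basis_exists)
  have "dim weights = DIM('v)" using sp dim_span[of weights] by simp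
  then have cB: "card B = DIM('v)" using B by simp
  then have "B \<noteq> {}" by force
  from card_independent_weights_less[OF B(1,2) this] show False using cB by simp
qed

section \<open>The subgroup cut out by independent weights\<close>

lemma continuous_map_compose_continuous_on:
  assumes "continuous_map X (top_of_set S) g" "continuous_on S f"
  shows "continuous_map X euclidean (\<lambda>x. f (g x))"
  using continuous_map_compose[OF assms(1), of euclidean f] assms(2)
  by (simp add: o_def)

lemma continuous_map_compose_continuous:
  assumes "continuous_map X euclidean g" "continuous_on UNIV f"
  shows "continuous_map X euclidean (\<lambda>x. f (g x))"
  using continuous_map_compose_continuous_on[of X UNIV g f] assms by simp

lemma openin_finite_Collect:
  assumes "finite I" "\<And>i. i \<in> I \<Longrightarrow> openin X {x \<in> topspace X. P i x}"
  shows "openin X {x \<in> topspace X. \<forall>i\<in>I. P i x}"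
  using assms
proof (induction I rule: finite_induct)
  case (insert i I)
  then have "openin X ({x \<in> topspace X. P i x} \<inter> {x \<in> topspace X. \<forall>i\<in>I. P i x})"
    by (intro openin_Int) auto
  moreover have "{x \<in> topspace X. P i x} \<inter> {x \<in> topspace X. \<forall>i\<in>I. P i x} = {x \<in> topspace X. \<forall>i\<in>insert i I. P i x}"
    by auto
  ultimately show ?case by simp
qed simp

lemma closedin_Collect_ball:
  assumes "\<And>i. i \<in> I \<Longrightarrow> closedin X {x \<in> topspace X. P i x}"
  shows "closedin X {x \<in> topspace X. \<forall>i\<in>I. P i x}"
proof -
  have "{x \<in> topspace X. \<forall>i\<in>I. P i x} = \<Inter> (insert (topspace X) ((\<lambda>i. {x \<in> topspace X. P i x}) ` I))" by auto
  moreover have "closedin X \<dots>" by (rule closedin_Inter) (use assms in auto)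
  ultimately show ?thesis by simp
qed

lemma prod_cis: "(\<Prod>i\<in>I. cis (f i)) = cis (\<Sum>i\<in>I. f i)"
  by (induction I rule: infinite_finite_induct) (simp_all add: cis_mult)

lemma unit_eq_cis_Arg: "norm z = 1 \<Longrightarrow> z = cis (Arg z)"
  by (metis cis_Arg div_by_1 norm_zero of_real_1 sgn_div_norm scaleR_one inverse_1 zero_neq_one)

locale torus_split = torus_rep n V \<rho> e for n and V :: "'v::euclidean_space set" and \<rho> e +
  fixes F :: "'v set"
  assumes e_one: "\<And>i. i < n \<Longrightarrow> e i \<bullet> e i = 1"
    and F_weights: "F \<subseteq> weights"
    and F_indep: "independent F"
    and F_closed: "\<And>a. a \<in> weights \<Longrightarrow> a \<in> int_span F \<Longrightarrow> a \<in> F \<or> - a \<in> F"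
begin

abbreviation "T \<equiv> torus n"
abbreviation "TT \<equiv> torus_top n"

sublocale T: comm_group T by (rule comm_group_torus)

lemma finite_F: "finite F"
  using F_indep by (rule independent_imp_finite)

lemma e_inner: "i < n \<Longrightarrow> j < n \<Longrightarrow> e i \<bullet> e j = (if i = j then 1 else 0)"
  using e_one e_orth by simp

lemma e_coords:
  assumes "a \<in> span (e ` {..<n})"
  shows "a = (\<Sum>i<n. (a \<bullet> e i) *\<^sub>R e i)"
  using assms
proof (induction rule: span_induct_alt)
  case (step c b y)
  then obtain j where j: "j < n" "b = e j" by auto
  have "(\<Sum>i<n. (b \<bullet> e i) *\<^sub>R e i) = (\<Sum>i<n. if i = j then e j else 0)"
    unfolding j(2) by (rule sum.cong) (auto simp: e_inner j(1))
  then have "(\<Sum>i<n. (b \<bullet> e i) *\<^sub>R e i) = b" using j by simp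
  moreover have "(\<Sum>i<n. ((c *\<^sub>R b + y) \<bullet> e i) *\<^sub>R e i) = c *\<^sub>R (\<Sum>i<n. (b \<bullet> e i) *\<^sub>R e i) + (\<Sum>i<n. (y \<bullet> e i) *\<^sub>R e i)"
    by (simp add: inner_add_left scaleR_add_left sum.distrib scaleR_sum_right)
  ultimately show ?case using step(2) by simp
qed simp

lemma e_coord_sum: "j < n \<Longrightarrow> e j \<bullet> (\<Sum>i<n. c i *\<^sub>R e i) = c j"
proof -
  assume j: "j < n"
  have "e j \<bullet> (\<Sum>i<n. c i *\<^sub>R e i) = (\<Sum>i<n. if i = j then c j else 0)"
    unfolding inner_sum_right by (rule sum.cong) (auto simp: e_inner j)
  then show ?thesis using j by simp
qed

definition torus_log :: "(nat \<Rightarrow> complex) \<Rightarrow> 'v" where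
  "torus_log t = (\<Sum>i<n. (Arg (t i) / (2 * pi)) *\<^sub>R e i)"

lemma torus_exp_torus_log:
  assumes "t \<in> carrier T"
  shows "torus_exp n e (torus_log t) = t"
proof
  fix i
  show "torus_exp n e (torus_log t) i = t i"
  proof (cases "i < n")
    case True
    then have "norm (t i) = 1" using assms by (auto simp: carrier_torus PiE_iff)
    then have "t i = cis (Arg (t i))" by (rule unit_eq_cis_Arg)
    then show ?thesis using True by (simp add: torus_exp_def torus_log_def e_coord_sum)
  next
    case False
    then show ?thesis using assms by (auto simp: torus_exp_def carrier_torus PiE_iff extensional_def)
  qed
qed

lemma carrier_T_eq: "carrier T = range (torus_exp n e)"
  using torus_exp_torus_log torus_exp_in by (metis image_subset_iff rangeI subsetI subset_antisym)

text \<open>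
  The character of the torus with weight \<open>a\<close>. The floor converts an integral coordinate of \<open>a\<close> to
  an integer exponent.
\<close>

definition character :: "'v \<Rightarrow> (nat \<Rightarrow> complex) \<Rightarrow> complex" where
  "character a t = (\<Prod>i<n. t i powi \<lfloor>a \<bullet> e i\<rfloor>)"

lemma character_torus_exp:
  assumes "a \<in> weights"
  shows "character a (torus_exp n e x) = cis (2 * pi * (a \<bullet> x))"
proof -
  have k: "real_of_int \<lfloor>a \<bullet> e i\<rfloor> = a \<bullet> e i" if "i < n" for i
    using weight_integral[OF assms, of "e i"] e_inner that by simp
  have "character a (torus_exp n e x) = (\<Prod>i<n. cis ((a \<bullet> e i) * (2 * pi * (e i \<bullet> x))))"
    unfolding character_def by (intro prod.cong refl) (simp add: torus_exp_def cis_power_int k)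
  also have "\<dots> = cis (\<Sum>i<n. (a \<bullet> e i) * (2 * pi * (e i \<bullet> x)))" by (rule prod_cis)
  also have "(\<Sum>i<n. (a \<bullet> e i) * (2 * pi * (e i \<bullet> x))) = 2 * pi * ((\<Sum>i<n. (a \<bullet> e i) *\<^sub>R e i) \<bullet> x)"
    by (simp add: inner_sum_left sum_distrib_left mult_ac)
  also have "(\<Sum>i<n. (a \<bullet> e i) *\<^sub>R e i) = a" using e_coords[OF weight_in_span[OF assms]] by simp
  finally show ?thesis .
qed

lemma continuous_map_coord: "i < n \<Longrightarrow> continuous_map TT euclidean (\<lambda>t. t i)"
  unfolding torus_top_def
  using continuous_map_product_projection[of i "{..<n}" "\<lambda>_. circle_top"]
  by (simp add: continuous_map_in_subtopology)

lemma topspace_coord: "t \<in> topspace TT \<Longrightarrow> i < n \<Longrightarrow> norm (t i) = 1"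
  by (auto simp: topspace_torus_top carrier_torus PiE_iff)

lemma continuous_map_character:
  assumes "a \<in> weights"
  shows "continuous_map TT circle_top (character a)"
  unfolding continuous_map_in_subtopology
proof
  show "continuous_map TT euclidean (character a)"
    unfolding continuous_map_atin limitin_canonical_iff character_def
  proof (intro ballI tendsto_prod tendsto_power_int)
    fix t i assume t: "t \<in> topspace TT" "i \<in> {..<n}"
    then show "((\<lambda>t. t i) \<longlongrightarrow> t i) (atin TT t)"
      using continuous_map_coord[of i] unfolding continuous_map_atin by simp
    show "t i \<noteq> 0" using topspace_coord[OF t(1)] t(2) by force
  qed
  show "character a \<in> topspace TT \<rightarrow> sphere 0 1"
    using character_torus_exp[OF assms] by (auto simp: topspace_torus_top carrier_T_eq)
qed

definition H :: "(nat \<Rightarrow> complex) set" where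
  "H = {t \<in> carrier T. \<forall>f\<in>F. character f t = 1}"

lemma torus_exp_in_H: "torus_exp n e x \<in> H \<longleftrightarrow> (\<forall>f\<in>F. f \<bullet> x \<in> \<int>)"
  unfolding H_def using torus_exp_in[of n e x] character_torus_exp F_weights by (auto simp: cis_eq_1_iff subset_iff)

lemma torus_exp_minus: "torus_exp n e (- x) = inv\<^bsub>T\<^esub> torus_exp n e x"
proof (rule T.inv_equality[symmetric])
  show "torus_exp n e (- x) \<otimes>\<^bsub>T\<^esub> torus_exp n e x = \<one>\<^bsub>T\<^esub>"
    using torus_exp_eq_one_iff[of n e 0] by (simp flip: torus_exp_add)
qed (simp_all add: torus_exp_in)

lemma H_subset: "H \<subseteq> carrier T"
  unfolding H_def by blast

lemma subgroup_H: "subgroup H T"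
proof (rule T.subgroupI)
  show "H \<subseteq> carrier T" by (rule H_subset)
  show "H \<noteq> {}" using torus_exp_in_H[of 0] by auto
  show "inv\<^bsub>T\<^esub> s \<in> H" if s: "s \<in> H" for s
  proof -
    obtain x where x: "s = torus_exp n e x" using s H_subset carrier_T_eq by blast
    show ?thesis using s unfolding x torus_exp_minus[symmetric] torus_exp_in_H by auto
  qed
  show "s \<otimes>\<^bsub>T\<^esub> t \<in> H" if st: "s \<in> H" "t \<in> H" for s t
  proof -
    obtain x y where x: "s = torus_exp n e x" "t = torus_exp n e y" using st H_subset carrier_T_eq by blast
    show ?thesis using st unfolding x torus_exp_add[symmetric] torus_exp_in_H by (auto simp: inner_add_right)
  qed
qed

lemma closedin_character_kernel:
  assumes "G \<subseteq> weights"
  shows "closedin TT {t \<in> carrier T. \<forall>f\<in>G. character f t = 1}"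
proof -
  have "closedin TT {t \<in> topspace TT. character f t \<in> {1}}" if "f \<in> G" for f
    using continuous_map_character[of f] that assms by (intro closedin_continuous_map_preimage[where Y = circle_top]) (auto intro: closed_subset)
  then have "closedin TT {t \<in> topspace TT. \<forall>f\<in>G. character f t = 1}"
    by (intro closedin_Collect_ball) simp
  then show ?thesis by (simp add: topspace_torus_top)
qed

lemma closedin_H: "closedin TT H"
  unfolding H_def by (rule closedin_character_kernel[OF F_weights])

definition lie_H :: "'v set" where
  "lie_H = {x \<in> span (e ` {..<n}). \<forall>f\<in>F. f \<bullet> x = 0}"

lemma subspace_lie_H: "subspace lie_H"
  unfolding lie_H_def by (auto simp: subspace_def inner_add_right span_add span_scale span_zero)

lemma dim_E: "dim (span (e ` {..<n})) = n"
proof -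
  have inj: "inj_on e {..<n}"
    using e_inner by (auto simp: inj_on_def) (metis one_neq_zero)
  have "pairwise orthogonal (e ` {..<n})" using e_inner by (auto simp: pairwise_def orthogonal_def)
  moreover have "0 \<notin> e ` {..<n}" using e_one by force
  ultimately have "independent (e ` {..<n})" by (rule pairwise_orthogonal_independent)
  then show ?thesis using inj by (simp add: dim_eq_card_independent card_image)
qed

lemma dim_lie_H: "dim lie_H + card F = n"
proof -
  have "span F \<subseteq> span (e ` {..<n})" by (rule span_minimal) (use F_weights weight_in_span in auto)
  then have "dim {y \<in> span (e ` {..<n}). \<forall>x \<in> span F. orthogonal x y} + dim (span F) = n"
    using dim_subspace_orthogonal_to_vectors[of "span F" "span (e ` {..<n})"] dim_E by simp
  moreover have "{y \<in> span (e ` {..<n}). \<forall>x \<in> span F. orthogonal x y} = lie_H"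
  proof -
    have "x \<bullet> y = 0" if "x \<in> span F" "\<forall>f\<in>F. f \<bullet> y = 0" for x y
      using that(1) by (induction rule: span_induct_alt) (use that(2) in \<open>auto simp: inner_add_left\<close>)
    then show ?thesis unfolding lie_H_def orthogonal_def by (auto intro: span_base)
  qed
  ultimately show ?thesis using F_indep by (simp add: dim_eq_card_independent)
qed

text \<open>
  Near a point \<open>h\<close> of \<open>H\<close>, multiplication by \<open>h\<close> composed with the exponential map is a chart defined
  on a neighbourhood of zero in \<open>lie_H\<close>: for a small vector \<open>x\<close>, the integrality of \<open>f \<bullet> x\<close> that
  expresses membership in \<open>H\<close> means \<open>f \<bullet> x = 0\<close>.
\<close>

lemma locally_euclidean_H: "locally_euclidean (dim lie_H) (subtopology TT H)"
  unfolding locally_euclidean_def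
proof
  fix h assume "h \<in> topspace (subtopology TT H)"
  then have hH: "h \<in> H" by simp
  then have hT: "h \<in> carrier T" using H_subset by blast
  have h1: "norm (h i) = 1" if "i < n" for i using topspace_coord[of h i] hT that by (simp add: topspace_torus_top)
  have h0: "h i \<noteq> 0" if "i < n" for i using h1[OF that] by force
  define d where "d = dim lie_H"
  obtain B where B: "B \<subseteq> lie_H" "pairwise orthogonal B" "\<And>x. x \<in> B \<Longrightarrow> norm x = 1" "independent B" "card B = d" "span B = lie_H"
    unfolding d_def using orthonormal_basis_subspace[OF subspace_lie_H] by metis
  have finB: "finite B" using B(4) by (rule independent_imp_finite)
  obtain k where k: "bij_betw k {0..<d} B" using ex_bij_betw_nat_finite[OF finB] B(5) by blast
  have kB: "k j \<in> B" if "j < d" for j using k that by (auto simp: bij_betw_def)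
  have kk: "k i \<bullet> k j = (if i = j then 1 else 0)" if "i < d" "j < d" for i j
  proof (cases "i = j")
    case True
    then show ?thesis using B(3)[OF kB[OF that(1)]] by (simp add: dot_square_norm)
  next
    case False
    then have "k i \<noteq> k j" using k that by (auto simp: bij_betw_def inj_on_def)
    then show ?thesis using False B(2) kB that by (auto simp: pairwise_def orthogonal_def)
  qed
  define A where "A y = (\<Sum>j<d. y j *\<^sub>R k j)" for y :: "nat \<Rightarrow> real"
  define C where "C x = (\<lambda>j. if j < d then x \<bullet> k j else 0)" for x :: 'v
  have AK: "A y \<in> lie_H" for y
    unfolding A_def using kB B(1) by (intro subspace_sum[OF subspace_lie_H] subspace_scale[OF subspace_lie_H]) auto
  have CA: "C (A y) = y" if "y \<in> topspace (Euclidean_space d)" for y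
  proof
    fix j
    show "C (A y) j = y j"
    proof (cases "j < d")
      case True
      have "A y \<bullet> k j = (\<Sum>i<d. if i = j then y j else 0)"
        unfolding A_def inner_sum_left by (rule sum.cong) (auto simp: kk True)
      then show ?thesis using True by (simp add: C_def)
    next
      case False
      then show ?thesis using that by (simp add: C_def topspace_Euclidean_space)
    qed
  qed
  have AC: "A (C x) = x" if "x \<in> lie_H" for x
  proof -
    have "A (C x) = (\<Sum>j\<in>{0..<d}. (x \<bullet> k j) *\<^sub>R k j)" unfolding A_def C_def by (intro sum.cong) auto
    also have "\<dots> = (\<Sum>b\<in>B. (x \<bullet> b) *\<^sub>R b)"
      using sum.reindex_bij_betw[OF k, of "\<lambda>b. (x \<bullet> b) *\<^sub>R b"] .
    also have "\<dots> = x" using orthonormal_basis_expand[OF B(2,3) _ finB] that B(6) by metis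
    finally show ?thesis .
  qed
  \<comment> \<open>\<open>M\<close> bounds all \<open>f \<bullet> x\<close> with coordinates of \<open>x\<close> at most 1. The radius \<open>\<delta>\<close> of the chart makes
  \<open>f \<bullet> x\<close> smaller than 1, and it is at most 1/4 in order that the coordinates of the torus stay in
  a half-plane where the argument is continuous.\<close>
  define M where "M = 1 + (\<Sum>f\<in>F. \<Sum>i<n. \<bar>f \<bullet> e i\<bar>)"
  have M: "M \<ge> 1" unfolding M_def by (simp add: sum_nonneg)
  define \<delta> where "\<delta> = 1 / (4 * M)"
  have \<delta>: "0 < \<delta>" "\<delta> \<le> 1/4" "M * \<delta> < 1" using M unfolding \<delta>_def by (auto simp: field_simps)
  have small: "f \<bullet> x = 0" if f: "f \<in> F" and int: "f \<bullet> x \<in> \<int>" and x: "\<And>i. i < n \<Longrightarrow> \<bar>e i \<bullet> x\<bar> < \<delta>" for f x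
  proof -
    have "f \<bullet> x = (\<Sum>i<n. (f \<bullet> e i) * (e i \<bullet> x))"
      by (subst e_coords[of f]) (use f F_weights weight_in_span in \<open>auto simp: inner_sum_left\<close>)
    then have "\<bar>f \<bullet> x\<bar> \<le> (\<Sum>i<n. \<bar>f \<bullet> e i\<bar> * \<bar>e i \<bullet> x\<bar>)" by (simp add: sum_abs flip: abs_mult)
    also have "\<dots> \<le> (\<Sum>i<n. \<bar>f \<bullet> e i\<bar> * \<delta>)" using x by (intro sum_mono mult_left_mono) (auto intro: less_imp_le)
    also have "\<dots> = (\<Sum>i<n. \<bar>f \<bullet> e i\<bar>) * \<delta>" by (simp add: sum_distrib_right)
    also have "\<dots> \<le> M * \<delta>"
    proof -
      have "(\<Sum>i<n. \<bar>f \<bullet> e i\<bar>) \<le> (\<Sum>f\<in>F. \<Sum>i<n. \<bar>f \<bullet> e i\<bar>)"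
        using f finite_F by (intro member_le_sum) (auto intro: sum_nonneg)
      then show ?thesis using \<delta>(1) unfolding M_def by (intro mult_right_mono) auto
    qed
    finally have "\<bar>f \<bullet> x\<bar> < 1" using \<delta>(3) by simp
    moreover obtain z where "f \<bullet> x = of_int z" using int by (auto elim: Ints_cases)
    ultimately show ?thesis by (simp flip: of_int_abs)
  qed
  have d2: "0 \<le> 2 * pi * \<delta>" "2 * pi * \<delta> \<le> pi / 2"
    using \<delta> mult_left_mono[OF \<delta>(2), of "2 * pi"] by auto
  have cos_gt: "cos (2 * pi * r) > cos (2 * pi * \<delta>)" if "\<bar>r\<bar> < \<delta>" for r
  proof -
    have "2 * pi * \<bar>r\<bar> < 2 * pi * \<delta>" using that by simp
    then have "cos (2 * pi * \<delta>) < cos (2 * pi * \<bar>r\<bar>)" using d2 by (intro cos_monotone_0_pi) auto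
    also have "cos (2 * pi * \<bar>r\<bar>) = cos (2 * pi * r)" by (cases "r \<ge> 0") auto
    finally show ?thesis .
  qed
  have cos_gt_imp: "\<bar>Arg z\<bar> < 2 * pi * \<delta>" if z: "norm z = 1" "Re z > cos (2 * pi * \<delta>)" for z
  proof (rule ccontr)
    assume "\<not> \<bar>Arg z\<bar> < 2 * pi * \<delta>"
    then have "cos \<bar>Arg z\<bar> \<le> cos (2 * pi * \<delta>)"
      using d2 Arg_bounded[of z] by (intro cos_monotone_0_pi_le) auto
    moreover have "cos \<bar>Arg z\<bar> = Re z" using unit_eq_cis_Arg[OF z(1)] by (metis cis.sel(1) cos_abs_real)
    ultimately show False using z(2) by simp
  qed
  have cpos: "cos (2 * pi * \<delta>) \<ge> 0" by (rule cos_ge_zero) (use d2 pi_gt_zero in linarith)+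
  define X where "X = subtopology TT H"
  \<comment> \<open>On the unit circle the condition on the real part bounds the argument.\<close>
  define U where "U = {t \<in> topspace X. \<forall>i\<in>{..<n}. Re (t i / h i) \<in> {cos (2 * pi * \<delta>)<..}}"
  define W where "W = {y \<in> topspace (Euclidean_space d). \<forall>i\<in>{..<n}. e i \<bullet> A y \<in> {- \<delta><..<\<delta>}}"
  have W_abs: "\<bar>e i \<bullet> A y\<bar> < \<delta>" if "y \<in> W" "i < n" for y i
    using that unfolding W_def abs_less_iff by force
  have contX: "continuous_map X euclidean (\<lambda>t. t i / h i)" if "i < n" for i
  proof -
    have "continuous_map X euclidean (\<lambda>t. t i)" unfolding X_def
      by (rule continuous_map_from_subtopology[OF continuous_map_coord[OF that]])
    then show ?thesis
      by (rule continuous_map_compose_continuous) (use h0[OF that] in \<open>auto intro!: continuous_intros\<close>)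
  qed
  have openU: "openin X U" unfolding U_def
  proof (rule openin_finite_Collect)
    fix i assume "i \<in> {..<n}"
    then have "continuous_map X euclidean (\<lambda>t. Re (t i / h i))"
      by (intro continuous_map_compose_continuous[OF contX]) (auto intro: continuous_intros)
    then show "openin X {t \<in> topspace X. Re (t i / h i) \<in> {cos (2 * pi * \<delta>)<..}}"
      by (rule openin_continuous_map_preimage) auto
  qed simp
  have contA: "continuous_map (Euclidean_space d) euclidean (\<lambda>y. e i \<bullet> A y)" for i
  proof -
    have "continuous_map (Euclidean_space d) euclidean (\<lambda>y. y j)" for j
      unfolding Euclidean_space_def
      by (rule continuous_map_from_subtopology, rule continuous_map_product_projection) simp
    then have "continuous_map (Euclidean_space d) euclidean (\<lambda>y. \<Sum>j<d. y j * (e i \<bullet> k j))"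
      by (intro continuous_map_sum continuous_map_real_mult) auto
    then show ?thesis by (simp add: A_def inner_sum_right)
  qed
  have openW: "openin (Euclidean_space d) W" unfolding W_def
  proof (rule openin_finite_Collect)
    show "openin (Euclidean_space d) {y \<in> topspace (Euclidean_space d). e i \<bullet> A y \<in> {- \<delta><..<\<delta>}}" for i
      by (rule openin_continuous_map_preimage[OF contA]) auto
  qed simp
  have topX: "topspace X = H" unfolding X_def using H_subset by (auto simp: topspace_torus_top)
  define \<Phi> where "\<Phi> y = (\<lambda>i\<in>{..<n}. h i * cis (2 * pi * (e i \<bullet> A y)))" for y
  define L where "L t = (\<Sum>i<n. (Arg (t i / h i) / (2 * pi)) *\<^sub>R e i)" for t
  have \<Phi>_eq: "\<Phi> y = h \<otimes>\<^bsub>T\<^esub> torus_exp n e (A y)" for y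
    unfolding \<Phi>_def mult_torus torus_exp_def by (auto simp: restrict_def)
  have \<Phi>U: "\<Phi> y \<in> U" if y: "y \<in> W" for y
  proof -
    have "torus_exp n e (A y) \<in> H" unfolding torus_exp_in_H using AK[of y] by (auto simp: lie_H_def)
    then have "\<Phi> y \<in> H" unfolding \<Phi>_eq using hH subgroup_H by (simp add: subgroup.m_closed)
    moreover have "Re (\<Phi> y i / h i) > cos (2 * pi * \<delta>)" if i: "i < n" for i
    proof -
      have "\<Phi> y i / h i = cis (2 * pi * (e i \<bullet> A y))" using h0[OF i] i by (simp add: \<Phi>_def)
      moreover have "\<bar>e i \<bullet> A y\<bar> < \<delta>" using W_abs[OF y i] .
      ultimately show ?thesis using cos_gt by simp
    qed
    ultimately show ?thesis unfolding U_def topX by auto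
  qed
  have L\<Phi>: "L (\<Phi> y) = A y" if y: "y \<in> W" for y
  proof -
    have "Arg (\<Phi> y i / h i) / (2 * pi) = A y \<bullet> e i" if i: "i < n" for i
    proof -
      have "\<bar>e i \<bullet> A y\<bar> < \<delta>" using W_abs[OF y i] .
      then have "\<bar>2 * pi * (e i \<bullet> A y)\<bar> < 2 * pi * \<delta>" by (simp add: abs_mult)
      then have "- pi < 2 * pi * (e i \<bullet> A y)" "2 * pi * (e i \<bullet> A y) \<le> pi"
        using d2 pi_gt_zero unfolding abs_less_iff by linarith+
      then have "2 * pi * (e i \<bullet> A y) \<in> {- pi<..pi}" by simp
      then have "Arg (cis (2 * pi * (e i \<bullet> A y))) = 2 * pi * (e i \<bullet> A y)" by (rule Arg_cis)
      then show ?thesis using h0[OF i] i by (simp add: \<Phi>_def inner_commute)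
    qed
    then have "L (\<Phi> y) = (\<Sum>i<n. (A y \<bullet> e i) *\<^sub>R e i)" unfolding L_def by (intro sum.cong) auto
    also have "\<dots> = A y" using e_coords[of "A y"] AK[of y] by (simp add: lie_H_def)
    finally show ?thesis .
  qed
  have tU: "L t \<in> lie_H \<and> C (L t) \<in> W \<and> h \<otimes>\<^bsub>T\<^esub> torus_exp n e (L t) = t" if t: "t \<in> U" for t
  proof -
    have tH: "t \<in> H" using t unfolding U_def topX by blast
    then have tT: "t \<in> carrier T" using H_subset by blast
    have t1: "norm (t i) = 1" if "i < n" for i using topspace_coord[of t i] tT that by (simp add: topspace_torus_top)
    have eL: "e i \<bullet> L t = Arg (t i / h i) / (2 * pi)" if "i < n" for i unfolding L_def using that by (rule e_coord_sum)
    have lt: "\<bar>e i \<bullet> L t\<bar> < \<delta>" if i: "i < n" for i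
    proof -
      have "\<bar>Arg (t i / h i)\<bar> < 2 * pi * \<delta>"
        by (rule cos_gt_imp) (use t i t1 h1 in \<open>auto simp: U_def norm_divide\<close>)
      then show ?thesis unfolding eL[OF i] by (simp add: field_simps)
    qed
    have prod: "h \<otimes>\<^bsub>T\<^esub> torus_exp n e (L t) = t"
    proof
      fix i
      show "(h \<otimes>\<^bsub>T\<^esub> torus_exp n e (L t)) i = t i"
      proof (cases "i < n")
        case True
        have "t i / h i = cis (Arg (t i / h i))" using t1 h1 True by (intro unit_eq_cis_Arg) (simp add: norm_divide)
        then show ?thesis using True h0[OF True] by (simp add: mult_torus torus_exp_def eL field_simps)
      next
        case False
        then show ?thesis using tT by (auto simp: mult_torus carrier_torus PiE_iff extensional_def)
      qed
    qed
    have "torus_exp n e (L t) = inv\<^bsub>T\<^esub> h \<otimes>\<^bsub>T\<^esub> t"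
      using prod hT torus_exp_in[of n e "L t"] by (metis T.inv_solve_left tT)
    also have "\<dots> \<in> H" using subgroup_H hH tH by (simp add: subgroup.m_closed subgroup.m_inv_closed)
    finally have "\<forall>f\<in>F. f \<bullet> L t \<in> \<int>" unfolding torus_exp_in_H .
    then have "\<forall>f\<in>F. f \<bullet> L t = 0" using small lt by blast
    moreover have "L t \<in> span (e ` {..<n})" unfolding L_def by (intro span_sum span_scale span_base) auto
    ultimately have LK: "L t \<in> lie_H" unfolding lie_H_def by blast
    moreover have "C (L t) \<in> W"
    proof -
      have "C (L t) \<in> topspace (Euclidean_space d)" by (simp add: topspace_Euclidean_space C_def)
      moreover have "e i \<bullet> A (C (L t)) \<in> {- \<delta><..<\<delta>}" if "i < n" for i
        using lt[OF that] unfolding AC[OF LK] abs_less_iff greaterThanLessThan_iff by linarith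
      ultimately show ?thesis unfolding W_def by blast
    qed
    ultimately show ?thesis using prod by blast
  qed
  have "homeomorphic_maps (subtopology X U) (subtopology (Euclidean_space d) W) (\<lambda>t. C (L t)) \<Phi>"
    unfolding homeomorphic_maps_def
  proof (intro conjI ballI)
    show "continuous_map (subtopology X U) (subtopology (Euclidean_space d) W) (\<lambda>t. C (L t))"
      unfolding continuous_map_in_subtopology
    proof
      show "(\<lambda>t. C (L t)) \<in> topspace (subtopology X U) \<rightarrow> W" using tU by auto
      have "continuous_map (subtopology X U) euclidean (\<lambda>t. C (L t) j)" for j
      proof (cases "j < d")
        case True
        have "continuous_map (subtopology X U) euclidean (\<lambda>t. Arg (t i / h i))" if i: "i < n" for i
        proof (rule continuous_map_compose_continuous_on[where S = "{z. Re z > 0}"])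
          show "continuous_map (subtopology X U) (top_of_set {z. Re z > 0}) (\<lambda>t. t i / h i)"
            unfolding continuous_map_in_subtopology
          proof
            show "continuous_map (subtopology X U) euclidean (\<lambda>t. t i / h i)"
              by (rule continuous_map_from_subtopology[OF contX[OF i]])
            show "(\<lambda>t. t i / h i) \<in> topspace (subtopology X U) \<rightarrow> {z. Re z > 0}"
            proof
              fix t assume "t \<in> topspace (subtopology X U)"
              then have "Re (t i / h i) > cos (2 * pi * \<delta>)" using i by (simp add: U_def)
              then show "t i / h i \<in> {z. Re z > 0}" using cpos by (simp only: mem_Collect_eq)
            qed
          qed
          show "continuous_on {z. Re z > 0} Arg"
            unfolding continuous_on_eq_continuous_within
            by (auto intro!: continuous_within_Arg simp: complex_nonpos_Reals_iff)
        qed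
        then have "continuous_map (subtopology X U) euclidean (\<lambda>t. \<Sum>i<n. (Arg (t i / h i) * (1 / (2 * pi))) * (e i \<bullet> k j))"
          by (intro continuous_map_sum continuous_map_real_mult continuous_map_canonical_const) auto
        then show ?thesis using True by (simp add: C_def L_def inner_sum_left)
      qed (simp add: C_def)
      then show "continuous_map (subtopology X U) (Euclidean_space d) (\<lambda>t. C (L t))"
        unfolding Euclidean_space_def continuous_map_in_subtopology continuous_map_componentwise_UNIV
        by (auto simp: C_def)
    qed
    show "continuous_map (subtopology (Euclidean_space d) W) (subtopology X U) \<Phi>"
      unfolding continuous_map_in_subtopology X_def
    proof (intro conjI)
      show "\<Phi> \<in> topspace (subtopology (Euclidean_space d) W) \<rightarrow> U" using \<Phi>U by auto
      then show "\<Phi> \<in> topspace (subtopology (Euclidean_space d) W) \<rightarrow> H" unfolding U_def topX by auto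
      show "continuous_map (subtopology (Euclidean_space d) W) TT \<Phi>"
        unfolding torus_top_def
      proof (rule continuous_map_coordinatewise_then_product)
        fix i assume i: "i \<in> {..<n}"
        have "continuous_map (subtopology (Euclidean_space d) W) euclidean (\<lambda>y. h i * cis (2 * pi * (e i \<bullet> A y)))"
          by (rule continuous_map_compose_continuous[OF continuous_map_from_subtopology[OF contA]])
            (auto intro!: continuous_intros)
        then have "continuous_map (subtopology (Euclidean_space d) W) euclidean (\<lambda>y. \<Phi> y i)"
          using i by (simp add: \<Phi>_def)
        then show "continuous_map (subtopology (Euclidean_space d) W) circle_top (\<lambda>y. \<Phi> y i)"
          unfolding continuous_map_in_subtopology using i h1 by (auto simp: \<Phi>_def norm_mult)
      qed (simp add: \<Phi>_def)
    qed
    show "\<Phi> (C (L t)) = t" if "t \<in> topspace (subtopology X U)" for t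
      using tU[of t] that AC[of "L t"] by (simp add: \<Phi>_eq)
    show "C (L (\<Phi> y)) = y" if "y \<in> topspace (subtopology (Euclidean_space d) W)" for y
      using that L\<Phi>[of y] CA[of y] by simp
  qed
  then have "subtopology X U homeomorphic_space subtopology (Euclidean_space d) W"
    unfolding homeomorphic_space_def by blast
  moreover have "h \<in> U"
  proof -
    have "cos (2 * pi * \<delta>) < 1" using cos_gt[of 0] \<delta>(1) by simp
    then show ?thesis unfolding U_def topX using hH h0 by auto
  qed
  ultimately show "\<exists>U W. openin (subtopology TT H) U \<and> h \<in> U \<and> openin (Euclidean_space (dim lie_H)) W \<and>
      subtopology (subtopology TT H) U homeomorphic_space subtopology (Euclidean_space (dim lie_H)) W"
    using openU openW unfolding X_def d_def by blast
qed

end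

section \<open>The quotient representation\<close>

context torus_split begin

abbreviation "Q \<equiv> T Mod H"
abbreviation "QT \<equiv> quotient_group_top T TT H"
abbreviation "VH \<equiv> common_fixed F"

text \<open>
  The exponential map of the quotient group.
\<close>

definition qexp :: "'v \<Rightarrow> (nat \<Rightarrow> complex) set" where
  "qexp x = H #>\<^bsub>T\<^esub> torus_exp n e x"

lemma normal_H: "H \<lhd> T"
  by (rule T.subgroup_imp_normal[OF subgroup_H])

sublocale Q: group Q
  by (rule normal.factorgroup_is_group[OF normal_H])

lemma carrier_Q: "carrier Q = range qexp"
  unfolding carrier_FactGroup carrier_T_eq qexp_def by auto

lemma qexp_in: "qexp x \<in> carrier Q"
  unfolding carrier_Q by simp

lemma qexp_add: "qexp (x + y) = qexp x \<otimes>\<^bsub>Q\<^esub> qexp y"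
  unfolding qexp_def mult_FactGroup torus_exp_add
  by (rule normal.rcos_sum[OF normal_H, symmetric]) (rule torus_exp_in)+

lemma qexp_zero: "qexp 0 = \<one>\<^bsub>Q\<^esub>"
  using qexp_add[of 0 0] qexp_in[of 0] by (metis Q.l_cancel_one' add_0)

lemma qexp_uminus: "qexp (- x) = inv\<^bsub>Q\<^esub> qexp x"
proof (rule Q.inv_equality[symmetric])
  show "qexp (- x) \<otimes>\<^bsub>Q\<^esub> qexp x = \<one>\<^bsub>Q\<^esub>" unfolding qexp_add[symmetric] qexp_zero[symmetric] by simp
qed (rule qexp_in)+

lemma mem_qexp_iff: "t \<in> qexp x \<longleftrightarrow> (\<exists>y. t = torus_exp n e (y + x) \<and> (\<forall>f\<in>F. f \<bullet> y \<in> \<int>))"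
proof
  assume "t \<in> qexp x"
  then obtain h where h: "h \<in> H" "t = h \<otimes>\<^bsub>T\<^esub> torus_exp n e x" unfolding qexp_def r_coset_def by auto
  then obtain y where "h = torus_exp n e y" using H_subset carrier_T_eq by blast
  then show "\<exists>y. t = torus_exp n e (y + x) \<and> (\<forall>f\<in>F. f \<bullet> y \<in> \<int>)"
    using h torus_exp_in_H[of y] by (intro exI[of _ y]) (simp add: torus_exp_add)
next
  assume "\<exists>y. t = torus_exp n e (y + x) \<and> (\<forall>f\<in>F. f \<bullet> y \<in> \<int>)"
  then obtain y where y: "t = torus_exp n e (y + x)" "torus_exp n e y \<in> H" using torus_exp_in_H by blast
  then show "t \<in> qexp x" unfolding qexp_def torus_exp_add by (auto intro: T.rcosI[OF _ H_subset torus_exp_in])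
qed

lemma qexp_eq_iff: "qexp x = qexp y \<longleftrightarrow> (\<forall>f\<in>F. f \<bullet> x - f \<bullet> y \<in> \<int>)"
proof
  assume "qexp x = qexp y"
  then have "torus_exp n e x \<in> qexp y" using mem_qexp_iff[of "torus_exp n e x" x] by (metis Ints_0 add_0 inner_zero_right)
  then obtain z where z: "torus_exp n e x = torus_exp n e (z + y)" "\<forall>f\<in>F. f \<bullet> z \<in> \<int>" unfolding mem_qexp_iff by blast
  have "f \<bullet> x - f \<bullet> y \<in> \<int>" if f: "f \<in> F" for f
  proof -
    have "cis (2 * pi * (f \<bullet> x)) = cis (2 * pi * (f \<bullet> (z + y)))"
      using arg_cong[OF z(1), of "character f"] character_torus_exp f F_weights by (simp add: subset_iff)
    then have "cis (2 * pi * (f \<bullet> x - f \<bullet> (z + y))) = 1"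
      by (simp add: right_diff_distrib flip: cis_divide)
    then have "f \<bullet> x - f \<bullet> (z + y) \<in> \<int>" by (simp add: cis_eq_1_iff)
    then have "(f \<bullet> x - f \<bullet> (z + y)) + f \<bullet> z \<in> \<int>" using z(2) f by (blast intro: Ints_add)
    then show ?thesis by (simp add: inner_add_right)
  qed
  then show "\<forall>f\<in>F. f \<bullet> x - f \<bullet> y \<in> \<int>" by blast
next
  assume "\<forall>f\<in>F. f \<bullet> x - f \<bullet> y \<in> \<int>"
  then have "torus_exp n e x \<in> qexp y" unfolding mem_qexp_iff by (intro exI[of _ "x - y"]) (simp add: inner_diff_right)
  then show "qexp x = qexp y" unfolding qexp_def
    using T.repr_independence[OF _ torus_exp_in subgroup_H] by metis
qed

lemma fixed_space_H: "fixed_space \<rho> V H = VH"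
proof -
  have "(\<forall>h\<in>H. \<rho> h v = v) \<longleftrightarrow> (\<forall>x. (\<forall>f\<in>F. f \<bullet> x \<in> \<int>) \<longrightarrow> R x v = v)" for v
  proof
    assume "\<forall>h\<in>H. \<rho> h v = v"
    then show "\<forall>x. (\<forall>f\<in>F. f \<bullet> x \<in> \<int>) \<longrightarrow> R x v = v" using torus_exp_in_H unfolding R_def by blast
  next
    assume r: "\<forall>x. (\<forall>f\<in>F. f \<bullet> x \<in> \<int>) \<longrightarrow> R x v = v"
    show "\<forall>h\<in>H. \<rho> h v = v"
    proof
      fix h assume "h \<in> H"
      moreover obtain x where "h = torus_exp n e x" using calculation H_subset carrier_T_eq by blast
      ultimately show "\<rho> h v = v" using r torus_exp_in_H[of x] unfolding R_def by blast
    qed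
  qed
  then show ?thesis unfolding fixed_space_def common_fixed_def by auto
qed

lemma VH_facts: "subspace VH" "VH \<subseteq> V" "\<And>x v. v \<in> VH \<Longrightarrow> R x v \<in> VH"
  using invariantD[OF invariant_common_fixed[of F]] by blast+

definition rH :: "(nat \<Rightarrow> complex) set \<Rightarrow> 'v \<Rightarrow> 'v" where
  "rH = induced_rep \<rho> V H"

lemma rH_qexp: "rH (qexp x) = restrict (R x) VH"
proof -
  have "restrict (\<rho> t) VH = restrict (R x) VH" if t: "t \<in> qexp x" for t
  proof -
    obtain y where y: "t = torus_exp n e (y + x)" "\<forall>f\<in>F. f \<bullet> y \<in> \<int>" using t mem_qexp_iff by blast
    have "\<rho> t v = R x v" if v: "v \<in> VH" for v
    proof -
      have "\<rho> t v = R (x + y) v" unfolding y(1) R_def by (simp add: add.commute)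
      also have "\<dots> = R x (R y v)" using v VH_facts by (intro R_plus) auto
      also have "R y v = v" using v y(2) unfolding common_fixed_def by blast
      finally show ?thesis .
    qed
    then show ?thesis by (auto simp: restrict_def)
  qed
  moreover have "torus_exp n e x \<in> qexp x" unfolding mem_qexp_iff by (intro exI[of _ 0]) simp
  ultimately have "(\<lambda>g. restrict (\<rho> g) VH) ` qexp x = {restrict (R x) VH}" by force
  then show ?thesis unfolding rH_def induced_rep_def fixed_space_H by simp
qed

lemma rH_apply: "v \<in> VH \<Longrightarrow> rH (qexp x) v = R x v"
  by (simp add: rH_qexp)

lemma restrict_R_SO: "restrict (R x) VH \<in> SO_carrier VH"
proof -
  have "bij_betw (restrict (R x) VH) VH VH"
  proof (rule bij_betw_byWitness[where f' = "R (- x)"])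
    show "\<forall>v\<in>VH. R (- x) (restrict (R x) VH v) = v" "\<forall>v\<in>VH. restrict (R x) VH (R (- x) v) = v"
      using VH_facts by auto
  qed (use VH_facts in auto)
  moreover have "restrict (R x) VH (u + v) = restrict (R x) VH u + restrict (R x) VH v"
    if "u \<in> VH" "v \<in> VH" for u v
    using that VH_facts(2) subspace_add[OF VH_facts(1) that] by (simp add: R_add subset_iff)
  moreover have "restrict (R x) VH (c *\<^sub>R v) = c *\<^sub>R restrict (R x) VH v" if "v \<in> VH" for c v
    using that VH_facts(2) subspace_scale[OF VH_facts(1) that] by (simp add: R_scale subset_iff)
  moreover have "restrict (R x) VH u \<bullet> restrict (R x) VH v = u \<bullet> v" if "u \<in> VH" "v \<in> VH" for u v
    using that VH_facts(2) by (simp add: R_inner subset_iff)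
  ultimately show ?thesis
    unfolding SO_carrier_def using det_on_R[OF invariant_common_fixed] by (simp add: Bij_def)
qed

lemma quotient_map_q: "quotient_map TT QT (\<lambda>t. H #>\<^bsub>T\<^esub> t)"
  unfolding quotient_group_top_def by (rule quotient_map_quotient_top)

lemma topspace_QT: "topspace QT = carrier Q"
  unfolding quotient_group_top_def topspace_quotient_top topspace_torus_top carrier_FactGroup ..

lemma coset_torus_exp: "t \<in> carrier T \<Longrightarrow> H #>\<^bsub>T\<^esub> t = qexp (torus_log t)"
  by (simp add: qexp_def torus_exp_torus_log)

lemma representation_rH: "SO_representation Q QT VH rH"
  unfolding SO_representation_def
proof
  show "rH \<in> hom Q (SO_group VH)"
  proof (rule homI)
    show "rH K \<in> carrier (SO_group VH)" if "K \<in> carrier Q" for K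
      using that restrict_R_SO unfolding carrier_Q by (auto simp: rH_qexp SO_group_def)
    show "rH (K \<otimes>\<^bsub>Q\<^esub> K') = rH K \<otimes>\<^bsub>SO_group VH\<^esub> rH K'" if K: "K \<in> carrier Q" "K' \<in> carrier Q" for K K'
    proof -
      obtain x y where xy: "K = qexp x" "K' = qexp y" using K unfolding carrier_Q by blast
      have "restrict (R (x + y)) VH = compose VH (restrict (R x) VH) (restrict (R y) VH)"
      proof
        fix v
        show "restrict (R (x + y)) VH v = compose VH (restrict (R x) VH) (restrict (R y) VH) v"
          using VH_facts R_plus[of v x y] by (cases "v \<in> VH") (auto simp: compose_def)
      qed
      moreover have "restrict (R x) VH \<in> Bij VH" for x using restrict_R_SO unfolding SO_carrier_def by blast
      ultimately show ?thesis
        unfolding xy qexp_add[symmetric] rH_qexp by (simp add: SO_group_def BijGroup_def)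
    qed
  qed
  show "continuous_map QT (SO_top VH) rH"
  proof (rule continuous_compose_quotient_map[OF quotient_map_q])
    have eq: "(rH \<circ> (\<lambda>t. H #>\<^bsub>T\<^esub> t)) t = restrict (\<rho> t) VH" if "t \<in> topspace TT" for t
    proof -
      have "t \<in> carrier T" using that by (simp add: topspace_torus_top)
      then show ?thesis by (simp add: coset_torus_exp rH_qexp R_def torus_exp_torus_log)
    qed
    have "continuous_map TT (SO_top VH) (\<lambda>t. restrict (\<rho> t) VH)"
      unfolding SO_top_def continuous_map_in_subtopology
    proof
      show "(\<lambda>t. restrict (\<rho> t) VH) \<in> topspace TT \<rightarrow> SO_carrier VH"
      proof
        fix t assume "t \<in> topspace TT"
        then have "t \<in> carrier T" by (simp add: topspace_torus_top)
        then have "restrict (\<rho> t) VH = restrict (R (torus_log t)) VH" by (simp add: R_def torus_exp_torus_log)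
        then show "restrict (\<rho> t) VH \<in> SO_carrier VH" using restrict_R_SO by simp
      qed
      show "continuous_map TT (product_topology (\<lambda>_. euclidean) VH) (\<lambda>t. restrict (\<rho> t) VH)"
      proof (rule continuous_map_coordinatewise_then_product)
        fix v assume v: "v \<in> VH"
        have "continuous_map TT (product_topology (\<lambda>_. euclidean) V) \<rho>"
          using rep unfolding SO_representation_def SO_top_def continuous_map_in_subtopology by blast
        then have "continuous_map TT euclidean (\<lambda>t. \<rho> t v)"
          using v VH_facts(2) by (auto simp: continuous_map_componentwise)
        then show "continuous_map TT euclidean (\<lambda>t. restrict (\<rho> t) VH v)" using v by simp
      qed simp
    qed
    then show "continuous_map TT (SO_top VH) (rH \<circ> (\<lambda>t. H #>\<^bsub>T\<^esub> t))"
      by (rule continuous_map_eq) (simp only: eq)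
  qed
qed

lemma faithful_rH: "faithful Q rH"
  unfolding faithful_def
proof (rule inj_onI)
  fix K K' assume K: "K \<in> carrier Q" "K' \<in> carrier Q" and eq: "rH K = rH K'"
  obtain x y where xy: "K = qexp x" "K' = qexp y" using K unfolding carrier_Q by blast
  have "f \<bullet> x - f \<bullet> y \<in> \<int>" if f: "f \<in> F" for f
  proof -
    have fw: "f \<in> weights" using f F_weights by blast
    define v where "v = weight_vector f"
    have v: "v \<in> wspace f" "v \<noteq> 0" using weight_vector[OF fw] unfolding v_def by auto
    then have vVH: "v \<in> VH" using wspace_common_fixed[of f F] f by blast
    then have vV: "v \<in> V" using VH_facts by blast
    have "R x v = R y v" using fun_cong[OF eq, of v] vVH unfolding xy by (simp add: rH_qexp)
    then have "R (- y) (R x v) = v" using vV by simp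
    then have "R (x - y) v = v" using R_plus[OF vV, of "- y" x] by simp
    from wspace_fixed_imp[OF v this] show ?thesis by (simp add: inner_diff_right)
  qed
  then show "K = K'" unfolding xy qexp_eq_iff by blast
qed

lemma subrepresentation_iff: "subrepresentation Q VH rH W \<longleftrightarrow> invariant W \<and> W \<subseteq> VH"
proof -
  have "(\<forall>K\<in>carrier Q. rH K ` W \<subseteq> W) \<longleftrightarrow> (\<forall>x. \<forall>w\<in>W. R x w \<in> W)" if "W \<subseteq> VH"
  proof -
    have "rH (qexp x) w = R x w" if "w \<in> W" for x w using \<open>W \<subseteq> VH\<close> that rH_apply by blast
    then show ?thesis unfolding carrier_Q by (auto simp: image_subset_iff)
  qed
  then show ?thesis unfolding subrepresentation_def invariant_def using VH_facts(2) by blast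
qed

lemma irreducible_subrep_iff: "irreducible_subrep Q VH rH W \<longleftrightarrow> irreducible W \<and> W \<subseteq> VH"
  unfolding irreducible_subrep_def irreducible_def subrepresentation_iff by blast

lemma wspace_VH: "f \<in> F \<Longrightarrow> wspace f \<subseteq> VH"
  using wspace_common_fixed by blast

lemma F_nonzero: "f \<in> F \<Longrightarrow> f \<noteq> 0"
  using F_weights unfolding weights_def by blast

lemma nontrivial_irreps_iff:
  "W \<in> nontrivial_irreps Q VH rH \<longleftrightarrow> irreducible W \<and> (\<exists>f\<in>F. W \<subseteq> wspace f)"
proof
  assume "W \<in> nontrivial_irreps Q VH rH"
  then have W: "irreducible W" "W \<subseteq> VH" and nt: "nontrivial_subrep Q rH W"
    unfolding nontrivial_irreps_def irreducible_subrep_iff by auto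
  obtain x v where xv: "v \<in> W" "R x v \<noteq> v"
    using nt W(2) rH_apply unfolding nontrivial_subrep_def carrier_Q by fastforce
  obtain a where a: "W \<subseteq> wspace a" using irreducible_in_wspace[OF W(1)] .
  have "v \<noteq> 0" using xv(2) by auto
  then obtain f where f: "f = 0 \<or> f \<in> F" "wspace a = wspace f"
    using common_fixed_weight[OF F_indep F_closed, of v a] xv(1) a W(2) by blast
  have "f \<noteq> 0" using f(2) a xv wspace_zero by blast
  then show "irreducible W \<and> (\<exists>f\<in>F. W \<subseteq> wspace f)" using W(1) f a by blast
next
  assume "irreducible W \<and> (\<exists>f\<in>F. W \<subseteq> wspace f)"
  then obtain f where W: "irreducible W" and f: "f \<in> F" "W \<subseteq> wspace f" by blast
  obtain w where w: "w \<in> W" "w \<bullet> w = 1" using irreducible_unit_vector[OF W] .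
  have WVH: "W \<subseteq> VH" using f wspace_VH by blast
  have "J f w \<bullet> w = 0" using J_orthogonal[OF F_nonzero[OF f(1)]] f w by blast
  then have "J f w \<noteq> w" using w by auto
  then have "nontrivial_subrep Q rH W"
    unfolding nontrivial_subrep_def J_def using qexp_in w(1) rH_apply WVH by (metis subsetD)
  then show "W \<in> nontrivial_irreps Q VH rH"
    unfolding nontrivial_irreps_def irreducible_subrep_iff using W WVH by blast
qed

lemma F_weight_unique:
  assumes "f \<in> F" "g \<in> F" "w \<in> wspace f" "w \<in> wspace g" "w \<noteq> 0"
  shows "f = g"
proof (rule ccontr)
  assume "f \<noteq> g"
  then have "w \<bullet> w = 0"
    using wspace_orthogonal[OF assms(3,4)] independent_not_uminus[OF F_indep assms(1,2)] by blast
  then show False using assms(5) by simp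
qed

lemma equivalent_subreps_iff:
  assumes W: "irreducible W" "f \<in> F" "W \<subseteq> wspace f" and W': "irreducible W'" "g \<in> F" "W' \<subseteq> wspace g"
  shows "equivalent_subreps Q rH W W' \<longleftrightarrow> f = g"
proof
  have WVH: "W \<subseteq> VH" "W' \<subseteq> VH" using W W' wspace_VH by blast+
  {
    assume "equivalent_subreps Q rH W W'"
    then obtain \<phi> where \<phi>: "linear \<phi>" "bij_betw \<phi> W W'"
      and eq: "\<And>K w. K \<in> carrier Q \<Longrightarrow> w \<in> W \<Longrightarrow> \<phi> (rH K w) = rH K (\<phi> w)"
      unfolding equivalent_subreps_def by blast
    have "\<phi> (R x w) = R x (\<phi> w)" if w: "w \<in> W" for x w
    proof -
      have "\<phi> w \<in> VH" using \<phi>(2) w WVH unfolding bij_betw_def by blast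
      then show ?thesis using eq[OF qexp_in w, of x] rH_apply w WVH(1) by (metis subsetD)
    qed
    moreover obtain w where w: "w \<in> W" "w \<bullet> w = 1" using irreducible_unit_vector[OF W(1)] .
    moreover have "w \<noteq> 0" using w by auto
    moreover have "subspace W" using W(1) invariantD(1) unfolding irreducible_def by blast
    ultimately have "f = g \<or> f = - g"
      using equivalent_imp_same_weight[of w W f W' g \<phi>] W(3) W'(3) \<phi> by blast
    then show "f = g" using independent_not_uminus[OF F_indep W(2) W'(2)] by blast
  }
  assume "f = g"
  then obtain \<phi> where \<phi>: "linear \<phi>" "bij_betw \<phi> W W'" "\<And>x w. w \<in> W \<Longrightarrow> \<phi> (R x w) = R x (\<phi> w)"
    using irreducible_same_weight_equivalent[OF W(1,3) W'(1)] W'(3) F_nonzero[OF W(2)] by blast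
  have "\<phi> (rH K w) = rH K (\<phi> w)" if K: "K \<in> carrier Q" and w: "w \<in> W" for K w
  proof -
    obtain x where x: "K = qexp x" using K unfolding carrier_Q by blast
    have "\<phi> w \<in> VH" using \<phi>(2) w WVH unfolding bij_betw_def by blast
    then show ?thesis using \<phi>(3)[OF w, of x] rH_apply w WVH(1) unfolding x by (metis subsetD)
  qed
  then show "equivalent_subreps Q rH W W'" unfolding equivalent_subreps_def using \<phi> by blast
qed

text \<open>
  The classes correspond to the members \<open>f\<close> of \<open>F\<close>: the class of \<open>f\<close> consists of all irreducible
  subspaces of the weight space of \<open>f\<close>.
\<close>

lemma card_nontrivial_irrep_classes: "card (nontrivial_irrep_classes Q VH rH) = card F"
proof -
  define N where "N = nontrivial_irreps Q VH rH"
  define r where "r = {(W, W'). W \<in> N \<and> W' \<in> N \<and> equivalent_subreps Q rH W W'}"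
  define cl where "cl f = {W. irreducible W \<and> W \<subseteq> wspace f}" for f
  have N: "W \<in> N \<longleftrightarrow> (\<exists>f\<in>F. W \<in> cl f)" for W unfolding N_def cl_def nontrivial_irreps_iff by blast
  have r: "r `` {W} = cl f" if "f \<in> F" "W \<in> cl f" for f W
  proof -
    have "W' \<in> r `` {W} \<longleftrightarrow> W' \<in> cl f" for W'
    proof
      assume "W' \<in> r `` {W}"
      then obtain g where g: "g \<in> F" "W' \<in> cl g" "equivalent_subreps Q rH W W'" unfolding r_def N by blast
      then have "f = g" using equivalent_subreps_iff[of W f W' g] that unfolding cl_def by blast
      then show "W' \<in> cl f" using g by simp
    next
      assume "W' \<in> cl f"
      then show "W' \<in> r `` {W}"
        using equivalent_subreps_iff[of W f W' f] that unfolding r_def N cl_def by blast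
    qed
    then show ?thesis by blast
  qed
  have ne: "\<exists>W. W \<in> cl f" if f: "f \<in> F" for f
  proof -
    have fw: "f \<in> weights" using f F_weights by blast
    have "irreducible (span {weight_vector f, J f (weight_vector f)})"
      by (rule irreducible_rotation_plane[OF F_nonzero[OF f] weight_vector[OF fw]])
    moreover have "span {weight_vector f, J f (weight_vector f)} \<subseteq> wspace f"
      using weight_vector(1)[OF fw] J_wspace invariantD(1)[OF invariant_wspace] by (intro span_minimal) auto
    ultimately show ?thesis unfolding cl_def by blast
  qed
  have "N // r = cl ` F"
  proof
    show "N // r \<subseteq> cl ` F" unfolding quotient_def using N r by blast
    show "cl ` F \<subseteq> N // r"
    proof
      fix C assume "C \<in> cl ` F"
      then obtain f where f: "f \<in> F" "C = cl f" by blast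
      then obtain W where "W \<in> cl f" using ne by blast
      then show "C \<in> N // r" unfolding f(2) using r[OF f(1)] N f(1) by (metis quotientI)
    qed
  qed
  moreover have "inj_on cl F"
  proof (rule inj_onI)
    fix f g assume fg: "f \<in> F" "g \<in> F" "cl f = cl g"
    obtain W where W: "W \<in> cl f" using ne fg by blast
    then have W': "irreducible W" "W \<subseteq> wspace f" "W \<subseteq> wspace g" using fg(3) unfolding cl_def by blast+
    obtain w where "w \<in> W" "w \<bullet> w = 1" using irreducible_unit_vector[OF W'(1)] .
    moreover have "w \<noteq> 0" using calculation by auto
    ultimately show "f = g" using F_weight_unique[OF fg(1,2)] W' by blast
  qed
  ultimately have "card (N // r) = card F" by (simp add: card_image)
  then show ?thesis unfolding nontrivial_irrep_classes_def N_def r_def .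
qed

text \<open>
  The characters in \<open>F\<close> are coordinates on the quotient; here all of them except \<open>f\<close> are trivial.
\<close>

definition coord_circle :: "'v \<Rightarrow> (nat \<Rightarrow> complex) set set" where
  "coord_circle f = qexp ` {x. \<forall>g\<in>F - {f}. g \<bullet> x \<in> \<int>}"

lemma subgroup_coord_circle: "subgroup (coord_circle f) Q"
proof (rule Q.subgroupI)
  show "coord_circle f \<subseteq> carrier Q" unfolding coord_circle_def using qexp_in by blast
  show "coord_circle f \<noteq> {}" unfolding coord_circle_def by (auto intro: exI[of _ 0])
  show "inv\<^bsub>Q\<^esub> K \<in> coord_circle f" if K: "K \<in> coord_circle f" for K
  proof -
    obtain x where x: "K = qexp x" "\<forall>g\<in>F - {f}. g \<bullet> x \<in> \<int>" using K unfolding coord_circle_def by blast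
    have "\<forall>g\<in>F - {f}. g \<bullet> (- x) \<in> \<int>" using x(2) by simp
    then show ?thesis unfolding x(1) qexp_uminus[symmetric] coord_circle_def by blast
  qed
  show "K \<otimes>\<^bsub>Q\<^esub> K' \<in> coord_circle f" if K: "K \<in> coord_circle f" "K' \<in> coord_circle f" for K K'
  proof -
    obtain x y where x: "K = qexp x" "\<forall>g\<in>F - {f}. g \<bullet> x \<in> \<int>" and y: "K' = qexp y" "\<forall>g\<in>F - {f}. g \<bullet> y \<in> \<int>"
      using K unfolding coord_circle_def by blast
    have "\<forall>g\<in>F - {f}. g \<bullet> (x + y) \<in> \<int>" using x(2) y(2) by (simp add: inner_add_right)
    then show ?thesis unfolding x(1) y(1) qexp_add[symmetric] coord_circle_def by blast
  qed
qed

text \<open>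
  The character \<open>f\<close> is constant on cosets of \<open>H\<close>, so that the image is a singleton.
\<close>

definition coset_char :: "'v \<Rightarrow> (nat \<Rightarrow> complex) set \<Rightarrow> complex" where
  "coset_char f C = the_elem (character f ` C)"

lemma coset_char_qexp:
  assumes "f \<in> F"
  shows "coset_char f (qexp x) = cis (2 * pi * (f \<bullet> x))"
proof -
  have fw: "f \<in> weights" using assms F_weights by blast
  have "character f t = cis (2 * pi * (f \<bullet> x))" if t: "t \<in> qexp x" for t
  proof -
    obtain y where y: "t = torus_exp n e (y + x)" "\<forall>f\<in>F. f \<bullet> y \<in> \<int>" using t unfolding mem_qexp_iff by blast
    have "character f t = cis (2 * pi * (f \<bullet> y)) * cis (2 * pi * (f \<bullet> x))"
      unfolding y(1) character_torus_exp[OF fw] by (simp add: cis_mult inner_add_right distrib_left)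
    also have "cis (2 * pi * (f \<bullet> y)) = 1" using y(2) assms by (simp add: cis_eq_1_iff)
    finally show ?thesis by simp
  qed
  moreover have "torus_exp n e x \<in> qexp x" unfolding mem_qexp_iff by (intro exI[of _ 0]) simp
  ultimately have "character f ` qexp x = {cis (2 * pi * (f \<bullet> x))}" by force
  then show ?thesis unfolding coset_char_def by simp
qed

lemma dual_F:
  assumes "f \<in> F"
  obtains v where "f \<bullet> v = 1" "\<And>g. g \<in> F - {f} \<Longrightarrow> g \<bullet> v = 0"
  using exists_dual_vector[OF F_indep assms] by metis

lemma bij_betw_coset_char:
  assumes f: "f \<in> F"
  shows "bij_betw (coset_char f) (coord_circle f) (sphere 0 1)"
  unfolding bij_betw_def
proof
  show "inj_on (coset_char f) (coord_circle f)"
  proof (rule inj_onI)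
    fix K K' assume K: "K \<in> coord_circle f" "K' \<in> coord_circle f" "coset_char f K = coset_char f K'"
    obtain x y where x: "K = qexp x" "\<forall>g\<in>F - {f}. g \<bullet> x \<in> \<int>" and y: "K' = qexp y" "\<forall>g\<in>F - {f}. g \<bullet> y \<in> \<int>"
      using K unfolding coord_circle_def by blast
    have "cis (2 * pi * (f \<bullet> x)) = cis (2 * pi * (f \<bullet> y))" using K(3) coset_char_qexp[OF f] unfolding x(1) y(1) by simp
    then have "cis (2 * pi * (f \<bullet> x - f \<bullet> y)) = 1" by (simp add: right_diff_distrib flip: cis_divide)
    then have "f \<bullet> x - f \<bullet> y \<in> \<int>" by (simp add: cis_eq_1_iff)
    then have "\<forall>g\<in>F. g \<bullet> x - g \<bullet> y \<in> \<int>" using x(2) y(2) by (metis Diff_iff Ints_diff singletonD)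
    then show "K = K'" unfolding x(1) y(1) qexp_eq_iff .
  qed
  show "coset_char f ` coord_circle f = sphere 0 1"
  proof
    show "coset_char f ` coord_circle f \<subseteq> sphere 0 1" unfolding coord_circle_def using coset_char_qexp[OF f] by auto
    show "sphere 0 1 \<subseteq> coset_char f ` coord_circle f"
    proof
      fix z :: complex assume "z \<in> sphere 0 1"
      then have z: "z = cis (Arg z)" by (intro unit_eq_cis_Arg) simp
      obtain v where v: "f \<bullet> v = 1" "\<And>g. g \<in> F - {f} \<Longrightarrow> g \<bullet> v = 0" using dual_F[OF f] by metis
      define x where "x = (Arg z / (2 * pi)) *\<^sub>R v"
      have "qexp x \<in> coord_circle f" unfolding coord_circle_def x_def using v(2) by auto
      moreover have "coset_char f (qexp x) = z" unfolding coset_char_qexp[OF f] x_def using v(1) z by simp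
      ultimately show "z \<in> coset_char f ` coord_circle f" by blast
    qed
  qed
qed

lemma compact_space_TT: "compact_space TT"
  unfolding torus_top_def
  by (subst compact_space_product_topology) (auto simp: compact_space_subtopology)

lemma continuous_map_coset_char:
  assumes f: "f \<in> F"
  shows "continuous_map QT circle_top (coset_char f)"
proof (rule continuous_compose_quotient_map[OF quotient_map_q])
  have fw: "f \<in> weights" using assms F_weights by blast
  have eq: "character f t = (coset_char f \<circ> (\<lambda>t. H #>\<^bsub>T\<^esub> t)) t" if "t \<in> topspace TT" for t
  proof -
    have t: "t \<in> carrier T" using that by (simp add: topspace_torus_top)
    then have "character f t = character f (torus_exp n e (torus_log t))" by (simp add: torus_exp_torus_log)
    then show ?thesis by (simp add: coset_torus_exp[OF t] coset_char_qexp[OF f] character_torus_exp[OF fw])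
  qed
  show "continuous_map TT circle_top (coset_char f \<circ> (\<lambda>t. H #>\<^bsub>T\<^esub> t))"
    by (rule continuous_map_eq[OF continuous_map_character[OF fw] eq])
qed

lemma compactin_coord_circle: "compactin QT (coord_circle f)"
proof -
  define M where "M = {t \<in> carrier T. \<forall>g\<in>F - {f}. character g t = 1}"
  have "compactin TT M"
    unfolding M_def by (intro closedin_compact_space[OF compact_space_TT] closedin_character_kernel) (use F_weights in auto)
  then have "compactin QT ((\<lambda>t. H #>\<^bsub>T\<^esub> t) ` M)"
    using image_compactin quotient_imp_continuous_map[OF quotient_map_q] by blast
  moreover have "(\<lambda>t. H #>\<^bsub>T\<^esub> t) ` M = coord_circle f"
  proof -
    have "torus_exp n e x \<in> M \<longleftrightarrow> (\<forall>g\<in>F - {f}. g \<bullet> x \<in> \<int>)" for x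
      unfolding M_def using torus_exp_in character_torus_exp F_weights by (auto simp: cis_eq_1_iff subset_iff)
    moreover have "M \<subseteq> range (torus_exp n e)" unfolding M_def carrier_T_eq by blast
    ultimately have "M = torus_exp n e ` {x. \<forall>g\<in>F - {f}. g \<bullet> x \<in> \<int>}" by blast
    then show ?thesis unfolding coord_circle_def qexp_def by (simp add: image_image)
  qed
  ultimately show ?thesis by simp
qed

text \<open>
  The character \<open>f\<close> maps the circle bijectively and continuously to the unit circle; compactness makes
  it a homeomorphism.
\<close>

lemma circle_subgroup_coord_circle:
  assumes f: "f \<in> F"
  shows "circle_subgroup Q QT (coord_circle f)"
proof -
  define X where "X = subtopology QT (coord_circle f)"
  have topX: "topspace X = coord_circle f"
    unfolding X_def topspace_subtopology topspace_QT using subgroup.subset[OF subgroup_coord_circle[of f]] by blast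
  have hom: "homeomorphic_map X circle_top (coset_char f)"
  proof (rule continuous_imp_homeomorphic_map)
    show "compact_space X" unfolding X_def by (rule compact_space_subtopology[OF compactin_coord_circle])
    show "Hausdorff_space circle_top" by (simp add: Hausdorff_space_subtopology)
    show "continuous_map X circle_top (coset_char f)"
      unfolding X_def by (rule continuous_map_from_subtopology[OF continuous_map_coset_char[OF f]])
    show "coset_char f ` topspace X = topspace circle_top" "inj_on (coset_char f) (topspace X)"
      using bij_betw_coset_char[OF f] unfolding topX bij_betw_def by auto
  qed
  then obtain \<phi> where \<phi>: "homeomorphic_maps X circle_top (coset_char f) \<phi>" unfolding homeomorphic_map_maps by blast
  have "coset_char f \<in> iso (Q\<lparr>carrier := coord_circle f\<rparr>) circle_group"
  proof (rule isoI)
    show "coset_char f \<in> hom (Q\<lparr>carrier := coord_circle f\<rparr>) circle_group"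
    proof (rule homI)
      show "coset_char f K \<in> carrier circle_group" if "K \<in> carrier (Q\<lparr>carrier := coord_circle f\<rparr>)" for K
        using that coset_char_qexp[OF f] unfolding coord_circle_def by auto
      show "coset_char f (K \<otimes>\<^bsub>Q\<lparr>carrier := coord_circle f\<rparr>\<^esub> K') = coset_char f K \<otimes>\<^bsub>circle_group\<^esub> coset_char f K'"
        if K: "K \<in> carrier (Q\<lparr>carrier := coord_circle f\<rparr>)" "K' \<in> carrier (Q\<lparr>carrier := coord_circle f\<rparr>)" for K K'
      proof -
        obtain x y where xy: "K = qexp x" "K' = qexp y" using K unfolding coord_circle_def by auto
        have "K \<otimes>\<^bsub>Q\<lparr>carrier := coord_circle f\<rparr>\<^esub> K' = qexp (x + y)" unfolding xy qexp_add by simp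
        then show ?thesis unfolding xy by (simp add: coset_char_qexp[OF f] cis_mult inner_add_right distrib_left)
      qed
    qed
    show "bij_betw (coset_char f) (carrier (Q\<lparr>carrier := coord_circle f\<rparr>)) (carrier circle_group)"
      using bij_betw_coset_char[OF f] by simp
  qed
  moreover have "group (Q\<lparr>carrier := coord_circle f\<rparr>)"
    by (rule subgroup.subgroup_is_group[OF subgroup_coord_circle Q.is_group])
  ultimately have "inv_into (coord_circle f) (coset_char f) \<in> iso circle_group (Q\<lparr>carrier := coord_circle f\<rparr>)"
    using group.iso_set_sym by fastforce
  moreover have "homeomorphic_map circle_top X (inv_into (coord_circle f) (coset_char f))"
  proof (rule homeomorphic_map_eq)
    show "homeomorphic_map circle_top X \<phi>" using \<phi> unfolding homeomorphic_maps_map by blast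
    fix z assume z: "z \<in> topspace circle_top"
    have cont: "continuous_map circle_top X \<phi>" and inv: "\<forall>y\<in>topspace circle_top. coset_char f (\<phi> y) = y"
      using \<phi> unfolding homeomorphic_maps_def by blast+
    have "\<phi> z \<in> coord_circle f" using continuous_map_funspace[OF cont] z unfolding topX by (rule funcset_mem)
    moreover have "coset_char f (\<phi> z) = z" using inv z by blast
    ultimately show "\<phi> z = inv_into (coord_circle f) (coset_char f) z"
      using bij_betw_coset_char[OF f] unfolding bij_betw_def by (metis inv_into_f_f)
  qed
  ultimately show ?thesis unfolding circle_subgroup_def X_def using subgroup_coord_circle by blast
qed

text \<open>
  The point with coordinate \<open>f\<close> equal to \<open>- 1\<close> and all others trivial lies on one circle only.
\<close>

lemma inj_coord_circle: "inj_on coord_circle F"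
proof (rule inj_onI, rule ccontr)
  fix f g assume fg: "f \<in> F" "g \<in> F" "coord_circle f = coord_circle g" "f \<noteq> g"
  obtain v where v: "f \<bullet> v = 1" "\<And>g. g \<in> F - {f} \<Longrightarrow> g \<bullet> v = 0" using dual_F[OF fg(1)] by metis
  have "qexp ((1/2) *\<^sub>R v) \<in> coord_circle f" unfolding coord_circle_def using v(2) by auto
  then have "qexp ((1/2) *\<^sub>R v) \<in> coord_circle g" using fg(3) by simp
  then obtain y where y: "qexp ((1/2) *\<^sub>R v) = qexp y" "\<forall>h\<in>F - {g}. h \<bullet> y \<in> \<int>"
    unfolding coord_circle_def by (elim imageE) simp
  have "f \<bullet> y \<in> \<int>" using y(2) fg by blast
  moreover have "f \<bullet> ((1/2) *\<^sub>R v) - f \<bullet> y \<in> \<int>" using y(1) fg(1) unfolding qexp_eq_iff by blast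
  ultimately have "(1/2 - f \<bullet> y) + f \<bullet> y \<in> \<int>" using v(1) by (intro Ints_add) simp_all
  then have "(1/2::real) \<in> \<int>" by simp
  then show False using half_not_Ints by contradiction
qed

lemma fixed_space_coord_circle: "fixed_space rH VH (coord_circle f) = VH \<inter> common_fixed (F - {f})"
  unfolding fixed_space_def coord_circle_def common_fixed_def[of "F - {f}"]
  using rH_apply VH_facts(2) by auto

text \<open>
  The vectors fixed by the circle of \<open>f\<close> comprise the isotypic components of all members of \<open>F\<close> other
  than \<open>f\<close>, so two different circles account for all components.
\<close>

lemma transverse_coord_circle:
  assumes fg: "f \<in> F" "g \<in> F" "f \<noteq> g"
  shows "transverse_in VH (fixed_space rH VH (coord_circle f)) (fixed_space rH VH (coord_circle g))"
proof -
  define A where "A f = VH \<inter> common_fixed (F - {f})" for f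
  have subA: "subspace (A f)" for f
    unfolding A_def using VH_facts(1) invariantD(1)[OF invariant_common_fixed] by (rule subspace_inter)
  have in_A: "wspace h \<subseteq> A f" if "h = 0 \<or> h \<in> F - {f}" for h f
    unfolding A_def using wspace_common_fixed[of h F] wspace_common_fixed[of h "F - {f}"] that by blast
  define S where "S = {a + b |a b. a \<in> A f \<and> b \<in> A g}"
  have subS: "subspace S" unfolding S_def by (rule subspace_sums[OF subA subA])
  have AS: "A f \<subseteq> S" "A g \<subseteq> S"
  proof -
    show "A f \<subseteq> S" unfolding S_def using subspace_0[OF subA[of g]] by force
    show "A g \<subseteq> S" unfolding S_def using subspace_0[OF subA[of f]] by force
  qed
  have "wspace 0 \<union> (\<Union>h\<in>F. wspace h) \<subseteq> S"
  proof -
    have "wspace h \<subseteq> S" if "h = 0 \<or> h \<in> F" for h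
      using in_A[of h f] in_A[of h g] that AS fg(3) by blast
    then show ?thesis by blast
  qed
  then have "VH \<subseteq> S"
    unfolding common_fixed_eq_span[OF F_indep F_closed, simplified] by (rule span_minimal[OF _ subS])
  moreover have "S \<subseteq> VH"
    unfolding S_def A_def by (auto intro: subspace_add[OF VH_facts(1)])
  ultimately have "S = VH" by (rule subset_antisym[rotated])
  then show ?thesis unfolding transverse_in_def fixed_space_coord_circle S_def A_def .
qed

end

section \<open>The splitting theorem\<close>

theorem mainTheorem7:
  fixes d :: nat
    and V :: "'v::euclidean_space set"
    and \<rho> :: "(nat \<Rightarrow> complex) \<Rightarrow> 'v \<Rightarrow> 'v"
  assumes "subspace V"
    and "SO_representation (torus (2 * d + 1)) (torus_top (2 * d + 1)) V \<rho>"
    and "faithful (torus (2 * d + 1)) \<rho>"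
  shows "\<exists>H. closed_subgroup_of_dim d (torus (2 * d + 1)) (torus_top (2 * d + 1)) H \<and>
    (let Q = torus (2 * d + 1) Mod H;
         Q_top = quotient_group_top (torus (2 * d + 1)) (torus_top (2 * d + 1)) H;
         VH = fixed_space \<rho> V H;
         \<rho>H = induced_rep \<rho> V H
     in SO_representation Q Q_top VH \<rho>H \<and>
        faithful Q \<rho>H \<and>
        card (nontrivial_irrep_classes Q VH \<rho>H) = d + 1 \<and>
        (\<exists>\<C>. card \<C> = d + 1 \<and>
             (\<forall>C\<in>\<C>. circle_subgroup Q Q_top C) \<and>
             pairwise (\<lambda>C C'. transverse_in VH (fixed_space \<rho>H VH C) (fixed_space \<rho>H VH C')) \<C>))"
proof -
  define n where "n = 2 * d + 1"
  have "n \<le> DIM('v)" unfolding n_def by (rule torus_rank_le_DIM[OF assms])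
  obtain e where e: "bij_betw e {0..<DIM('v)} (Basis::'v set)" using ex_bij_betw_nat_finite[OF finite_Basis] by blast
  have eB: "e i \<in> Basis" if "i < n" for i using e that \<open>n \<le> DIM('v)\<close> by (auto simp: bij_betw_def)
  have e_inj: "e i \<noteq> e j" if "i < n" "j < n" "i \<noteq> j" for i j
    using e that \<open>n \<le> DIM('v)\<close> by (auto simp: bij_betw_def inj_on_def)
  interpret tr: torus_rep n V \<rho> e
    by unfold_locales (use assms eB e_inj in \<open>auto simp: n_def inner_Basis\<close>)
  have "dim tr.weights = n"
  proof -
    have "e ` {..<n} \<subseteq> Basis" using eB by blast
    then have "independent (e ` {..<n})" using independent_Basis independent_mono by blast
    moreover have "inj_on e {..<n}" using e_inj by (auto simp: inj_on_def)
    ultimately have "dim (e ` {..<n}) = n" by (simp add: dim_eq_card_independent card_image)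
    then show ?thesis using tr.span_weights by (metis dim_span)
  qed
  then obtain F where F: "F \<subseteq> tr.weights" "independent F" "card F = d + 1"
    "\<And>a. a \<in> tr.weights \<Longrightarrow> a \<in> int_span F \<Longrightarrow> a = 0 \<or> a \<in> F \<or> - a \<in> F"
    using half_rank_int_closed_independent[OF tr.finite_weights tr.weights_uminus, of "d + 1"] n_def by auto
  interpret ts: torus_split n V \<rho> e F
  proof
    show "e i \<bullet> e i = 1" if "i < n" for i using eB[OF that] by (simp add: inner_Basis)
    show "a \<in> F \<or> - a \<in> F" if "a \<in> tr.weights" "a \<in> int_span F" for a
      using F(4)[OF that] that(1) unfolding tr.weights_def by blast
  qed (use F in auto)
  have "dim ts.lie_H = d" using ts.dim_lie_H F(3) n_def by simp
  then have "closed_subgroup_of_dim d (torus n) (torus_top n) ts.H"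
    unfolding closed_subgroup_of_dim_def using ts.subgroup_H ts.closedin_H ts.locally_euclidean_H by simp
  moreover have "card (ts.coord_circle ` F) = d + 1" using ts.inj_coord_circle F(3) by (simp add: card_image)
  moreover have "pairwise (\<lambda>C C'. transverse_in ts.VH (fixed_space ts.rH ts.VH C) (fixed_space ts.rH ts.VH C')) (ts.coord_circle ` F)"
    using ts.transverse_coord_circle unfolding pairwise_def by blast
  ultimately show ?thesis
    using ts.representation_rH ts.faithful_rH ts.card_nontrivial_irrep_classes F(3) ts.circle_subgroup_coord_circle
    unfolding n_def[symmetric] Let_def ts.fixed_space_H ts.rH_def
    by (intro exI[of _ ts.H]) (auto simp: ts.fixed_space_H)
qed

end
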